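(* Let $\lambda\in\mathbb{C}$ with $|\lambda|=1$, let $\mathcal{A}$ be the non-commutative torus with unitary generators $U,V$ satisfying $UV=\lambda VU$, and let $\mathcal{A}_0$ be the $*$-subalgebra generated by $U$ and $V$. Fix $c_1,c_2\in\mathbb{C}$ and let $$\phi:\mathcal{A}_0\to\mathcal{A}_0\otimes\mathcal{B}(\mathbb{C}^3);\quad x\mapsto\begin{bmatrix}\tau(x)&\overline{c_1}\,\delta_1^\dagger(x)&\overline{c_2}\,\delta_2^\dagger(x)\\ c_1\,\delta_1(x)&0&0\\ c_2\,\delta_2(x)&0&0\end{bmatrix},$$ where $\delta_1,\delta_2,\tau:\mathcal{A}_0\to\mathcal{A}_0$ are the linear maps such that, for all $m,n\in\mathbb{Z}$, $$\delta_1(U^mV^n)=mU^mV^n,\quad\delta_2(U^mV^n)=nU^mV^n,\quad\tau(U^mV^n)=-\tfrac12\bigl(|c_1|^2m^2+|c_2|^2n^2\bigr)U^mV^n,$$ and $\delta_i^\dagger(x):=\delta_i(x^* )^*$ (so $\delta_i^\dagger=-\delta_i$). There exists an adapted family $j=(j_t)_{t\ge0}$ of unital $*$-homomorphisms from $\mathcal{A}$ to $\mathcal{B}(\mathsf{h}\bar\otimes\mathcal{F})$ such that $$\langle u\varepsilon(f),j_t(x)v\varepsilon(g)\rangle=\langle u\varepsilon(f),(xv)\varepsilon(g)\rangle+\int_0^t\langle u\varepsilon(f),j_s\bigl(\phi^{\widehat{f}(s)}_{\widehat{g}(s)}(x)\bigr)v\varepsilon(g)\rangle\,ds$$ for all $u,v\in\mathsf{h}$,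 $f,g\in L^2(\mathbb{R}_+;\mathbb{C}^2)$, $x\in\mathcal{A}_0$ and $t\ge0$.
   Context: The non-commutative torus is the universal $C^*$-algebra generated by unitaries $U$ and $V$ satisfying $UV=\lambda VU$; $\{U^mV^n:m,n\in\mathbb{Z}\}$ is a basis of $\mathcal{A}_0$. It is identified with a $C^*$-subalgebra of $\mathcal{B}(\mathsf{h})$, $\mathsf{h}:=\ell^2(\mathbb{Z}^2)$, via $(Uu)_{m,n}=u_{m+1,n}$ and $(Vu)_{m,n}=\lambda^mu_{m,n+1}$. Inner products are linear in the second variable; $\otimes$ is the algebraic and $\bar\otimes$ the Hilbert-space tensor product; $|\xi\rangle:\lambda\mapsto\lambda\xi$, $\langle\xi|:\eta\mapsto\langle\xi,\eta\rangle$. The multiplicity space is $\mathsf{k}=\mathbb{C}^2$ and $\widehat{\mathsf{k}}=\mathbb{C}\oplus\mathsf{k}=\mathbb{C}^3$. For $\xi,\chi\in\widehat{\mathsf{k}}$, $\phi^\xi_\chi(x):=(1_{\mathsf{h}}\otimes\langle\xi|)\phi(x)(1_{\mathsf{h}}\otimes|\chi\rangle)$. $\mathcal{F}$ is Boson Fock space over $L^2(\mathbb{R}_+;\mathsf{k})$ with exponential vectors $\varepsilon(f)$, $\langle\varepsilon(f),\varepsilon(g)\rangle=e^{\langle f,g\rangle}$; $u\varepsilon(f):=u\otimes\varepsilon(f)$; $\widehat{f}(t):=(1,f(t))\in\widehat{\mathsf{k}}$; $f_{t)}:=1_{[0,t)}f$, $f_{[t}:=1_{[t,\infty)}f$. Adapted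 means $\langle u\varepsilon(f),j_t(a)v\varepsilon(g)\rangle=\langle u\varepsilon(f_{t)}),j_t(a)v\varepsilon(g_{t)})\rangle\langle\varepsilon(f_{[t}),\varepsilon(g_{[t})\rangle$ for all $u,v,f,g,t$ and $a\in\mathcal{A}$. *)

theory Defs
  imports "HOL-Analysis.Analysis"
begin

section \<open>Complex inner product spaces\<close>

class scaleC =
  fixes scaleC :: "complex \<Rightarrow> 'a \<Rightarrow> 'a"  (infixr \<open>*\<^sub>C\<close> 75)

class complex_vector = real_vector + scaleC +
  assumes scaleC_add_right: "a *\<^sub>C (x + y) = a *\<^sub>C x + a *\<^sub>C y"
    and scaleC_add_left: "(a + b) *\<^sub>C x = a *\<^sub>C x + b *\<^sub>C x"
    and scaleC_scaleC: "a *\<^sub>C (b *\<^sub>C x) = (a * b) *\<^sub>C x"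
    and scaleC_one: "1 *\<^sub>C x = x"
    and scaleR_scaleC: "r *\<^sub>R x = complex_of_real r *\<^sub>C x"

class complex_normed_vector = complex_vector + real_normed_vector +
  assumes norm_scaleC: "norm (a *\<^sub>C x) = cmod a * norm x"

text \<open>The complex inner product is linear in the second variable; its real part is the
  inner product of \<^class>\<open>real_inner\<close>, which supplies norm, topology and positive
  definiteness.\<close>

class complex_inner = complex_vector + real_inner +
  fixes cinner :: "'a \<Rightarrow> 'a \<Rightarrow> complex"
  assumes cinner_commute: "cinner x y = cnj (cinner y x)"
    and cinner_add_right: "cinner x (y + z) = cinner x y + cinner x z"
    and cinner_scaleC_right: "cinner x (c *\<^sub>C y) = c * cinner x y"
    and inner_eq_Re_cinner: "inner x y = Re (cinner x y)"
begin

lemma cinner_add_left: "cinner (x + y) z = cinner x z + cinner y z"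
  by (subst (1 2 3) cinner_commute) (simp add: cinner_add_right)

lemma cinner_scaleC_left: "cinner (c *\<^sub>C x) y = cnj c * cinner x y"
  by (subst (1 2) cinner_commute) (simp add: cinner_scaleC_right)

lemma cinner_same: "cinner x x = complex_of_real ((norm x)\<^sup>2)"
proof (rule complex_eqI)
  have "Im (cinner x x) = - Im (cinner x x)"
    by (subst (1) cinner_commute) simp
  thus "Im (cinner x x) = Im (complex_of_real ((norm x)\<^sup>2))" by simp
  show "Re (cinner x x) = Re (complex_of_real ((norm x)\<^sup>2))"
    by (simp add: inner_eq_Re_cinner[symmetric] power2_norm_eq_inner)
qed

lemma norm_scaleC_inner: "norm (a *\<^sub>C x) = cmod a * norm x"
proof -
  have "complex_of_real ((norm (a *\<^sub>C x))\<^sup>2) = a * (cnj a * cinner x x)"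
    unfolding cinner_same[symmetric] cinner_scaleC_left cinner_scaleC_right ..
  also have "\<dots> = complex_of_real ((cmod a)\<^sup>2) * complex_of_real ((norm x)\<^sup>2)"
    using complex_norm_square[of a] by (simp only: cinner_same mult.assoc)
  finally have "(norm (a *\<^sub>C x))\<^sup>2 = (cmod a)\<^sup>2 * (norm x)\<^sup>2"
    unfolding of_real_mult[symmetric] of_real_eq_iff .
  hence "(norm (a *\<^sub>C x))\<^sup>2 = (cmod a * norm x)\<^sup>2"
    unfolding power_mult_distrib .
  thus ?thesis by (rule power2_eq_imp_eq) auto
qed

subclass complex_normed_vector
  by standard (rule norm_scaleC_inner)

lemma norm_cinner_le: "cmod (cinner x y) \<le> norm x * norm y"
proof (cases "cinner x y = 0")
  case False
  define c where "c = cnj (sgn (cinner x y))"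
  have c: "cmod c = 1" using False by (simp add: c_def norm_sgn)
  have "c * cinner x y = complex_of_real (cmod (cinner x y))"
    using False complex_norm_square[of "cinner x y"]
    by (simp add: c_def sgn_eq field_simps power2_eq_square)
  hence "cmod (cinner x y) = inner x (c *\<^sub>C y)"
    by (simp add: inner_eq_Re_cinner cinner_scaleC_right)
  also have "\<dots> \<le> norm x * norm (c *\<^sub>C y)" by (rule norm_cauchy_schwarz)
  finally show ?thesis using c by (simp add: norm_scaleC_inner)
qed simp

end

instantiation complex :: complex_inner
begin
definition "scaleC_complex = ((*) :: complex \<Rightarrow> complex \<Rightarrow> complex)"
definition "cinner_complex (x::complex) y = cnj x * y"
instance
  by standard (auto simp: scaleC_complex_def cinner_complex_def algebra_simps
      scaleR_conv_of_real inner_complex_def)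
end


section \<open>Square-summable families\<close>

text \<open>The Hilbert space \<open>\<ell>\<^sup>2('i; 'k)\<close> of square-summable families of vectors of \<open>'k\<close>.
  With \<open>'k = complex\<close> this is \<open>\<ell>\<^sup>2('i)\<close>; in general it is the Hilbert-space tensor product
  of \<open>\<ell>\<^sup>2('i)\<close> and \<open>'k\<close>, with elementary tensors given by \<open>tensor\<close> below.\<close>

typedef (overloaded) ('i, 'k) ell2 = "{x :: 'i \<Rightarrow> 'k::complex_inner. (\<lambda>i. (norm (x i))\<^sup>2) summable_on UNIV}"
  morphisms ell2_nth Abs_ell2
  by (rule exI[of _ "\<lambda>_. 0"]) simp

setup_lifting type_definition_ell2

lemma norm_add_square_le:
  fixes a b :: "'a::real_normed_vector"
  shows "(norm (a + b))\<^sup>2 \<le> 2 * (norm a)\<^sup>2 + 2 * (norm b)\<^sup>2"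
proof -
  have "(norm (a + b))\<^sup>2 \<le> (norm a + norm b)\<^sup>2"
    by (intro power_mono norm_triangle_ineq) auto
  also have "\<dots> \<le> 2 * (norm a)\<^sup>2 + 2 * (norm b)\<^sup>2"
    using sum_squares_bound[of "norm a" "norm b"] by (simp add: power2_sum)
  finally show ?thesis .
qed

lemma cinner_le_squares: "cmod (cinner a b) \<le> (norm a)\<^sup>2 + (norm b)\<^sup>2"
proof -
  have "2 * (norm a * norm b) \<le> (norm a)\<^sup>2 + (norm b)\<^sup>2"
    using sum_squares_bound[of "norm a" "norm b"] by (simp add: mult.assoc)
  moreover have "0 \<le> norm a * norm b" by simp
  ultimately show ?thesis using norm_cinner_le[of a b] by linarith
qed

lemma ell2_cinner_summable:
  assumes "(\<lambda>i. (norm (x i))\<^sup>2) summable_on UNIV" "(\<lambda>i. (norm (y i))\<^sup>2) summable_on UNIV"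
  shows "(\<lambda>i. cinner (x i) (y i)) summable_on UNIV"
proof -
  have "(\<lambda>i. (norm (x i))\<^sup>2 + (norm (y i))\<^sup>2) summable_on UNIV"
    using assms by (rule summable_on_add)
  hence "(\<lambda>i. cmod (cinner (x i) (y i))) summable_on UNIV"
    by (rule summable_on_comparison_test) (auto simp: cinner_le_squares)
  thus ?thesis by (rule abs_summable_summable)
qed

instantiation ell2 :: (type, complex_inner) complex_inner
begin

lift_definition zero_ell2 :: "('a, 'b) ell2" is "\<lambda>_. 0" by simp

lift_definition plus_ell2 :: "('a, 'b) ell2 \<Rightarrow> ('a, 'b) ell2 \<Rightarrow> ('a, 'b) ell2"
  is "\<lambda>x y i. x i + y i"
proof -
  fix x y :: "'a \<Rightarrow> 'b"
  assume "(\<lambda>i. (norm (x i))\<^sup>2) summable_on UNIV" "(\<lambda>i. (norm (y i))\<^sup>2) summable_on UNIV"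
  hence "(\<lambda>i. 2 * (norm (x i))\<^sup>2 + 2 * (norm (y i))\<^sup>2) summable_on UNIV"
    by (intro summable_on_add summable_on_cmult_right)
  thus "(\<lambda>i. (norm (x i + y i))\<^sup>2) summable_on UNIV"
    by (rule summable_on_comparison_test) (auto simp: norm_add_square_le)
qed

lift_definition uminus_ell2 :: "('a, 'b) ell2 \<Rightarrow> ('a, 'b) ell2" is "\<lambda>x i. - x i" by simp

definition "minus_ell2 (x :: ('a, 'b) ell2) y = x + - y"

lift_definition scaleC_ell2 :: "complex \<Rightarrow> ('a, 'b) ell2 \<Rightarrow> ('a, 'b) ell2"
  is "\<lambda>c x i. c *\<^sub>C x i"
  by (simp add: norm_scaleC power_mult_distrib summable_on_cmult_right)

definition "scaleR_ell2 r (x :: ('a, 'b) ell2) = complex_of_real r *\<^sub>C x"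

lift_definition cinner_ell2 :: "('a, 'b) ell2 \<Rightarrow> ('a, 'b) ell2 \<Rightarrow> complex"
  is "\<lambda>x y. \<Sum>\<^sub>\<infinity>i. cinner (x i) (y i)" .

definition "inner_ell2 (x :: ('a, 'b) ell2) y = Re (cinner x y)"
definition "norm_ell2 (x :: ('a, 'b) ell2) = sqrt (inner x x)"
definition "dist_ell2 (x :: ('a, 'b) ell2) y = norm (x - y)"
definition "sgn_ell2 (x :: ('a, 'b) ell2) = inverse (norm x) *\<^sub>R x"
definition [code del]: "(uniformity :: (('a, 'b) ell2 \<times> ('a, 'b) ell2) filter) =
  (INF e\<in>{0 <..}. principal {(x, y). dist x y < e})"
definition [code del]: "open (S :: ('a, 'b) ell2 set) =
  (\<forall>x\<in>S. \<forall>\<^sub>F (x', y) in uniformity. x' = x \<longrightarrow> y \<in> S)"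

instance
proof
  fix x y z :: "('a, 'b) ell2" and a b :: complex and r s :: real
  show "x + y + z = x + (y + z)" "x + y = y + x" "0 + x = x" "- x + x = 0"
    by (transfer; simp add: algebra_simps fun_eq_iff)+
  show "x - y = x + - y" by (simp add: minus_ell2_def)
  show c1: "a *\<^sub>C (x + y) = a *\<^sub>C x + a *\<^sub>C y" for a x and y :: "('a, 'b) ell2"
    by transfer (simp add: scaleC_add_right)
  show c2: "(a + b) *\<^sub>C x = a *\<^sub>C x + b *\<^sub>C x" for a b and x :: "('a, 'b) ell2"
    by transfer (simp add: scaleC_add_left)
  show c3: "a *\<^sub>C (b *\<^sub>C x) = (a * b) *\<^sub>C x" for a b and x :: "('a, 'b) ell2"
    by transfer (simp add: scaleC_scaleC)
  show c4: "1 *\<^sub>C x = x" for x :: "('a, 'b) ell2"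
    by transfer (simp add: scaleC_one)
  show "r *\<^sub>R x = complex_of_real r *\<^sub>C x" by (simp add: scaleR_ell2_def)
  show "r *\<^sub>R (x + y) = r *\<^sub>R x + r *\<^sub>R y" "(r + s) *\<^sub>R x = r *\<^sub>R x + s *\<^sub>R x"
    "r *\<^sub>R (s *\<^sub>R x) = (r * s) *\<^sub>R x" "1 *\<^sub>R x = x"
    by (simp_all add: scaleR_ell2_def c1 c2 c3 c4)
  show i1: "cinner x y = cnj (cinner y x)" for x y :: "('a, 'b) ell2"
  proof transfer
    fix x y :: "'a \<Rightarrow> 'b"
    have "(\<Sum>\<^sub>\<infinity>i. cinner (x i) (y i)) = (\<Sum>\<^sub>\<infinity>i. cnj (cinner (y i) (x i)))"
      by (intro infsum_cong cinner_commute)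
    also have "\<dots> = cnj (\<Sum>\<^sub>\<infinity>i. cinner (y i) (x i))" by simp
    finally show "(\<Sum>\<^sub>\<infinity>i. cinner (x i) (y i)) = cnj (\<Sum>\<^sub>\<infinity>i. cinner (y i) (x i))" .
  qed
  show i2: "cinner x (y + z) = cinner x y + cinner x z" for x y z :: "('a, 'b) ell2"
    by transfer (simp add: cinner_add_right infsum_add ell2_cinner_summable)
  show i3: "cinner x (a *\<^sub>C y) = a * cinner x y" for a and x y :: "('a, 'b) ell2"
    by transfer (simp add: cinner_scaleC_right infsum_cmult_right ell2_cinner_summable)
  show "inner x y = Re (cinner x y)" by (simp add: inner_ell2_def)
  show sym: "inner x y = inner y x" for x y :: "('a, 'b) ell2"
    using i1[of x y] by (simp add: inner_ell2_def)
  have "inner z (x + y) = inner z x + inner z y"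
    by (simp add: inner_ell2_def i2)
  thus "inner (x + y) z = inner x z + inner y z"
    by (simp only: sym[of _ z])
  have "inner y (r *\<^sub>R x) = r * inner y x"
    by (simp add: inner_ell2_def scaleR_ell2_def i3)
  thus "inner (r *\<^sub>R x) y = r * inner x y"
    by (simp only: sym[of _ y])
  have sm: "(\<lambda>i. (norm (ell2_nth x i))\<^sup>2) summable_on UNIV" using ell2_nth[of x] by simp
  have sq: "cinner x x = complex_of_real (\<Sum>\<^sub>\<infinity>i. (norm (ell2_nth x i))\<^sup>2)"
    unfolding cinner_ell2.rep_eq cinner_same
    by (intro infsumI has_sum_of_real has_sum_infsum sm)
  show "0 \<le> inner x x" by (simp add: inner_ell2_def sq infsum_nonneg)
  show "inner x x = 0 \<longleftrightarrow> x = 0"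
  proof
    assume "inner x x = 0"
    hence "(\<Sum>\<^sub>\<infinity>i. (norm (ell2_nth x i))\<^sup>2) = 0" by (simp add: inner_ell2_def sq)
    hence "(norm (ell2_nth x i))\<^sup>2 = 0" for i
      using nonneg_infsum_le_0D[of "\<lambda>i. (norm (ell2_nth x i))\<^sup>2" UNIV i] sm by simp
    thus "x = 0" by (intro ell2_nth_inject[THEN iffD1]) (simp add: fun_eq_iff zero_ell2.rep_eq)
  next
    assume "x = 0"
    thus "inner x x = 0" using sq by (simp add: inner_ell2_def zero_ell2.rep_eq)
  qed
  show "norm x = sqrt (inner x x)" by (rule norm_ell2_def)
  show "dist x y = norm (x - y)" by (rule dist_ell2_def)
  show "sgn x = inverse (norm x) *\<^sub>R x" by (rule sgn_ell2_def)
qed (rule uniformity_ell2_def open_ell2_def)+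

end

lift_definition tensor :: "('i, complex) ell2 \<Rightarrow> 'k::complex_inner \<Rightarrow> ('i, 'k) ell2"
  is "\<lambda>u k i. u i *\<^sub>C k"
  by (simp add: norm_scaleC power_mult_distrib summable_on_cmult_left)

lemma cinner_tensor: "cinner (tensor u k) (tensor v l) = cinner u v * cinner k l"
proof transfer
  fix u v :: "'i \<Rightarrow> complex" and k l :: "'k::complex_inner"
  assume "(\<lambda>i. (norm (u i))\<^sup>2) summable_on UNIV" "(\<lambda>i. (norm (v i))\<^sup>2) summable_on UNIV"
  hence "(\<lambda>i. cinner (u i) (v i)) summable_on UNIV" by (rule ell2_cinner_summable)
  moreover have "cinner (u i *\<^sub>C k) (v i *\<^sub>C l) = cinner (u i) (v i) * cinner k l" for i
    by (simp add: cinner_scaleC_left cinner_scaleC_right cinner_complex_def)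
  ultimately show "(\<Sum>\<^sub>\<infinity>i. cinner (u i *\<^sub>C k) (v i *\<^sub>C l)) = (\<Sum>\<^sub>\<infinity>i. cinner (u i) (v i)) * cinner k l"
    by (simp add: infsum_cmult_left)
qed


section \<open>Boson Fock space over \<open>L\<^sup>2(\<real>\<^sub>+; \<complex>\<^sup>2)\<close>\<close>

definition half_line :: "real measure" where
  "half_line = restrict_space lborel {0..}"

text \<open>Square-integrable functions; no quotient by almost-everywhere equality is taken here.
  Values at negative arguments are irrelevant.\<close>

definition L2_half_line :: "(real \<Rightarrow> complex^2) set" where
  "L2_half_line = {f. f \<in> borel_measurable half_line \<and> integrable half_line (\<lambda>t. (norm (f t))\<^sup>2)}"

definition L2_cinner :: "(real \<Rightarrow> complex^2) \<Rightarrow> (real \<Rightarrow> complex^2) \<Rightarrow> complex" where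
  "L2_cinner f g = (\<integral>t. (\<Sum>k\<in>UNIV. cnj (f t $ k) * g t $ k) \<partial>half_line)"

text \<open>\<open>L\<^sup>2(\<real>\<^sub>+; \<complex>\<^sup>2)\<close> is \<open>L\<^sup>2\<close> of \<open>\<real>\<^sub>+ \<times> {1, 2}\<close>, so its \<open>n\<close>-th symmetric tensor power is the space
  of symmetric functions in \<open>L\<^sup>2((\<real>\<^sub>+ \<times> {1, 2})\<^sup>n)\<close>, and the Fock space is the Hilbert sum of
  these spaces over \<open>n\<close>.\<close>

definition one_particle :: "(real \<times> 2) measure" where
  "one_particle = half_line \<Otimes>\<^sub>M count_space UNIV"

abbreviation n_particle :: "nat \<Rightarrow> (nat \<Rightarrow> real \<times> 2) measure" where
  "n_particle n \<equiv> Pi\<^sub>M {..<n} (\<lambda>_. one_particle)"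

text \<open>Symmetry is required at every point rather than almost everywhere: averaging over
  permutations turns an almost everywhere symmetric function into an equivalent
  symmetric one, so the equivalence classes are the same.\<close>

definition fock_function :: "(nat \<Rightarrow> (nat \<Rightarrow> real \<times> 2) \<Rightarrow> complex) \<Rightarrow> bool" where
  "fock_function \<Phi> \<longleftrightarrow>
    (\<forall>n. \<Phi> n \<in> borel_measurable (n_particle n)) \<and>
    (\<forall>n. integrable (n_particle n) (\<lambda>w. (norm (\<Phi> n w))\<^sup>2)) \<and>
    summable (\<lambda>n. \<integral>w. (norm (\<Phi> n w))\<^sup>2 \<partial>n_particle n) \<and>
    (\<forall>n p. p permutes {..<n} \<longrightarrow> (\<forall>w\<in>space (n_particle n). \<Phi> n (w \<circ> p) = \<Phi> n w))"

definition fock_eq :: "(nat \<Rightarrow> (nat \<Rightarrow> real \<times> 2) \<Rightarrow> complex) \<Rightarrow> (nat \<Rightarrow> (nat \<Rightarrow> real \<times> 2) \<Rightarrow> complex) \<Rightarrow> bool" where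
  "fock_eq \<Phi> \<Psi> \<longleftrightarrow> fock_function \<Phi> \<and> fock_function \<Psi> \<and> (\<forall>n. AE w in n_particle n. \<Phi> n w = \<Psi> n w)"

lemma fock_function_zero: "fock_function (\<lambda>_ _. 0)"
  by (simp add: fock_function_def)

quotient_type fock = "nat \<Rightarrow> (nat \<Rightarrow> real \<times> 2) \<Rightarrow> complex" / partial: fock_eq
proof (rule part_equivpI)
  show "\<exists>x. fock_eq x x"
    using fock_function_zero by (auto simp: fock_eq_def)
  show "symp fock_eq"
    by (auto simp: symp_def fock_eq_def eq_commute)
  show "transp fock_eq"
  proof (rule transpI)
    fix x y z assume "fock_eq x y" "fock_eq y z"
    hence *: "AE w in n_particle n. x n w = y n w" "AE w in n_particle n. y n w = z n w"
      and "fock_function x" "fock_function z" for n by (auto simp: fock_eq_def)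
    have "AE w in n_particle n. x n w = z n w" for n
      using *[of n] by eventually_elim simp
    with \<open>fock_function x\<close> \<open>fock_function z\<close> show "fock_eq x z" by (simp add: fock_eq_def)
  qed
qed

lemma cnj_borel: "cnj \<in> borel_measurable borel"
  by (intro borel_measurable_continuous_onI continuous_intros)

lemma L2_cnj_mult:
  fixes a b :: "'x \<Rightarrow> complex"
  assumes [measurable]: "a \<in> borel_measurable M" "b \<in> borel_measurable M"
    and "integrable M (\<lambda>w. (norm (a w))\<^sup>2)" "integrable M (\<lambda>w. (norm (b w))\<^sup>2)"
  shows "integrable M (\<lambda>w. cnj (a w) * b w)"
    and "norm (\<integral>w. cnj (a w) * b w \<partial>M) \<le> (\<integral>w. (norm (a w))\<^sup>2 \<partial>M) + (\<integral>w. (norm (b w))\<^sup>2 \<partial>M)"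
proof -
  note cnj_borel[measurable]
  have int: "integrable M (\<lambda>w. (norm (a w))\<^sup>2 + (norm (b w))\<^sup>2)"
    using assms by simp
  have le: "norm (cnj (a w) * b w) \<le> (norm (a w))\<^sup>2 + (norm (b w))\<^sup>2" for w
    using cinner_le_squares[of "a w" "b w"] by (simp add: cinner_complex_def)
  show *: "integrable M (\<lambda>w. cnj (a w) * b w)"
    by (rule Bochner_Integration.integrable_bound[OF int]) (use le in auto)
  have "norm (\<integral>w. cnj (a w) * b w \<partial>M) \<le> (\<integral>w. norm (cnj (a w) * b w) \<partial>M)"
    by (rule integral_norm_bound)
  also have "\<dots> \<le> (\<integral>w. (norm (a w))\<^sup>2 + (norm (b w))\<^sup>2 \<partial>M)"
    by (rule integral_mono) (use * int le in auto)
  also have "\<dots> = (\<integral>w. (norm (a w))\<^sup>2 \<partial>M) + (\<integral>w. (norm (b w))\<^sup>2 \<partial>M)"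
    using assms by simp
  finally show "norm (\<integral>w. cnj (a w) * b w \<partial>M) \<le> (\<integral>w. (norm (a w))\<^sup>2 \<partial>M) + (\<integral>w. (norm (b w))\<^sup>2 \<partial>M)" .
qed

lemma fock_functionD:
  assumes "fock_function x"
  shows "x n \<in> borel_measurable (n_particle n)"
    and "integrable (n_particle n) (\<lambda>w. (norm (x n w))\<^sup>2)"
    and "summable (\<lambda>n. \<integral>w. (norm (x n w))\<^sup>2 \<partial>n_particle n)"
  using assms by (simp_all add: fock_function_def)

lemma fock_function_add:
  assumes "fock_function x" "fock_function y"
  shows "fock_function (\<lambda>n w. x n w + y n w)"
proof -
  note x = fock_functionD[OF assms(1)] and y = fock_functionD[OF assms(2)]
  have m: "(\<lambda>w. x n w + y n w) \<in> borel_measurable (n_particle n)" for n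
    by (intro borel_measurable_add x y)
  have i: "integrable (n_particle n) (\<lambda>w. 2 * (norm (x n w))\<^sup>2 + 2 * (norm (y n w))\<^sup>2)" for n
    by (intro Bochner_Integration.integrable_add integrable_mult_right x y)
  have j: "integrable (n_particle n) (\<lambda>w. (norm (x n w + y n w))\<^sup>2)" for n
    by (rule Bochner_Integration.integrable_bound[OF i])
       (use m[of n] in \<open>simp_all add: norm_add_square_le\<close>)
  have "(\<integral>w. (norm (x n w + y n w))\<^sup>2 \<partial>n_particle n)
     \<le> 2 * (\<integral>w. (norm (x n w))\<^sup>2 \<partial>n_particle n) + 2 * (\<integral>w. (norm (y n w))\<^sup>2 \<partial>n_particle n)" for n
  proof -
    have "(\<integral>w. (norm (x n w + y n w))\<^sup>2 \<partial>n_particle n)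
      \<le> (\<integral>w. 2 * (norm (x n w))\<^sup>2 + 2 * (norm (y n w))\<^sup>2 \<partial>n_particle n)"
      by (intro integral_mono i j norm_add_square_le)
    also have "\<dots> = 2 * (\<integral>w. (norm (x n w))\<^sup>2 \<partial>n_particle n) + 2 * (\<integral>w. (norm (y n w))\<^sup>2 \<partial>n_particle n)"
      by (simp add: x(2) y(2))
    finally show ?thesis .
  qed
  moreover have "summable (\<lambda>n. 2 * (\<integral>w. (norm (x n w))\<^sup>2 \<partial>n_particle n) + 2 * (\<integral>w. (norm (y n w))\<^sup>2 \<partial>n_particle n))"
    by (intro summable_add summable_mult x y)
  ultimately have "summable (\<lambda>n. \<integral>w. (norm (x n w + y n w))\<^sup>2 \<partial>n_particle n)"
    by (intro summable_comparison_test'[of _ 0 "\<lambda>n. \<integral>w. (norm (x n w + y n w))\<^sup>2 \<partial>n_particle n"])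
       simp_all
  thus ?thesis using assms j m by (simp add: fock_function_def)
qed

lemma fock_function_scale:
  assumes "fock_function x"
  shows "fock_function (\<lambda>n w. c * x n w)"
  using assms
  by (simp add: fock_function_def norm_mult power_mult_distrib summable_mult borel_measurable_times)

lemma fock_cinner_summable:
  assumes "fock_function x" "fock_function y"
  shows "integrable (n_particle n) (\<lambda>w. cnj (x n w) * y n w)"
    and "summable (\<lambda>n. \<integral>w. cnj (x n w) * y n w \<partial>n_particle n)"
proof -
  note x = fock_functionD[OF assms(1)] and y = fock_functionD[OF assms(2)]
  show "integrable (n_particle n) (\<lambda>w. cnj (x n w) * y n w)"
    by (rule L2_cnj_mult(1)[OF x(1) y(1) x(2) y(2)])
  have "summable (\<lambda>n. (\<integral>w. (norm (x n w))\<^sup>2 \<partial>n_particle n) + (\<integral>w. (norm (y n w))\<^sup>2 \<partial>n_particle n))"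
    by (intro summable_add x y)
  thus "summable (\<lambda>n. \<integral>w. cnj (x n w) * y n w \<partial>n_particle n)"
    by (rule summable_comparison_test'[of _ 0]) (rule L2_cnj_mult(2)[OF x(1) y(1) x(2) y(2)])
qed

instantiation fock :: complex_inner
begin

lift_definition zero_fock :: fock is "\<lambda>_ _. 0"
  by (simp add: fock_eq_def fock_function_zero)

lift_definition plus_fock :: "fock \<Rightarrow> fock \<Rightarrow> fock" is "\<lambda>x y n w. x n w + y n w"
proof -
  fix x x' y y' assume *: "fock_eq x x'" "fock_eq y y'"
  have "AE w in n_particle n. x n w + y n w = x' n w + y' n w" for n
  proof -
    have "AE w in n_particle n. x n w = x' n w" "AE w in n_particle n. y n w = y' n w"
      using * by (auto simp: fock_eq_def)
    thus ?thesis by eventually_elim simp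
  qed
  thus "fock_eq (\<lambda>n w. x n w + y n w) (\<lambda>n w. x' n w + y' n w)"
    using * by (simp add: fock_eq_def fock_function_add)
qed

lift_definition scaleC_fock :: "complex \<Rightarrow> fock \<Rightarrow> fock" is "\<lambda>c x n w. c * x n w"
proof -
  fix c x x' assume *: "fock_eq x x'"
  have "AE w in n_particle n. c * x n w = c * x' n w" for n
  proof -
    have "AE w in n_particle n. x n w = x' n w" using * by (simp add: fock_eq_def)
    thus ?thesis by eventually_elim simp
  qed
  thus "fock_eq (\<lambda>n w. c * x n w) (\<lambda>n w. c * x' n w)"
    using * by (simp add: fock_eq_def fock_function_scale)
qed

definition "uminus_fock (x :: fock) = (-1) *\<^sub>C x"
definition "minus_fock (x :: fock) y = x + - y"
definition "scaleR_fock r (x :: fock) = complex_of_real r *\<^sub>C x"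

lift_definition cinner_fock :: "fock \<Rightarrow> fock \<Rightarrow> complex"
  is "\<lambda>x y. \<Sum>n. \<integral>w. cnj (x n w) * y n w \<partial>n_particle n"
proof -
  fix x x' y y' assume *: "fock_eq x x'" "fock_eq y y'"
  have "(\<integral>w. cnj (x n w) * y n w \<partial>n_particle n) = (\<integral>w. cnj (x' n w) * y' n w \<partial>n_particle n)" for n
  proof (rule integral_cong_AE)
    have "AE w in n_particle n. x n w = x' n w" "AE w in n_particle n. y n w = y' n w"
      using * by (auto simp: fock_eq_def)
    thus "AE w in n_particle n. cnj (x n w) * y n w = cnj (x' n w) * y' n w"
      by eventually_elim simp
  qed (use * in \<open>auto simp: fock_eq_def intro!: borel_measurable_integrable fock_cinner_summable\<close>)
  thus "(\<Sum>n. \<integral>w. cnj (x n w) * y n w \<partial>n_particle n) = (\<Sum>n. \<integral>w. cnj (x' n w) * y' n w \<partial>n_particle n)"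
    by simp
qed

definition "inner_fock (x :: fock) y = Re (cinner x y)"
definition "norm_fock (x :: fock) = sqrt (inner x x)"
definition "dist_fock (x :: fock) y = norm (x - y)"
definition "sgn_fock (x :: fock) = inverse (norm x) *\<^sub>R x"
definition [code del]: "(uniformity :: (fock \<times> fock) filter) =
  (INF e\<in>{0 <..}. principal {(x, y). dist x y < e})"
definition [code del]: "open (S :: fock set) =
  (\<forall>x\<in>S. \<forall>\<^sub>F (x', y) in uniformity. x' = x \<longrightarrow> y \<in> S)"

instance
proof
  fix x y z :: fock and r s :: real
  have eqI: "fock_eq u v" if "u = v" "fock_function v" for u v
    using that by (simp add: fock_eq_def)
  have ff: "fock_function u" if "fock_eq u u" for u using that by (simp add: fock_eq_def)
  note ffs = fock_function_add fock_function_scale fock_function_zero ff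
  show "x + y + z = x + (y + z)" "x + y = y + x" "0 + x = x"
    by (transfer; rule eqI; simp add: ffs algebra_simps)+
  show "- x + x = 0"
    unfolding uminus_fock_def by (transfer; rule eqI; simp add: fock_function_zero)
  show "x - y = x + - y" by (simp add: minus_fock_def)
  show c1: "a *\<^sub>C (x + y) = a *\<^sub>C x + a *\<^sub>C y" for a and x y :: fock
    by (transfer; rule eqI; simp add: ffs algebra_simps)
  show c2: "(a + b) *\<^sub>C x = a *\<^sub>C x + b *\<^sub>C x" for a b and x :: fock
    by (transfer; rule eqI; simp add: ffs algebra_simps)
  show c3: "a *\<^sub>C (b *\<^sub>C x) = (a * b) *\<^sub>C x" for a b and x :: fock
    by (transfer; rule eqI; simp add: ffs algebra_simps)
  show c4: "1 *\<^sub>C x = x" for x :: fock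
    by (transfer; rule eqI; simp add: ffs)
  show "r *\<^sub>R x = complex_of_real r *\<^sub>C x" by (simp add: scaleR_fock_def)
  show "r *\<^sub>R (x + y) = r *\<^sub>R x + r *\<^sub>R y" "(r + s) *\<^sub>R x = r *\<^sub>R x + s *\<^sub>R x"
    "r *\<^sub>R (s *\<^sub>R x) = (r * s) *\<^sub>R x" "1 *\<^sub>R x = x"
    by (simp_all add: scaleR_fock_def c1 c2 c3 c4)
  show i1: "cinner x y = cnj (cinner y x)" for x y :: fock
  proof transfer
    fix x y assume "fock_eq x x" "fock_eq y y"
    hence s: "summable (\<lambda>n. \<integral>w. cnj (y n w) * x n w \<partial>n_particle n)"
      by (intro fock_cinner_summable ff)
    have "(\<integral>w. cnj (x n w) * y n w \<partial>n_particle n)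
        = cnj (\<integral>w. cnj (y n w) * x n w \<partial>n_particle n)" for n
      unfolding Bochner_Integration.integral_cnj[symmetric]
      by (rule Bochner_Integration.integral_cong) (simp_all only: complex_cnj_mult complex_cnj_cnj mult.commute)
    hence "(\<Sum>n. \<integral>w. cnj (x n w) * y n w \<partial>n_particle n)
        = (\<Sum>n. cnj (\<integral>w. cnj (y n w) * x n w \<partial>n_particle n))"
      by (rule suminf_cong)
    also have "\<dots> = cnj (\<Sum>n. \<integral>w. cnj (y n w) * x n w \<partial>n_particle n)"
      by (rule sums_unique[symmetric]) (use s in \<open>simp add: sums_cnj summable_sums\<close>)
    finally show "(\<Sum>n. \<integral>w. cnj (x n w) * y n w \<partial>n_particle n)
        = cnj (\<Sum>n. \<integral>w. cnj (y n w) * x n w \<partial>n_particle n)" .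
  qed
  show i2: "cinner x (y + z) = cinner x y + cinner x z" for x y z :: fock
    by transfer (simp add: ff distrib_left fock_cinner_summable suminf_add[symmetric])
  show i3: "cinner x (a *\<^sub>C y) = a * cinner x y" for a and x y :: fock
  proof transfer
    fix a x y assume "fock_eq x x" "fock_eq y y"
    hence xy: "fock_function x" "fock_function y" by (auto intro: ff)
    have "(\<integral>w. cnj (x n w) * (a * y n w) \<partial>n_particle n) = a * (\<integral>w. cnj (x n w) * y n w \<partial>n_particle n)" for n
      by (subst mult.left_commute) (rule integral_mult_right_zero)
    thus "(\<Sum>n. \<integral>w. cnj (x n w) * (a * y n w) \<partial>n_particle n)
        = a * (\<Sum>n. \<integral>w. cnj (x n w) * y n w \<partial>n_particle n)"
      by (simp add: suminf_mult fock_cinner_summable xy)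
  qed
  show "inner x y = Re (cinner x y)" by (simp add: inner_fock_def)
  show sym: "inner x y = inner y x" for x y :: fock
    using i1[of x y] by (simp add: inner_fock_def)
  have "inner z (x + y) = inner z x + inner z y"
    by (simp add: inner_fock_def i2)
  thus "inner (x + y) z = inner x z + inner y z"
    by (simp only: sym[of _ z])
  have "inner y (r *\<^sub>R x) = r * inner y x"
    by (simp add: inner_fock_def scaleR_fock_def i3)
  thus "inner (r *\<^sub>R x) y = r * inner x y"
    by (simp only: sym[of _ y])
  have sq: "(\<Sum>n. \<integral>w. cnj (x n w) * x n w \<partial>n_particle n)
      = complex_of_real (\<Sum>n. \<integral>w. (norm (x n w))\<^sup>2 \<partial>n_particle n)" if "fock_function x" for x
  proof -
    have "cnj (x n w) * x n w = complex_of_real ((norm (x n w))\<^sup>2)" for n w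
      using complex_norm_square[of "x n w"] by (simp add: mult.commute)
    thus ?thesis using that
      by (simp add: fock_function_def suminf_of_real del: of_real_power)
  qed
  show "0 \<le> inner x x" unfolding inner_fock_def
    by transfer (auto simp: sq ff fock_function_def fock_eq_def intro!: suminf_nonneg)
  show "inner x x = 0 \<longleftrightarrow> x = 0" unfolding inner_fock_def
  proof transfer
    fix x assume "fock_eq x x"
    hence x: "fock_function x" by (rule ff)
    hence sm: "summable (\<lambda>n. \<integral>w. (norm (x n w))\<^sup>2 \<partial>n_particle n)"
      and int: "integrable (n_particle n) (\<lambda>w. (norm (x n w))\<^sup>2)" for n
      by (auto simp: fock_function_def)
    have "Re (\<Sum>n. \<integral>w. cnj (x n w) * x n w \<partial>n_particle n) = 0
      \<longleftrightarrow> (\<forall>n. (\<integral>w. (norm (x n w))\<^sup>2 \<partial>n_particle n) = 0)"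
      using suminf_eq_zero_iff[OF sm] by (simp add: sq x)
    also have "\<dots> \<longleftrightarrow> (\<forall>n. AE w in n_particle n. x n w = 0)"
      using integral_nonneg_eq_0_iff_AE[OF int] by simp
    finally show "Re (\<Sum>n. \<integral>w. cnj (x n w) * x n w \<partial>n_particle n) = 0 \<longleftrightarrow> fock_eq x (\<lambda>_ _. 0)"
      using x by (simp add: fock_eq_def fock_function_zero)
  qed
  show "norm x = sqrt (inner x x)" by (rule norm_fock_def)
  show "dist x y = norm (x - y)" by (rule dist_fock_def)
  show "sgn x = inverse (norm x) *\<^sub>R x" by (rule sgn_fock_def)
qed (rule uniformity_fock_def open_fock_def)+

end

text \<open>The exponential vector of \<open>f\<close> has \<open>n\<close>-particle component \<open>(n!)\<^bsup>-1/2\<^esup>\<close> times the \<open>n\<close>-th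
  tensor power of \<open>f\<close>.\<close>

definition exp_vec :: "(real \<Rightarrow> complex^2) \<Rightarrow> fock" where
  "exp_vec f = abs_fock (\<lambda>n w. (\<Prod>i<n. f (fst (w i)) $ snd (w i)) / complex_of_real (sqrt (fact n)))"

lemma sigma_finite_half_line: "sigma_finite_measure half_line"
  unfolding half_line_def
  by (rule sigma_finite_measure_restrict_space[OF sigma_finite_lborel]) simp

lemma one_particle_facts:
  assumes f: "f \<in> L2_half_line" and g: "g \<in> L2_half_line"
  shows "(\<lambda>p. f (fst p) $ snd p) \<in> borel_measurable one_particle"
    and "integrable one_particle (\<lambda>p. cnj (f (fst p) $ snd p) * g (fst p) $ snd p)"
    and "(\<integral>p. cnj (f (fst p) $ snd p) * g (fst p) $ snd p \<partial>one_particle) = L2_cinner f g"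
proof -
  interpret pair_sigma_finite half_line "count_space (UNIV :: 2 set)"
    unfolding pair_sigma_finite_def
    using sigma_finite_half_line by (auto intro: sigma_finite_measure_count_space_finite)
  have comp: "(\<lambda>t. h t $ k) \<in> borel_measurable half_line"
    if "h \<in> L2_half_line" for h :: "real \<Rightarrow> complex^2" and k
  proof -
    have [measurable]: "h \<in> borel_measurable half_line" using that by (simp add: L2_half_line_def)
    have [measurable]: "(\<lambda>v :: complex^2. v $ k) \<in> borel_measurable borel"
      by (intro borel_measurable_continuous_onI continuous_intros)
    show ?thesis by measurable
  qed
  have meas: "(\<lambda>p. h (fst p) $ snd p) \<in> borel_measurable one_particle"
    if "h \<in> L2_half_line" for h :: "real \<Rightarrow> complex^2"
    unfolding one_particle_def
    by (rule measurable_compose_countable'[where g = snd and I = UNIV])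
       (auto intro!: measurable_compose[OF measurable_fst comp[OF that]] countable_finite)
  have sq: "integrable half_line (\<lambda>t. (norm (h t $ k))\<^sup>2)"
    if "h \<in> L2_half_line" for h :: "real \<Rightarrow> complex^2" and k
  proof -
    have "integrable half_line (\<lambda>t. (norm (h t))\<^sup>2)" using that by (simp add: L2_half_line_def)
    thus ?thesis
      by (rule Bochner_Integration.integrable_bound)
         (use comp[OF that] in \<open>auto intro!: power_mono Finite_Cartesian_Product.norm_nth_le\<close>)
  qed
  have int: "integrable half_line (\<lambda>t. cnj (f t $ k) * g t $ k)" for k
    by (intro L2_cnj_mult comp sq f g)
  show "(\<lambda>p. f (fst p) $ snd p) \<in> borel_measurable one_particle" by (rule meas[OF f])
  have m[measurable]: "(\<lambda>p. cnj (f (fst p) $ snd p) * g (fst p) $ snd p)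
      \<in> borel_measurable (half_line \<Otimes>\<^sub>M count_space UNIV)"
    using measurable_compose[OF meas[OF f] cnj_borel] meas[OF g] unfolding one_particle_def
    by (rule borel_measurable_times)
  show I: "integrable one_particle (\<lambda>p. cnj (f (fst p) $ snd p) * g (fst p) $ snd p)"
    unfolding one_particle_def
    by (rule Fubini_integrable[OF m])
       (use int in \<open>auto simp: lebesgue_integral_count_space_finite integrable_count_space\<close>)
  show "(\<integral>p. cnj (f (fst p) $ snd p) * g (fst p) $ snd p \<partial>one_particle) = L2_cinner f g"
    using integral_fst'[OF I[unfolded one_particle_def]]
    by (simp add: one_particle_def L2_cinner_def lebesgue_integral_count_space_finite)
qed

lemma n_particle_facts:
  assumes f: "f \<in> L2_half_line" and g: "g \<in> L2_half_line"
  shows "integrable (n_particle n) (\<lambda>w. cnj (\<Prod>i<n. f (fst (w i)) $ snd (w i)) * (\<Prod>i<n. g (fst (w i)) $ snd (w i)))"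
    and "(\<integral>w. cnj (\<Prod>i<n. f (fst (w i)) $ snd (w i)) * (\<Prod>i<n. g (fst (w i)) $ snd (w i)) \<partial>n_particle n)
      = L2_cinner f g ^ n"
proof -
  have "sigma_finite_measure one_particle"
    unfolding one_particle_def
    by (intro sigma_finite_pair_measure sigma_finite_half_line sigma_finite_measure_count_space_finite) simp
  then interpret product_sigma_finite "\<lambda>_ :: nat. one_particle"
    by (simp add: product_sigma_finite_def)
  have eq: "cnj (\<Prod>i<n. f (fst (w i)) $ snd (w i)) * (\<Prod>i<n. g (fst (w i)) $ snd (w i))
     = (\<Prod>i<n. cnj (f (fst (w i)) $ snd (w i)) * g (fst (w i)) $ snd (w i))" for w
    by (simp add: prod.distrib)
  show "integrable (n_particle n) (\<lambda>w. cnj (\<Prod>i<n. f (fst (w i)) $ snd (w i)) * (\<Prod>i<n. g (fst (w i)) $ snd (w i)))"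
    unfolding eq
    by (rule product_integrable_prod[where f = "\<lambda>_ p. cnj (f (fst p) $ snd p) * g (fst p) $ snd p"])
       (auto intro: one_particle_facts f g)
  show "(\<integral>w. cnj (\<Prod>i<n. f (fst (w i)) $ snd (w i)) * (\<Prod>i<n. g (fst (w i)) $ snd (w i)) \<partial>n_particle n)
      = L2_cinner f g ^ n"
    unfolding eq
    by (subst product_integral_prod[where f = "\<lambda>_ p. cnj (f (fst p) $ snd p) * g (fst p) $ snd p"])
       (auto simp: one_particle_facts f g)
qed

lemma fock_function_exp_vec:
  assumes f: "f \<in> L2_half_line"
  shows "fock_function (\<lambda>n w. (\<Prod>i<n. f (fst (w i)) $ snd (w i)) / complex_of_real (sqrt (fact n)))"
    (is "fock_function ?F")
proof -
  define P where "P = (\<lambda>(n::nat) w. \<Prod>i<n. f (fst (w i)) $ snd (w i))"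
  have F: "?F = (\<lambda>n w. P n w / complex_of_real (sqrt (fact n)))" by (simp add: P_def)
  have m: "P n \<in> borel_measurable (n_particle n)" for n
    unfolding P_def
    by (intro borel_measurable_prod measurable_compose[OF _ one_particle_facts(1)[OF f f]] measurable_component_singleton) simp
  have c: "cnj (P n w) * P n w = complex_of_real ((norm (P n w))\<^sup>2)" for n w
    using complex_norm_square[of "P n w"] by (simp add: mult.commute)
  have i: "integrable (n_particle n) (\<lambda>w. (norm (P n w))\<^sup>2)" for n
  proof -
    have "integrable (n_particle n) (\<lambda>w. cnj (P n w) * P n w)"
      unfolding P_def by (rule n_particle_facts(1)[OF f f])
    thus ?thesis unfolding c complex_of_real_integrable_eq .
  qed
  have "L2_cinner f f = (\<integral>p. complex_of_real ((norm (f (fst p) $ snd p))\<^sup>2) \<partial>one_particle)"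
    unfolding one_particle_facts(3)[OF f f, symmetric]
    by (intro Bochner_Integration.integral_cong refl)
       (simp only: complex_norm_square mult.commute)
  also have "\<dots> = complex_of_real (\<integral>p. (norm (f (fst p) $ snd p))\<^sup>2 \<partial>one_particle)"
    by (rule integral_complex_of_real)
  finally obtain q where q: "L2_cinner f f = complex_of_real q" by blast
  have "complex_of_real (\<integral>w. (norm (P n w))\<^sup>2 \<partial>n_particle n) = complex_of_real (q ^ n)" for n
  proof -
    have "(\<integral>w. cnj (P n w) * P n w \<partial>n_particle n) = complex_of_real q ^ n"
      unfolding P_def q[symmetric] by (rule n_particle_facts(2)[OF f f])
    hence "complex_of_real (\<integral>w. (norm (P n w))\<^sup>2 \<partial>n_particle n) = complex_of_real q ^ n"
      unfolding c integral_complex_of_real .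
    thus ?thesis by (simp only: of_real_power[of q])
  qed
  hence v: "(\<integral>w. (norm (P n w))\<^sup>2 \<partial>n_particle n) = q ^ n" for n
    unfolding of_real_eq_iff .
  have e: "(norm (P n w / complex_of_real (sqrt (fact n))))\<^sup>2 = (norm (P n w))\<^sup>2 / fact n" for n w
    by (simp add: norm_divide power_divide)
  have "summable (\<lambda>n. q ^ n / fact n)"
    using summable_exp[of q] by (simp add: field_simps)
  moreover have "P n (w \<circ> p) = P n w" if "p permutes {..<n}" for n w p
    unfolding P_def using prod.permute[OF that, of "\<lambda>i. f (fst (w i)) $ snd (w i)"]
    by (simp add: o_def)
  ultimately show ?thesis
    unfolding F fock_function_def e using m i by (auto simp: v)
qed

lemma cinner_exp_vec:
  assumes f: "f \<in> L2_half_line" and g: "g \<in> L2_half_line"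
  shows "cinner (exp_vec f) (exp_vec g) = exp (L2_cinner f g)"
proof -
  let ?F = "\<lambda>f n w. (\<Prod>i<n. f (fst (w i)) $ snd (w i)) / complex_of_real (sqrt (fact n))"
  have "fock_eq (?F f) (?F f)" "fock_eq (?F g) (?F g)"
    using fock_function_exp_vec f g by (auto simp: fock_eq_def)
  hence "cinner (exp_vec f) (exp_vec g) = (\<Sum>n. \<integral>w. cnj (?F f n w) * ?F g n w \<partial>n_particle n)"
    unfolding exp_vec_def by (rule cinner_fock.abs_eq)
  also have "\<dots> = (\<Sum>n. L2_cinner f g ^ n / fact n)"
  proof (rule suminf_cong)
    fix n :: nat
    have sq: "complex_of_real (sqrt (fact n)) * complex_of_real (sqrt (fact n)) = fact n"
      unfolding of_real_mult[symmetric] by simp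
    have "cnj (?F f n w) * ?F g n w
       = (cnj (\<Prod>i<n. f (fst (w i)) $ snd (w i)) * (\<Prod>i<n. g (fst (w i)) $ snd (w i))) / fact n" for w
      unfolding complex_cnj_divide complex_cnj_complex_of_real times_divide_times_eq sq ..
    thus "(\<integral>w. cnj (?F f n w) * ?F g n w \<partial>n_particle n) = L2_cinner f g ^ n / fact n"
      by (simp only: integral_divide_zero n_particle_facts(2)[OF f g])
  qed
  also have "\<dots> = exp (L2_cinner f g)"
    by (simp add: exp_def scaleR_conv_of_real field_simps)
  finally show ?thesis .
qed


section \<open>Operators\<close>

text \<open>The type \<open>'a \<Rightarrow>\<^sub>L 'b\<close> consists of bounded real-linear maps. Operators on complex spaces
  are those satisfying \<open>complex_linear\<close>; all operators constructed below do.\<close>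

definition complex_linear :: "('a::complex_normed_vector \<Rightarrow>\<^sub>L 'b::complex_normed_vector) \<Rightarrow> bool" where
  "complex_linear T \<longleftrightarrow> (\<forall>c x. T (c *\<^sub>C x) = c *\<^sub>C T x)"

lemma bounded_linear_scaleC: "bounded_linear (\<lambda>x :: 'a::complex_normed_vector. c *\<^sub>C x)"
  by (rule bounded_linear_intro[where K = "cmod c"])
     (simp_all add: scaleC_add_right scaleR_scaleC scaleC_scaleC norm_scaleC mult.commute)

instantiation blinfun :: (real_normed_vector, complex_normed_vector) complex_vector
begin

lift_definition scaleC_blinfun :: "complex \<Rightarrow> ('a \<Rightarrow>\<^sub>L 'b) \<Rightarrow> ('a \<Rightarrow>\<^sub>L 'b)"
  is "\<lambda>c T x. c *\<^sub>C T x"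
  by (rule bounded_linear_compose[OF bounded_linear_scaleC])

instance
  by standard
     (transfer; simp add: scaleC_add_right scaleC_add_left scaleC_scaleC scaleC_one scaleR_scaleC)+

end

definition adjoint_op :: "('a::complex_inner \<Rightarrow>\<^sub>L 'a) \<Rightarrow> ('a \<Rightarrow>\<^sub>L 'a)" where
  "adjoint_op T = (THE S :: 'a \<Rightarrow>\<^sub>L 'a. \<forall>x y. cinner (S x) y = cinner x (T y))"

lemma adjoint_opI:
  fixes S T :: "'a::complex_inner \<Rightarrow>\<^sub>L 'a"
  assumes "\<And>x y. cinner (S x) y = cinner x (T y)"
  shows "adjoint_op T = S"
  unfolding adjoint_op_def
proof (rule the_equality)
  fix R :: "'a \<Rightarrow>\<^sub>L 'a" assume R: "\<forall>x y. cinner (R x) y = cinner x (T y)"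
  have "inner (R x) y = inner (S x) y" for x y
    using R assms by (simp add: inner_eq_Re_cinner)
  thus "R = S" by (intro blinfun_eqI) (metis inner_commute vector_eq_rdot)
qed (use assms in blast)

inductive_set star_subalgebra :: "('a::complex_inner \<Rightarrow>\<^sub>L 'a) set \<Rightarrow> ('a \<Rightarrow>\<^sub>L 'a) set"
  for G :: "('a \<Rightarrow>\<^sub>L 'a) set"
where
  generator: "a \<in> G \<Longrightarrow> a \<in> star_subalgebra G"
| add: "a \<in> star_subalgebra G \<Longrightarrow> b \<in> star_subalgebra G \<Longrightarrow> a + b \<in> star_subalgebra G"
| scale: "a \<in> star_subalgebra G \<Longrightarrow> c *\<^sub>C a \<in> star_subalgebra G"
| mult: "a \<in> star_subalgebra G \<Longrightarrow> b \<in> star_subalgebra G \<Longrightarrow> a o\<^sub>L b \<in> star_subalgebra G"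
| star: "a \<in> star_subalgebra G \<Longrightarrow> adjoint_op a \<in> star_subalgebra G"

definition complex_linear_on :: "'a::complex_vector set \<Rightarrow> ('a \<Rightarrow> 'b::complex_vector) \<Rightarrow> bool" where
  "complex_linear_on S d \<longleftrightarrow>
    (\<forall>a\<in>S. \<forall>b\<in>S. d (a + b) = d a + d b) \<and> (\<forall>c. \<forall>a\<in>S. d (c *\<^sub>C a) = c *\<^sub>C d a)"

definition unital_star_hom ::
  "('a::complex_inner \<Rightarrow>\<^sub>L 'a) set \<Rightarrow> (('a \<Rightarrow>\<^sub>L 'a) \<Rightarrow> ('b::complex_inner \<Rightarrow>\<^sub>L 'b)) \<Rightarrow> bool" where
  "unital_star_hom A j \<longleftrightarrow>
    (\<forall>a\<in>A. complex_linear (j a)) \<and>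
    complex_linear_on A j \<and>
    j id_blinfun = id_blinfun \<and>
    (\<forall>a\<in>A. \<forall>b\<in>A. j (a o\<^sub>L b) = j a o\<^sub>L j b) \<and>
    (\<forall>a\<in>A. j (adjoint_op a) = adjoint_op (j a))"

definition unitary_zpow :: "('a::complex_inner \<Rightarrow>\<^sub>L 'a) \<Rightarrow> int \<Rightarrow> ('a \<Rightarrow>\<^sub>L 'a)" where
  "unitary_zpow T m =
    (if 0 \<le> m then (((o\<^sub>L) T) ^^ nat m) id_blinfun
     else (((o\<^sub>L) (adjoint_op T)) ^^ nat (- m)) id_blinfun)"


section \<open>The non-commutative torus\<close>

type_synonym h = "(int \<times> int, complex) ell2"

text \<open>Boundedness of the map defining \<open>torus_V\<close> needs \<open>|\<lambda>| = 1\<close>, which is therefore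
  a hypothesis wherever \<open>torus_V\<close> is used.\<close>

definition torus_U :: "h \<Rightarrow>\<^sub>L h" where
  "torus_U = Blinfun (\<lambda>u. Abs_ell2 (\<lambda>(m, n). ell2_nth u (m + 1, n)))"

definition torus_V :: "complex \<Rightarrow> (h \<Rightarrow>\<^sub>L h)" where
  "torus_V lam = Blinfun (\<lambda>u. Abs_ell2 (\<lambda>(m, n). lam powi m * ell2_nth u (m, n + 1)))"

lemma ell2_eqI: "(\<And>i. ell2_nth u i = ell2_nth v i) \<Longrightarrow> u = v"
  by (metis ell2_nth_inject ext)

lemma weighted_shift:
  fixes w :: "'i \<Rightarrow> complex" and s :: "'i \<Rightarrow> 'i"
  assumes w: "\<And>i. cmod (w i) = 1" and s: "bij s"
  defines "T \<equiv> \<lambda>u. Abs_ell2 (\<lambda>i. w i * ell2_nth u (s i))"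
  shows "ell2_nth (T u) i = w i * ell2_nth u (s i)" and "bounded_linear T"
proof -
  have *: "(\<lambda>i. (norm (w i * ell2_nth u (s i)))\<^sup>2) summable_on UNIV
      \<and> (\<Sum>\<^sub>\<infinity>i. (norm (w i * ell2_nth u (s i)))\<^sup>2) = (\<Sum>\<^sub>\<infinity>i. (norm (ell2_nth u i))\<^sup>2)" for u
    using summable_on_reindex_bij_betw[OF s, of "\<lambda>i. (norm (ell2_nth u i))\<^sup>2"]
      infsum_reindex_bij_betw[OF s, of "\<lambda>i. (norm (ell2_nth u i))\<^sup>2"] ell2_nth[of u]
    by (simp add: norm_mult w)
  show nth: "ell2_nth (T u) i = w i * ell2_nth u (s i)" for u i
    unfolding T_def using * by (subst Abs_ell2_inverse) auto
  have n: "(norm u)\<^sup>2 = (\<Sum>\<^sub>\<infinity>i. (norm (ell2_nth u i))\<^sup>2)" for u :: "('i, complex) ell2"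
  proof -
    have "complex_of_real ((norm u)\<^sup>2) = (\<Sum>\<^sub>\<infinity>i. complex_of_real ((norm (ell2_nth u i))\<^sup>2))"
      unfolding cinner_same[symmetric] cinner_ell2.rep_eq ..
    also have "\<dots> = complex_of_real (\<Sum>\<^sub>\<infinity>i. (norm (ell2_nth u i))\<^sup>2)"
      using ell2_nth[of u] by (intro infsumI has_sum_of_real has_sum_infsum) simp
    finally show ?thesis unfolding of_real_eq_iff .
  qed
  have "(norm (T u))\<^sup>2 = (norm u)\<^sup>2" for u
    using * by (simp add: n nth)
  hence "norm (T u) = norm u" for u by (simp add: power2_eq_iff_nonneg)
  thus "bounded_linear T"
    by (intro bounded_linear_intro[where K = 1] ell2_eqI)
       (simp_all add: nth plus_ell2.rep_eq scaleR_scaleC scaleC_ell2.rep_eq scaleC_complex_def distrib_left)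
qed

lemma torus_U_nth: "ell2_nth (torus_U u) (m, n) = ell2_nth u (m + 1, n)"
proof -
  have b: "bij (\<lambda>p :: int \<times> int. (fst p + 1, snd p))"
    by (rule bij_betw_byWitness[where f' = "\<lambda>p. (fst p - 1, snd p)"]) auto
  note ws = weighted_shift[of "\<lambda>_. 1", OF _ b, simplified]
  show ?thesis
    unfolding torus_U_def case_prod_beta' by (simp add: bounded_linear_Blinfun_apply[OF ws(2)] ws(1))
qed

lemma torus_V_nth:
  assumes "cmod lam = 1"
  shows "ell2_nth (torus_V lam u) (m, n) = lam powi m * ell2_nth u (m, n + 1)"
proof -
  have b: "bij (\<lambda>p :: int \<times> int. (fst p, snd p + 1))"
    by (rule bij_betw_byWitness[where f' = "\<lambda>p. (fst p, snd p - 1)"]) auto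
  have "cmod (lam powi fst p) = 1" for p :: "int \<times> int"
    using assms by (simp add: norm_power_int)
  note ws = weighted_shift[of "\<lambda>p. lam powi fst p", OF this b]
  show ?thesis
    unfolding torus_V_def case_prod_beta' by (simp add: bounded_linear_Blinfun_apply[OF ws(2)] ws(1))
qed

lemma torus_commutation:
  assumes "cmod lam = 1"
  shows "torus_U o\<^sub>L torus_V lam = lam *\<^sub>C (torus_V lam o\<^sub>L torus_U)"
proof (intro blinfun_eqI ell2_eqI)
  fix u :: h and i :: "int \<times> int"
  have "lam \<noteq> 0" using assms by auto
  thus "ell2_nth ((torus_U o\<^sub>L torus_V lam) u) i = ell2_nth ((lam *\<^sub>C (torus_V lam o\<^sub>L torus_U)) u) i"
    by (cases i) (simp add: torus_U_nth torus_V_nth[OF assms] scaleC_blinfun.rep_eq scaleC_ell2.rep_eq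
        scaleC_complex_def power_int_add)
qed

definition torus_basis :: "complex \<Rightarrow> int \<Rightarrow> int \<Rightarrow> (h \<Rightarrow>\<^sub>L h)" where
  "torus_basis lam m n = unitary_zpow torus_U m o\<^sub>L unitary_zpow (torus_V lam) n"

definition torus_A0 :: "complex \<Rightarrow> (h \<Rightarrow>\<^sub>L h) set" where
  "torus_A0 lam = star_subalgebra {torus_U, torus_V lam}"

text \<open>The closure is in the operator norm.\<close>

definition torus_A :: "complex \<Rightarrow> (h \<Rightarrow>\<^sub>L h) set" where
  "torus_A lam = closure (torus_A0 lam)"


section \<open>The flow generator\<close>

text \<open>An element of \<open>B(h) \<otimes> B(\<complex>\<^sup>n)\<close> is given by its matrix of entries, and acts on
  \<open>h \<otimes> \<complex>\<^sup>n = h\<^sup>n\<close>. The map \<open>ket \<eta>\<close> is \<open>1 \<otimes> |\<eta>\<rangle>\<close> and \<open>bra \<xi>\<close> is \<open>1 \<otimes> \<langle>\<xi>|\<close>.\<close>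

lemma bounded_linear_vec_lambda:
  fixes f :: "'a::real_normed_vector \<Rightarrow> 'n::finite \<Rightarrow> 'b::real_normed_vector"
  assumes "\<And>i. bounded_linear (\<lambda>x. f x i)"
  shows "bounded_linear (\<lambda>x. \<chi> i. f x i)"
proof -
  obtain K where K: "\<And>i x. norm (f x i) \<le> norm x * K i"
    using bounded_linear.bounded[OF assms] by metis
  show ?thesis
  proof (rule bounded_linear_intro[where K = "sum K UNIV"])
    fix x y :: 'a and r :: real
    show "(\<chi> i. f (x + y) i) = (\<chi> i. f x i) + (\<chi> i. f y i)"
      using linear_add[OF bounded_linear.linear[OF assms]] by (simp add: vec_eq_iff)
    show "(\<chi> i. f (r *\<^sub>R x) i) = r *\<^sub>R (\<chi> i. f x i)"
      using linear_scale[OF bounded_linear.linear[OF assms]] by (simp add: vec_eq_iff)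
    have "norm (\<chi> i. f x i) \<le> (\<Sum>i\<in>UNIV. norm (f x i))"
      by (simp add: norm_vec_def L2_set_le_sum)
    also have "\<dots> \<le> norm x * sum K UNIV"
      by (simp add: sum_distrib_left sum_mono K)
    finally show "norm (\<chi> i. f x i) \<le> norm x * sum K UNIV" .
  qed
qed

lift_definition ket :: "complex^'n \<Rightarrow> ('a::complex_normed_vector \<Rightarrow>\<^sub>L ('a^'n::finite))"
  is "\<lambda>c v. \<chi> i. (c $ i) *\<^sub>C v"
  by (intro bounded_linear_vec_lambda bounded_linear_scaleC)

lift_definition bra :: "complex^'n \<Rightarrow> (('a::complex_normed_vector^'n::finite) \<Rightarrow>\<^sub>L 'a)"
  is "\<lambda>c v. \<Sum>i\<in>UNIV. cnj (c $ i) *\<^sub>C (v $ i)"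
  by (intro bounded_linear_sum bounded_linear_compose[OF bounded_linear_scaleC] bounded_linear_vec_nth)

definition matrix_op ::
  "('a::complex_normed_vector \<Rightarrow>\<^sub>L 'a)^'n^'n \<Rightarrow> (('a^'n::finite) \<Rightarrow>\<^sub>L ('a^'n))" where
  "matrix_op M = Blinfun (\<lambda>v. \<chi> i. \<Sum>k\<in>UNIV. (M $ i $ k) (v $ k))"

lemma matrix_op_apply: "matrix_op M v = (\<chi> i. \<Sum>k\<in>UNIV. (M $ i $ k) (v $ k))"
  unfolding matrix_op_def
  by (intro bounded_linear_Blinfun_apply[THEN fun_cong] bounded_linear_vec_lambda bounded_linear_sum
      bounded_linear_compose[OF blinfun.bounded_linear_right] bounded_linear_vec_nth)

definition slice :: "complex^'n \<Rightarrow> complex^'n \<Rightarrow>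
    ('a::complex_normed_vector \<Rightarrow>\<^sub>L 'a)^'n^'n \<Rightarrow> ('a \<Rightarrow>\<^sub>L 'a)" where
  "slice \<xi> \<eta> M = bra \<xi> o\<^sub>L matrix_op M o\<^sub>L ket \<eta>"

lemma scaleC_sum: "c *\<^sub>C (\<Sum>i\<in>I. f i) = (\<Sum>i\<in>I. c *\<^sub>C (f i :: 'a::complex_normed_vector))"
  by (rule linear_sum[OF bounded_linear.linear[OF bounded_linear_scaleC]])

lemma slice_eq_sum:
  assumes "\<And>i k. complex_linear (M $ i $ k)"
  shows "slice \<xi> \<eta> M = (\<Sum>i\<in>UNIV. \<Sum>k\<in>UNIV. (cnj (\<xi> $ i) * \<eta> $ k) *\<^sub>C M $ i $ k)"
  using assms
  by (intro blinfun_eqI)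
     (simp add: slice_def bra.rep_eq ket.rep_eq matrix_op_apply complex_linear_def scaleC_sum
       scaleC_scaleC blinfun.sum_left scaleC_blinfun.rep_eq)

definition dagger :: "(('a::complex_inner \<Rightarrow>\<^sub>L 'a) \<Rightarrow> ('a \<Rightarrow>\<^sub>L 'a)) \<Rightarrow> ('a \<Rightarrow>\<^sub>L 'a) \<Rightarrow> ('a \<Rightarrow>\<^sub>L 'a)" where
  "dagger d x = adjoint_op (d (adjoint_op x))"

definition torus_phi :: "complex \<Rightarrow> complex \<Rightarrow> ((h \<Rightarrow>\<^sub>L h) \<Rightarrow> (h \<Rightarrow>\<^sub>L h)) \<Rightarrow> ((h \<Rightarrow>\<^sub>L h) \<Rightarrow> (h \<Rightarrow>\<^sub>L h)) \<Rightarrow>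
    ((h \<Rightarrow>\<^sub>L h) \<Rightarrow> (h \<Rightarrow>\<^sub>L h)) \<Rightarrow> (h \<Rightarrow>\<^sub>L h) \<Rightarrow> (h \<Rightarrow>\<^sub>L h)^3^3" where
  "torus_phi c1 c2 d1 d2 tau x =
    vector [vector [tau x, cnj c1 *\<^sub>C dagger d1 x, cnj c2 *\<^sub>C dagger d2 x],
            vector [c1 *\<^sub>C d1 x, 0, 0],
            vector [c2 *\<^sub>C d2 x, 0, 0]]"


section \<open>Adapted families\<close>

definition vec_hat :: "(real \<Rightarrow> complex^2) \<Rightarrow> real \<Rightarrow> complex^3" where
  "vec_hat f t = vector [1, f t $ 1, f t $ 2]"

definition before :: "real \<Rightarrow> (real \<Rightarrow> complex^2) \<Rightarrow> real \<Rightarrow> complex^2" where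
  "before t f = (\<lambda>s. if s \<in> {0..<t} then f s else 0)"

definition after :: "real \<Rightarrow> (real \<Rightarrow> complex^2) \<Rightarrow> real \<Rightarrow> complex^2" where
  "after t f = (\<lambda>s. if s \<in> {t..} then f s else 0)"

type_synonym h_fock = "(int \<times> int, fock) ell2"

definition exp_tensor :: "h \<Rightarrow> (real \<Rightarrow> complex^2) \<Rightarrow> h_fock" where
  "exp_tensor u f = tensor u (exp_vec f)"

definition adapted :: "(h \<Rightarrow>\<^sub>L h) set \<Rightarrow> (real \<Rightarrow> (h \<Rightarrow>\<^sub>L h) \<Rightarrow> (h_fock \<Rightarrow>\<^sub>L h_fock)) \<Rightarrow> bool" where
  "adapted A j \<longleftrightarrow>
    (\<forall>u v. \<forall>f\<in>L2_half_line. \<forall>g\<in>L2_half_line. \<forall>t\<ge>0. \<forall>a\<in>A.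
      cinner (exp_tensor u f) (j t a (exp_tensor v g)) =
      cinner (exp_tensor u (before t f)) (j t a (exp_tensor v (before t g))) *
      cinner (exp_vec (after t f)) (exp_vec (after t g)))"

end

theory Submission
  imports Defs
begin

text \<open>Let \<open>W(k)\<close> be the Weyl operator, \<open>W(k) \<epsilon>(f) = exp (- \<parallel>k\<parallel>\<^sup>2 / 2 - \<langle>k, f\<rangle>) \<epsilon>(f + k)\<close>, and for
  \<open>p = (m, n)\<close> put \<open>k\<^sub>t(p) = (m c\<^sub>1, n c\<^sub>2) 1\<^bsub>[0,t)\<^esub>\<close>. The inner products \<open>\<langle>k\<^sub>t(p), k\<^sub>t(q)\<rangle>\<close> are real, so
  \<open>p \<mapsto> W(k\<^sub>t(p))\<close> is a unitary representation of \<open>\<int>\<^sup>2\<close>. Since \<open>\<phi>\<close> acts on \<open>U\<^sup>m V\<^sup>n\<close> by scalars, the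
  equation is solved by \<open>j\<^sub>t(U\<^sup>m V\<^sup>n) = U\<^sup>m V\<^sup>n \<otimes> W(k\<^sub>t(m, n))\<close>, the matrix elements being the exponentials of
  indefinite integrals. To see that this extends to a homomorphism of the whole algebra, let \<open>T\<^sub>t\<close> be
  the unitary on \<open>\<ell>\<^sup>2(\<int>\<^sup>2; F)\<close> with \<open>(T\<^sub>t \<xi>)\<^sub>p = W(k\<^sub>t(p)) \<xi>\<^sub>p\<close>; as \<open>U\<^sup>m V\<^sup>n\<close> is a weighted shift by
  \<open>(m, n)\<close>, we have \<open>j\<^sub>t(a) = T\<^sub>t\<^sup>* (a \<otimes> 1) T\<^sub>t\<close>, and the right-hand side makes sense for every bounded
  operator \<open>a\<close>.\<close>

section \<open>Hilbert spaces\<close>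

text \<open>The choice of k_t is forced by matching exponents. Relative to exp \<langle>f,
  g\<rangle>, the matrix element of W(k) between \<epsilon>(f) and \<epsilon>(g) is the exponential
  of \<langle>f, k\<rangle> - \<langle>k, g\<rangle> - \<parallel>k\<parallel>^2 / 2. For k = k_t(m,
  n) the three terms are integrals over [0, t], and their densities are the contributions to \<phi>
  of the entries with \<delta>, of those with its dagger, and of \<tau>. As f and g are only square
  integrable, the total density is merely integrable in time, so the scalar equation has to be
  solved in integrated form, without pointwise derivatives. Two constructions carry the analysis.
  W(k) arises by extending an isometry from the exponential vectors, and a \<otimes> 1 by
  representing functionals on the Fock space. Both rest on orthogonal projection, hence on
  completeness of the Fock space, which is proved for the quotient of sequences of symmetric
  functions.\<close>

interpretation cinner: bounded_bilinear "cinner :: 'a::complex_inner \<Rightarrow> 'a \<Rightarrow> complex"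
proof
  fix x y z :: 'a and r :: real
  show "cinner (x + y) z = cinner x z + cinner y z" by (rule cinner_add_left)
  show "cinner x (y + z) = cinner x y + cinner x z" by (rule cinner_add_right)
  show "cinner (r *\<^sub>R x) y = r *\<^sub>R cinner x y"
    by (simp only: scaleR_scaleC cinner_scaleC_left scaleC_complex_def complex_cnj_complex_of_real)
  show "cinner x (r *\<^sub>R y) = r *\<^sub>R cinner x y"
    by (simp only: scaleR_scaleC cinner_scaleC_right scaleC_complex_def)
  show "\<exists>K. \<forall>x y :: 'a. norm (cinner x y) \<le> norm x * norm y * K"
    by (rule exI[of _ 1]) (simp add: norm_cinner_le)
qed

interpretation scaleC: bounded_bilinear "scaleC :: complex \<Rightarrow> 'a::complex_normed_vector \<Rightarrow> 'a"
proof
  fix x y :: 'a and a b :: complex and r :: real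
  show "(a + b) *\<^sub>C x = a *\<^sub>C x + b *\<^sub>C x" by (rule scaleC_add_left)
  show "a *\<^sub>C (x + y) = a *\<^sub>C x + a *\<^sub>C y" by (rule scaleC_add_right)
  show "(r *\<^sub>R a) *\<^sub>C x = r *\<^sub>R a *\<^sub>C x"
    by (simp add: scaleR_scaleC scaleC_scaleC scaleR_conv_of_real scaleC_complex_def)
  show "a *\<^sub>C (r *\<^sub>R x) = r *\<^sub>R a *\<^sub>C x"
    by (simp add: scaleR_scaleC scaleC_scaleC mult.commute)
  show "\<exists>K. \<forall>a. \<forall>x :: 'a. norm (a *\<^sub>C x) \<le> norm a * norm x * K"
    by (rule exI[of _ 1]) (simp add: norm_scaleC)
qed

section \<open>Orthogonal projection and Riesz representation\<close>

lemma cinner_eqI: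
  fixes x y :: "'a::complex_inner"
  assumes "\<And>z. cinner z x = cinner z y"
  shows "x = y"
proof -
  have "inner (x - y) (x - y) = 0"
    by (simp add: inner_eq_Re_cinner cinner.diff_right assms)
  thus ?thesis by simp
qed

text \<open>The projection theorem in disguise: a minimising sequence for the distance from
  \<open>x\<close> to \<open>D\<close> is Cauchy by the parallelogram law, and \<open>x\<close>
  minus its limit is orthogonal to \<open>D\<close>, hence zero by \<open>perp\<close>.\<close>

lemma closed_subspace_eq_UNIV:
  fixes D :: "'a::{real_inner, complete_space} set"
  assumes sub: "subspace D" and closed: "closed D"
    and perp: "\<And>x. (\<And>y. y \<in> D \<Longrightarrow> inner y x = 0) \<Longrightarrow> x = 0"
  shows "D = UNIV"
proof (intro equalityI subset_UNIV subsetI)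
  fix x :: 'a
  have ne: "D \<noteq> {}" using subspace_0[OF sub] by auto
  define d where "d = infdist x D"
  have d0: "0 \<le> d" by (simp add: d_def infdist_nonneg)
  have dle: "d \<le> norm (x - z)" if "z \<in> D" for z
    using infdist_le[OF that, of x] by (simp add: d_def dist_norm)
  have "\<exists>y\<in>D. norm (x - y) < d + 1 / real (Suc n)" for n
  proof -
    have "infdist x D < d + 1 / real (Suc n)" by (simp add: d_def)
    hence "(INF a\<in>D. dist x a) < d + 1 / real (Suc n)"
      using ne by (simp add: infdist_def)
    thus ?thesis by (subst (asm) cINF_less_iff) (auto simp: ne dist_norm intro!: bdd_belowI[of _ 0])
  qed
  then obtain y where yD: "y n \<in> D" and y: "norm (x - y n) < d + 1 / real (Suc n)" for n by metis
  \<comment> \<open>The midpoint of two points of \<open>D\<close> lies in \<open>D\<close>, so its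
    distance from \<open>x\<close> is at least \<open>d\<close>; this enters the parallelogram
    identity.\<close>
  have par: "(norm (y n - y m))\<^sup>2 \<le> 2 * (norm (x - y n))\<^sup>2 + 2 * (norm (x - y m))\<^sup>2 - 4 * d\<^sup>2" for n m
  proof -
    have "(1/2) *\<^sub>R (y n + y m) \<in> D" using yD sub by (simp add: subspace_add subspace_mul)
    from power_mono[OF dle[OF this] d0, of 2]
    have 1: "d\<^sup>2 \<le> (norm (x - (1/2) *\<^sub>R (y n + y m)))\<^sup>2" .
    have 2: "4 * (norm (x - (1/2) *\<^sub>R (y n + y m)))\<^sup>2 + (norm (y n - y m))\<^sup>2
       = 2 * (norm (x - y n))\<^sup>2 + 2 * (norm (x - y m))\<^sup>2"
      unfolding power2_norm_eq_inner
      by (simp add: inner_diff_left inner_diff_right inner_add_left inner_add_right inner_commute algebra_simps)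
    show ?thesis using 1 2 by linarith
  qed
  have "Cauchy y"
  proof (rule metric_CauchyI)
    fix e :: real assume e: "0 < e"
    have "(\<lambda>N. 4 * (d + 1 / real (Suc N))\<^sup>2 - 4 * d\<^sup>2) \<longlonglongrightarrow> 4 * (d + 0)\<^sup>2 - 4 * d\<^sup>2"
      by (intro tendsto_intros LIMSEQ_Suc[OF lim_1_over_n])
    hence "\<forall>\<^sub>F N in sequentially. 4 * (d + 1 / real (Suc N))\<^sup>2 - 4 * d\<^sup>2 < e\<^sup>2"
      by (rule order_tendstoD) (use e in simp)
    then obtain N where N: "4 * (d + 1 / real (Suc N))\<^sup>2 - 4 * d\<^sup>2 < e\<^sup>2"
      by (auto simp: eventually_sequentially)
    have b: "(norm (x - y n))\<^sup>2 \<le> (d + 1 / real (Suc N))\<^sup>2" if "n \<ge> N" for n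
    proof (rule power_mono)
      have "1 / real (Suc n) \<le> 1 / real (Suc N)" using that by (intro divide_left_mono) auto
      thus "norm (x - y n) \<le> d + 1 / real (Suc N)" using y[of n] by linarith
    qed simp
    show "\<exists>M. \<forall>m\<ge>M. \<forall>n\<ge>M. dist (y m) (y n) < e"
    proof (intro exI allI impI)
      fix m n assume "m \<ge> N" "n \<ge> N"
      hence "(norm (y m - y n))\<^sup>2 < e\<^sup>2" using par[of m n] b[of m] b[of n] N by linarith
      thus "dist (y m) (y n) < e" using e by (simp add: dist_norm power2_less_imp_less)
    qed
  qed
  then obtain p where p: "y \<longlonglongrightarrow> p" using Cauchy_convergent convergentD by blast
  have pD: "p \<in> D" using closed p yD closed_sequential_limits by blast
  have "norm (x - p) \<le> d"
  proof (rule LIMSEQ_le)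
    show "(\<lambda>n. norm (x - y n)) \<longlonglongrightarrow> norm (x - p)" by (intro tendsto_intros p)
    have "(\<lambda>n. d + 1 / real (Suc n)) \<longlonglongrightarrow> d + 0"
      by (intro tendsto_intros LIMSEQ_Suc[OF lim_1_over_n])
    thus "(\<lambda>n. d + 1 / real (Suc n)) \<longlonglongrightarrow> d" by simp
    show "\<exists>N. \<forall>n\<ge>N. norm (x - y n) \<le> d + 1 / real (Suc n)" using y by (auto intro: less_imp_le)
  qed
  have "inner z (x - p) = 0" if z: "z \<in> D" for z
  proof (cases "z = 0")
    case False
    \<comment> \<open>The minimiser of the norm of \<open>x - p - t *\<^sub>R z\<close> over real
      \<open>t\<close>: it would improve on \<open>p\<close> unless the inner product
      vanishes.\<close>
    define t where "t = inner z (x - p) / inner z z"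
    have "p + t *\<^sub>R z \<in> D" using pD z sub by (simp add: subspace_add subspace_mul)
    from dle[OF this] have "norm (x - p) \<le> norm (x - (p + t *\<^sub>R z))"
      using \<open>norm (x - p) \<le> d\<close> by linarith
    hence "(norm (x - p))\<^sup>2 \<le> (norm ((x - p) - t *\<^sub>R z))\<^sup>2" by (simp add: algebra_simps)
    also have "\<dots> = (norm (x - p))\<^sup>2 - 2 * t * inner z (x - p) + t\<^sup>2 * inner z z"
      unfolding power2_norm_eq_inner
      by (simp add: inner_diff_left inner_diff_right inner_commute algebra_simps power2_eq_square)
    also have "\<dots> = (norm (x - p))\<^sup>2 - (inner z (x - p))\<^sup>2 / inner z z"
      using False by (simp add: t_def power2_eq_square field_simps)
    finally have "(inner z (x - p))\<^sup>2 / inner z z \<le> 0" by simp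
    moreover have "inner z z > 0" using False by simp
    ultimately have "(inner z (x - p))\<^sup>2 \<le> 0" by (simp add: divide_le_0_iff)
    thus ?thesis by simp
  qed simp
  hence "x - p = 0" by (rule perp)
  thus "x \<in> D" using pD by simp
qed

text \<open>If \<open>f\<close> is not zero, its kernel is a proper closed subspace and has a
  nonzero normal vector \<open>z\<close>. Since \<open>f z *\<^sub>R x - f x *\<^sub>R z\<close>
  lies in the kernel, pairing it with \<open>z\<close> shows which multiple of \<open>z\<close>
  represents \<open>f\<close>.\<close>

lemma riesz_representation_real:
  fixes f :: "'a::{real_inner, complete_space} \<Rightarrow> real"
  assumes f: "bounded_linear f"
  shows "\<exists>y. \<forall>x. f x = inner y x"
proof (cases "\<forall>x. f x = 0")
  case False
  interpret f: bounded_linear f by (rule f)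
  let ?D = "{x. f x = 0}"
  have "subspace ?D" by (simp add: subspace_def f.add f.scaleR f.zero)
  moreover have "closed ?D"
    by (intro closed_Collect_eq continuous_intros f.continuous_on)
  ultimately obtain z where z: "z \<noteq> 0" "\<And>y. f y = 0 \<Longrightarrow> inner y z = 0"
    using closed_subspace_eq_UNIV[of ?D] False by blast
  have "f x = inner ((f z / inner z z) *\<^sub>R z) x" for x
  proof -
    have fz: "f z \<noteq> 0" using z(1) z(2)[of z] by auto
    have "f (f z *\<^sub>R x - f x *\<^sub>R z) = 0" by (simp add: f.diff f.scaleR)
    hence "inner (f z *\<^sub>R x - f x *\<^sub>R z) z = 0" by (rule z(2))
    hence "f z * inner x z = f x * inner z z" by (simp add: inner_diff_left)
    thus ?thesis using z(1) by (simp add: inner_commute field_simps)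
  qed
  thus ?thesis by blast
qed (auto intro: exI[of _ 0])

lemma riesz_representation:
  fixes f :: "'a::{complex_inner, complete_space} \<Rightarrow> complex"
  assumes f: "bounded_linear f" and c: "\<And>c x. f (c *\<^sub>C x) = c * f x"
  shows "\<exists>y. \<forall>x. f x = cinner y x"
proof -
  have "bounded_linear (\<lambda>x. Re (f x))"
    by (rule bounded_linear_compose[OF bounded_linear_Re f])
  then obtain y where y: "Re (f x) = inner y x" for x
    using riesz_representation_real by blast
  have "f x = cinner y x" for x
  proof (rule complex_eqI)
    show "Re (f x) = Re (cinner y x)" by (simp add: y inner_eq_Re_cinner)
    \<comment> \<open>Imaginary parts are real parts at a rotated vector: Re f(i x) = - Im f(x), and
      likewise for the inner product.\<close>
    have "Re (f (\<i> *\<^sub>C x)) = Re (cinner y (\<i> *\<^sub>C x))" by (simp add: y inner_eq_Re_cinner)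
    thus "Im (f x) = Im (cinner y x)" by (simp add: c cinner_scaleC_right)
  qed
  thus ?thesis by blast
qed

section \<open>Finite orthonormal systems\<close>

definition orthonormal :: "'a::complex_inner set \<Rightarrow> bool" where
  "orthonormal B \<longleftrightarrow> (\<forall>a\<in>B. \<forall>b\<in>B. cinner a b = (if a = b then 1 else 0))"

lemma orthonormal_coeff:
  assumes "orthonormal B" "finite B" "b \<in> B"
  shows "cinner b (\<Sum>a\<in>B. c a *\<^sub>C a) = c b"
proof -
  have "cinner b (\<Sum>a\<in>B. c a *\<^sub>C a) = (\<Sum>a\<in>B. if a = b then c a else 0)"
    unfolding cinner.sum_right cinner_scaleC_right
    using assms by (intro sum.cong) (auto simp: orthonormal_def)
  thus ?thesis using assms by simp
qed

text \<open>The finite form serves to estimate ampliations, where finitely many coordinates are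
  compared at a time. The component of \<open>s\<close> orthogonal to the system found so far is
  normalised and adjoined, unless it vanishes.\<close>

lemma gram_schmidt:
  fixes S :: "'a::complex_inner set"
  assumes "finite S"
  shows "\<exists>B. finite B \<and> orthonormal B \<and> (\<forall>s\<in>S. s = (\<Sum>b\<in>B. cinner b s *\<^sub>C b))"
  using assms
proof induction
  case empty
  show ?case by (rule exI[of _ "{}"]) (simp add: orthonormal_def)
next
  case (insert s S)
  then obtain B where B: "finite B" "orthonormal B" "\<And>s. s \<in> S \<Longrightarrow> s = (\<Sum>b\<in>B. cinner b s *\<^sub>C b)"
    by blast
  define r where "r = s - (\<Sum>b\<in>B. cinner b s *\<^sub>C b)"
  have perp: "cinner b r = 0" if "b \<in> B" for b
    using orthonormal_coeff[OF B(2,1) that] by (simp add: r_def cinner.diff_right)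
  show ?case
  proof (cases "r = 0")
    case True
    thus ?thesis using B by (auto simp: r_def)
  next
    case False
    define e where "e = complex_of_real (inverse (norm r)) *\<^sub>C r"
    have be: "cinner b e = 0" if "b \<in> B" for b
      using perp[OF that] by (simp add: e_def cinner_scaleC_right)
    have eb: "cinner e b = 0" if "b \<in> B" for b
      using be[OF that] cinner_commute[of e b] by simp
    have ee: "cinner e e = 1"
      using False by (simp add: cinner_same e_def norm_scaleC norm_inverse)
    hence enB: "e \<notin> B" using be by fastforce
    have on: "orthonormal (insert e B)"
      using B(2) be eb ee enB by (auto simp: orthonormal_def)
    have "cinner e s = cinner e (r + (\<Sum>b\<in>B. cinner b s *\<^sub>C b))" by (simp add: r_def)
    also have "\<dots> = cinner e r"
      using eb by (simp add: cinner.add_right cinner.sum_right cinner_scaleC_right)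
    also have "\<dots> = complex_of_real (norm r)"
      using False by (simp add: e_def cinner_scaleC_left cinner_same power2_eq_square)
    finally have "cinner e s *\<^sub>C e = r" using False by (simp add: e_def scaleC_scaleC scaleC_one)
    hence s: "s = (\<Sum>b\<in>insert e B. cinner b s *\<^sub>C b)"
      using enB B(1) by (simp add: r_def)
    have "t = (\<Sum>b\<in>insert e B. cinner b t *\<^sub>C b)" if "t \<in> S" for t
    proof -
      have "cinner e t = cinner e (\<Sum>b\<in>B. cinner b t *\<^sub>C b)" using B(3)[OF that] by simp
      also have "\<dots> = 0" using eb by (simp add: cinner.sum_right cinner_scaleC_right)
      finally show ?thesis using enB B(1) B(3)[OF that] by (simp add: scaleC.zero_left)
    qed
    thus ?thesis using s on B(1) by (intro exI[of _ "insert e B"]) auto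
  qed
qed

lemma parseval_finite:
  assumes x: "x = (\<Sum>b\<in>B. cinner b x *\<^sub>C b)"
  shows "(norm x)\<^sup>2 = (\<Sum>b\<in>B. (cmod (cinner b x))\<^sup>2)"
proof -
  have "complex_of_real ((norm x)\<^sup>2) = cinner x (\<Sum>b\<in>B. cinner b x *\<^sub>C b)"
    by (subst x[symmetric]) (simp add: cinner_same)
  also have "\<dots> = (\<Sum>b\<in>B. cinner b x * cnj (cinner b x))"
    by (simp add: cinner.sum_right cinner_scaleC_right cinner_commute[of x])
  also have "\<dots> = complex_of_real (\<Sum>b\<in>B. (cmod (cinner b x))\<^sup>2)"
    by (simp only: of_real_sum complex_norm_square)
  finally show ?thesis unfolding of_real_eq_iff .
qed

lemma bessel_finite:
  fixes x :: "'a::complex_inner"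
  assumes B: "finite B" "orthonormal B"
  shows "(\<Sum>b\<in>B. (cmod (cinner b x))\<^sup>2) \<le> (norm x)\<^sup>2"
proof -
  define p where "p = (\<Sum>b\<in>B. cinner b x *\<^sub>C b)"
  have c: "cinner b p = cinner b x" if "b \<in> B" for b
    unfolding p_def by (rule orthonormal_coeff[OF B(2,1) that])
  have "(norm p)\<^sup>2 = (\<Sum>b\<in>B. (cmod (cinner b p))\<^sup>2)"
    by (rule parseval_finite) (simp add: c p_def[symmetric])
  also have "\<dots> = (\<Sum>b\<in>B. (cmod (cinner b x))\<^sup>2)" by (simp add: c)
  finally have p: "(\<Sum>b\<in>B. (cmod (cinner b x))\<^sup>2) = (norm p)\<^sup>2" ..
  have "cinner p (x - p) = (\<Sum>b\<in>B. cnj (cinner b x) * cinner b (x - p))"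
    by (subst (1) p_def) (simp add: cinner.sum_left cinner_scaleC_left)
  also have "\<dots> = 0" by (simp add: cinner.diff_right c)
  finally have "inner p (x - p) = 0" by (simp add: inner_eq_Re_cinner)
  hence "(norm p)\<^sup>2 + (norm (x - p))\<^sup>2 = (norm x)\<^sup>2"
    by (simp add: power2_norm_eq_inner inner_diff_left inner_diff_right inner_commute algebra_simps)
  moreover have "0 \<le> (norm (x - p))\<^sup>2" by simp
  ultimately show ?thesis unfolding p by linarith
qed

section \<open>Maps that preserve the inner product\<close>

lemma cinner_preserving_norm:
  assumes "\<And>x y. cinner (W x) (W y) = cinner x y"
  shows "norm (W x) = norm x"
proof -
  have "complex_of_real ((norm (W x))\<^sup>2) = complex_of_real ((norm x)\<^sup>2)"
    using assms[of x x] by (simp only: cinner_same)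
  thus ?thesis unfolding of_real_eq_iff by (simp add: power2_eq_iff_nonneg)
qed

text \<open>The squared norm of a defect such as W(x + y) - W x - W y expands into inner products,
  which \<open>W\<close> preserves; it therefore equals the squared norm of (x + y) - x - y.\<close>

lemma cinner_preserving_linear:
  fixes W :: "'a::complex_inner \<Rightarrow> 'b::complex_inner"
  assumes W: "\<And>x y. cinner (W x) (W y) = cinner x y"
  shows "W (x + y) = W x + W y" and "W (c *\<^sub>C x) = c *\<^sub>C W x" and "bounded_linear W"
proof -
  have Z: "z = 0" if "cinner z z = 0" for z :: 'b
    using that by (simp add: cinner_same)
  show add: "W (x + y) = W x + W y" for x y
  proof -
    have "cinner (W (x + y) - (W x + W y)) (W (x + y) - (W x + W y)) = 0"
      by (simp add: cinner.diff_left cinner.diff_right cinner.add_left cinner.add_right W)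
    from Z[OF this] show ?thesis by simp
  qed
  show sc: "W (c *\<^sub>C x) = c *\<^sub>C W x" for c x
  proof -
    have "cinner (W (c *\<^sub>C x) - c *\<^sub>C W x) (W (c *\<^sub>C x) - c *\<^sub>C W x) = 0"
      by (simp add: cinner.diff_left cinner.diff_right cinner_scaleC_left cinner_scaleC_right W)
    from Z[OF this] show ?thesis by simp
  qed
  show "bounded_linear W"
    by (rule bounded_linear_intro[where K = 1])
       (simp_all add: add sc scaleR_scaleC cinner_preserving_norm[OF W])
qed

lemma subspace_closure:
  fixes S :: "'a::real_normed_vector set"
  assumes S: "subspace S"
  shows "subspace (closure S)"
proof (rule subspaceI)
  show "0 \<in> closure S" using subspace_0[OF S] closure_subset by blast
  fix x assume "x \<in> closure S"
  then obtain a where a: "\<And>n. a n \<in> S" "a \<longlonglongrightarrow> x" unfolding closure_sequential by blast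
  show "c *\<^sub>R x \<in> closure S" for c
    unfolding closure_sequential
    by (rule exI[of _ "\<lambda>n. c *\<^sub>R a n"]) (use a S in \<open>auto intro: tendsto_intros subspace_mul\<close>)
  fix y assume "y \<in> closure S"
  then obtain b where b: "\<And>n. b n \<in> S" "b \<longlonglongrightarrow> y" unfolding closure_sequential by blast
  show "x + y \<in> closure S"
    unfolding closure_sequential
    by (rule exI[of _ "\<lambda>n. a n + b n"]) (use a b S in \<open>auto intro: tendsto_intros subspace_add\<close>)
qed

text \<open>The closed linear span of a Gram-preserving relation is the graph of an isometry, and its
  domain is closed because the space is complete.\<close>

lemma isometry_extension:
  fixes G :: "('a::{complex_inner, complete_space} \<times> 'a) set"
  assumes G: "\<And>p q. p \<in> G \<Longrightarrow> q \<in> G \<Longrightarrow> cinner (snd p) (snd q) = cinner (fst p) (fst q)"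
    and perp: "\<And>x. (\<And>p. p \<in> G \<Longrightarrow> inner (fst p) x = 0) \<Longrightarrow> x = 0"
  shows "\<exists>W. (\<forall>x y. cinner (W x) (W y) = cinner x y) \<and> (\<forall>p\<in>G. W (fst p) = snd p)"
proof -
  \<comment> \<open>The real span suffices, since a map preserving the complex inner product is
    automatically complex-linear.\<close>
  define K where "K = closure (span G)"
  have subK: "subspace K" unfolding K_def by (intro subspace_closure subspace_span)
  have GK: "G \<subseteq> K" unfolding K_def using closure_subset span_superset by blast
  let ?P = "\<lambda>p q :: 'a \<times> 'a. cinner (snd p) (snd q) = cinner (fst p) (fst q)"
  have subP: "subspace {q. ?P p q}" "subspace {q. ?P q p}" for p
    by (auto simp: subspace_def cinner.add_right cinner.scaleR_right cinner.zero_right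
      cinner.add_left cinner.scaleR_left cinner.zero_left)
  have clP: "closed {q. ?P p q}" "closed {q. ?P q p}" for p
    by (intro closed_Collect_eq continuous_intros bounded_linear.continuous_on[OF cinner.bounded_linear_right]
      bounded_linear.continuous_on[OF cinner.bounded_linear_left])+
  have ext: "K \<subseteq> S" if "subspace S" "closed S" "G \<subseteq> S" for S
    unfolding K_def using that by (intro closure_minimal span_minimal)
  \<comment> \<open>Preservation passes from \<open>G\<close> to \<open>K\<close> in one argument at
    a time, because the condition on either argument alone defines a closed subspace.\<close>
  have 1: "?P p q" if "p \<in> G" "q \<in> K" for p q
    using ext[OF subP(1) clP(1), of p] G that by blast
  have P: "?P p q" if "p \<in> K" "q \<in> K" for p q
    using ext[OF subP(2) clP(2), of q] 1 that by blast
  have nrm: "norm (snd p) = norm (fst p)" if "p \<in> K" for p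
  proof -
    have "complex_of_real ((norm (snd p))\<^sup>2) = complex_of_real ((norm (fst p))\<^sup>2)"
      using P[OF that that] by (simp only: cinner_same)
    thus ?thesis unfolding of_real_eq_iff by (simp add: power2_eq_iff_nonneg)
  qed
  have "fst ` K = UNIV"
  proof (rule closed_subspace_eq_UNIV)
    show "subspace (fst ` K)"
      by (intro linear_subspace_image subK bounded_linear.linear bounded_linear_fst)
    show "closed (fst ` K)"
      unfolding closed_sequential_limits
    proof (intro allI impI, elim conjE)
      fix x l assume x: "\<forall>n. x n \<in> fst ` K" and l: "x \<longlonglongrightarrow> l"
      from x have "\<forall>n. \<exists>z. (x n, z) \<in> K" by force
      then obtain y where y: "(x n, y n) \<in> K" for n by metis
      have d: "dist (y m) (y n) = dist (x m) (x n)" for m n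
        using nrm[OF subspace_diff[OF subK y y]] by (simp add: dist_norm)
      have "Cauchy x" using l LIMSEQ_imp_Cauchy by blast
      hence "Cauchy y" unfolding Cauchy_def d .
      then obtain k where "y \<longlonglongrightarrow> k" using Cauchy_convergent convergentD by blast
      hence "(\<lambda>n. (x n, y n)) \<longlonglongrightarrow> (l, k)" using l by (intro tendsto_Pair)
      hence "(l, k) \<in> K" using y closed_sequentially[of K "\<lambda>n. (x n, y n)"] by (simp add: K_def)
      thus "l \<in> fst ` K" by force
    qed
    fix x assume "\<And>y. y \<in> fst ` K \<Longrightarrow> inner y x = 0"
    thus "x = 0" using GK by (intro perp) blast
  qed
  hence "\<forall>x. \<exists>y. (x, y) \<in> K" by (metis UNIV_I imageE prod.collapse)
  then obtain W where W: "(x, W x) \<in> K" for x by metis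
  have "W (fst p) = snd p" if "p \<in> G" for p
  proof -
    \<comment> \<open>The two pairs share their first component, so the difference is (0, z), and
      equality of norms on \<open>K\<close> forces z = 0.\<close>
    have "(fst p, W (fst p)) - p \<in> K" using W GK that subspace_diff[OF subK] by blast
    from nrm[OF this] show ?thesis by simp
  qed
  moreover have "cinner (W x) (W y) = cinner x y" for x y
    using P[OF W W, of x y] by simp
  ultimately show ?thesis by blast
qed

text \<open>The vectors on which \<open>V\<close> and \<open>W\<close> agree form a closed subspace.
  Totality is phrased through this set and not through fixed generators, so that \<open>x\<close>
  itself may be shown to belong to it, as happens in \<open>weyl_weyl\<close>.\<close>

lemma bounded_linear_eq_if_total:
  fixes V W :: "'a::{complex_inner, complete_space} \<Rightarrow> 'b::complex_inner"
  assumes V: "bounded_linear V" and W: "bounded_linear W"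
    and perp: "\<And>x. (\<And>y. V y = W y \<Longrightarrow> inner y x = 0) \<Longrightarrow> x = 0"
  shows "V = W"
proof -
  interpret V: bounded_linear V by (rule V)
  interpret W: bounded_linear W by (rule W)
  have "{x. V x = W x} = UNIV"
  proof (rule closed_subspace_eq_UNIV)
    show "subspace {x. V x = W x}"
      by (simp add: subspace_def V.add V.scaleR V.zero W.add W.scaleR W.zero)
    show "closed {x. V x = W x}"
      by (intro closed_Collect_eq V.continuous_on W.continuous_on continuous_intros)
  qed (use perp in blast)
  thus ?thesis by blast
qed

section \<open>Completeness of the Fock space\<close>

text \<open>The squared Fock norm with values in the extended half-line, meaningful before square
  integrability is known. The sum over \<open>n\<close> is an integral for the counting measure, so
  that convergence theorems for integrals apply to it too.\<close>

definition fock_mass :: "(nat \<Rightarrow> (nat \<Rightarrow> real \<times> 2) \<Rightarrow> complex) \<Rightarrow> ennreal" where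
  "fock_mass \<Phi> = (\<integral>\<^sup>+n. (\<integral>\<^sup>+w. ennreal ((norm (\<Phi> n w))\<^sup>2) \<partial>n_particle n) \<partial>count_space UNIV)"

lemma fock_mass_eq:
  assumes "fock_function \<Phi>"
  shows "fock_mass \<Phi> = ennreal (\<Sum>n. \<integral>w. (norm (\<Phi> n w))\<^sup>2 \<partial>n_particle n)"
proof -
  have "(\<integral>\<^sup>+w. ennreal ((norm (\<Phi> n w))\<^sup>2) \<partial>n_particle n)
      = ennreal (\<integral>w. (norm (\<Phi> n w))\<^sup>2 \<partial>n_particle n)" for n
    by (rule nn_integral_eq_integral) (use fock_functionD[OF assms] in auto)
  hence "fock_mass \<Phi> = (\<Sum>n. ennreal (\<integral>w. (norm (\<Phi> n w))\<^sup>2 \<partial>n_particle n))"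
    by (simp add: fock_mass_def nn_integral_count_space_nat)
  also have "\<dots> = ennreal (\<Sum>n. \<integral>w. (norm (\<Phi> n w))\<^sup>2 \<partial>n_particle n)"
    by (rule suminf_ennreal2) (use fock_functionD[OF assms] in auto)
  finally show ?thesis .
qed

lemma fock_functionI:
  assumes m: "\<And>n. \<Phi> n \<in> borel_measurable (n_particle n)"
    and s: "\<And>n p w. p permutes {..<n} \<Longrightarrow> w \<in> space (n_particle n) \<Longrightarrow> \<Phi> n (w \<circ> p) = \<Phi> n w"
    and fin: "fock_mass \<Phi> < \<infinity>"
  shows "fock_function \<Phi>"
proof -
  note m[measurable]
  let ?I = "\<lambda>n. \<integral>\<^sup>+w. ennreal ((norm (\<Phi> n w))\<^sup>2) \<partial>n_particle n"
  have fin': "(\<Sum>n. ?I n) < \<infinity>" using fin by (simp add: fock_mass_def nn_integral_count_space_nat)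
  have "?I n < \<infinity>" for n
    using fin' ennreal_suminf_lessD[of ?I top n] by simp
  hence int: "integrable (n_particle n) (\<lambda>w. (norm (\<Phi> n w))\<^sup>2)" for n
    by (intro integrableI_bounded) auto
  have eq: "?I n = ennreal (\<integral>w. (norm (\<Phi> n w))\<^sup>2 \<partial>n_particle n)" for n
    by (rule nn_integral_eq_integral) (use int in auto)
  have "summable (\<lambda>n. \<integral>w. (norm (\<Phi> n w))\<^sup>2 \<partial>n_particle n)"
    by (rule summable_suminf_not_top) (use fin' in \<open>auto simp: eq\<close>)
  thus ?thesis using m s int by (simp add: fock_function_def)
qed

lemma fock_eq_refl: "fock_eq \<Phi> \<Phi> \<longleftrightarrow> fock_function \<Phi>"
  by (auto simp: fock_eq_def)

lemma fock_function_rep: "fock_function (rep_fock x)"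
  using Quotient_rep_reflp[OF Quotient_fock] fock_eq_refl by blast

lemma abs_rep_fock: "abs_fock (rep_fock x) = x"
  by (rule Quotient_abs_rep[OF Quotient_fock])

lemma norm_abs_fock:
  assumes "fock_function \<Phi>"
  shows "ennreal ((norm (abs_fock \<Phi>))\<^sup>2) = fock_mass \<Phi>"
proof -
  have c: "cnj (\<Phi> n w) * \<Phi> n w = complex_of_real ((norm (\<Phi> n w))\<^sup>2)" for n w
    using complex_norm_square[of "\<Phi> n w"] by (simp add: mult.commute)
  have "complex_of_real ((norm (abs_fock \<Phi>))\<^sup>2) = (\<Sum>n. \<integral>w. cnj (\<Phi> n w) * \<Phi> n w \<partial>n_particle n)"
    unfolding cinner_same[symmetric] using assms by (intro cinner_fock.abs_eq) (simp_all add: fock_eq_refl)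
  also have "\<dots> = (\<Sum>n. complex_of_real (\<integral>w. (norm (\<Phi> n w))\<^sup>2 \<partial>n_particle n))"
    by (simp only: c integral_complex_of_real)
  also have "\<dots> = complex_of_real (\<Sum>n. \<integral>w. (norm (\<Phi> n w))\<^sup>2 \<partial>n_particle n)"
    by (rule suminf_of_real[symmetric]) (rule fock_functionD(3)[OF assms])
  finally show ?thesis using fock_mass_eq[OF assms] by (simp only: of_real_eq_iff)
qed

lemma fock_function_diff:
  assumes "fock_function x" "fock_function y"
  shows "fock_function (\<lambda>n w. x n w - y n w)"
  using fock_function_add[OF assms(1) fock_function_scale[OF assms(2), of "-1"]] by simp

lemma abs_fock_diff:
  assumes "fock_function x" "fock_function y"
  shows "abs_fock x - abs_fock y = abs_fock (\<lambda>n w. x n w - y n w)"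
  using assms fock_function_scale[OF assms(2), of "-1"]
  by (simp add: minus_fock_def uminus_fock_def scaleC_fock.abs_eq plus_fock.abs_eq fock_eq_refl)

lemma half_power_square: "((1/2 :: real) ^ k)\<^sup>2 = (1/4) ^ k"
proof -
  have "((1/2 :: real) ^ k)\<^sup>2 = ((1/2)\<^sup>2) ^ k" unfolding power_mult[symmetric] by (simp only: mult.commute)
  also have "(1/2 :: real)\<^sup>2 = 1/4" by (simp add: power2_eq_square)
  finally show ?thesis .
qed

text \<open>The norm a of an increment satisfies a \<le> 2^-j + 2^j a^2, since either 2^j a \<le> 1
  or a \<le> 2^j a^2. Hence the increments are summable.\<close>

lemma convergent_if_geometric:
  fixes z :: "nat \<Rightarrow> complex"
  assumes "summable (\<lambda>j. 2 ^ j * (norm (z (Suc j) - z j))\<^sup>2)"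
  shows "convergent z"
proof -
  have le: "norm (z (Suc j) - z j) \<le> (1/2) ^ j + 2 ^ j * (norm (z (Suc j) - z j))\<^sup>2" for j
  proof -
    define a b where "a = norm (z (Suc j) - z j)" and "b = (2::real) ^ j"
    have b: "b > 0" and a: "0 \<le> a" by (simp_all add: a_def b_def)
    have "a \<le> 1 / b + b * a\<^sup>2"
    proof (cases "a * b \<le> 1")
      case True
      hence "a \<le> 1 / b" using b by (simp add: pos_le_divide_eq)
      thus ?thesis using b by (intro add_increasing2) auto
    next
      case False
      hence "a * 1 \<le> a * (a * b)" using a by (intro mult_left_mono) auto
      hence "a \<le> b * a\<^sup>2" by (simp add: power2_eq_square mult_ac)
      thus ?thesis using b by (intro add_increasing) auto
    qed
    thus ?thesis unfolding a_def b_def power_one_over .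
  qed
  have "summable (\<lambda>j. (1/2) ^ j + 2 ^ j * (norm (z (Suc j) - z j))\<^sup>2)"
    by (intro summable_add assms summable_geometric) simp
  hence "summable (\<lambda>j. z (Suc j) - z j)"
    by (rule summable_comparison_test'[of _ 0]) (rule le)
  hence "convergent (\<lambda>n. \<Sum>j<n. z (Suc j) - z j)"
    unfolding summable_iff_convergent .
  hence "convergent (\<lambda>n. z n - z 0)" unfolding sum_lessThan_telescope .
  from convergent_add[OF this convergent_const[of "z 0"]] show ?thesis by simp
qed

text \<open>Fatou's lemma, applied on each \<open>n\<close>-particle space and to the sum over \<open>n\<close>.\<close>

lemma fock_mass_liminf:
  assumes m: "\<And>j n. F j n \<in> borel_measurable (n_particle n)"
    and lim: "\<And>n. AE w in n_particle n. (\<lambda>j. F j n w) \<longlonglongrightarrow> L n w"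
  shows "fock_mass L \<le> liminf (\<lambda>j. fock_mass (F j))"
proof -
  have m2: "(\<lambda>w. ennreal ((norm (F j n w))\<^sup>2)) \<in> borel_measurable (n_particle n)" for j n
    using m[of j n] by measurable
  have le: "(\<integral>\<^sup>+w. ennreal ((norm (L n w))\<^sup>2) \<partial>n_particle n)
     \<le> liminf (\<lambda>j. \<integral>\<^sup>+w. ennreal ((norm (F j n w))\<^sup>2) \<partial>n_particle n)" for n
  proof -
    have "(\<integral>\<^sup>+w. ennreal ((norm (L n w))\<^sup>2) \<partial>n_particle n)
       = (\<integral>\<^sup>+w. liminf (\<lambda>j. ennreal ((norm (F j n w))\<^sup>2)) \<partial>n_particle n)"
    proof (rule nn_integral_cong_AE)
      show "AE w in n_particle n. ennreal ((norm (L n w))\<^sup>2) = liminf (\<lambda>j. ennreal ((norm (F j n w))\<^sup>2))"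
        using lim[of n]
      proof eventually_elim
        case (elim w)
        have "(\<lambda>j. ennreal ((norm (F j n w))\<^sup>2)) \<longlonglongrightarrow> ennreal ((norm (L n w))\<^sup>2)"
          by (intro tendsto_ennrealI tendsto_power tendsto_norm elim)
        thus ?case by (intro lim_imp_Liminf[symmetric]) simp_all
      qed
    qed
    also have "\<dots> \<le> liminf (\<lambda>j. \<integral>\<^sup>+w. ennreal ((norm (F j n w))\<^sup>2) \<partial>n_particle n)"
      by (rule nn_integral_liminf[OF m2])
    finally show ?thesis .
  qed
  have "fock_mass L \<le> (\<integral>\<^sup>+n. liminf (\<lambda>j. \<integral>\<^sup>+w. ennreal ((norm (F j n w))\<^sup>2) \<partial>n_particle n) \<partial>count_space UNIV)"
    unfolding fock_mass_def by (intro nn_integral_mono le)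
  also have "\<dots> \<le> liminf (\<lambda>j. fock_mass (F j))"
    unfolding fock_mass_def by (rule nn_integral_liminf) simp
  finally show ?thesis .
qed

text \<open>The Riesz-Fischer argument: a rapidly Cauchy subsequence converges almost everywhere for
  each particle number, and Fatou's lemma for its differences from a fixed \<open>X m\<close> shows
  that the pointwise limit represents the limit in norm.\<close>

instance fock :: complete_space
proof
  fix X :: "nat \<Rightarrow> fock" assume X: "Cauchy X"
  have "\<exists>N. \<forall>m\<ge>N. \<forall>n\<ge>N. norm (X m - X n) < (1/2) ^ k" for k
    using CauchyD[OF X, of "(1/2) ^ k"] by simp
  then obtain N where N: "\<And>k m n. m \<ge> N k \<Longrightarrow> n \<ge> N k \<Longrightarrow> norm (X m - X n) < (1/2) ^ k" by metis
  \<comment> \<open>Summing the thresholds makes \<open>r j\<close> at least \<open>N k\<close> for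
    every k \<le> j.\<close>
  define r where "r k = (\<Sum>i\<le>k. N i)" for k
  have rN: "r j \<ge> N k" if "j \<ge> k" for j k
    unfolding r_def using that member_le_sum[of k "{..j}" N] by simp
  define F where "F j = rep_fock (X (r j))" for j
  have F: "fock_function (F j)" for j unfolding F_def by (rule fock_function_rep)
  note Fm = fock_functionD(1)[OF F]
  note Fm[measurable]
  have massd: "fock_mass (\<lambda>n w. F j n w - rep_fock (X m) n w) \<le> ennreal ((1/4) ^ k)"
    if "j \<ge> k" "m \<ge> N k" for j m k
  proof -
    have "(norm (X (r j) - X m))\<^sup>2 \<le> ((1/2) ^ k)\<^sup>2"
      using N[OF rN[OF that(1)] that(2)] by (intro power_mono) auto
    also have "\<dots> = (1/4) ^ k" by (rule half_power_square)
    finally have "ennreal ((norm (X (r j) - X m))\<^sup>2) \<le> ennreal ((1/4) ^ k)" by (rule ennreal_leI)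
    moreover have "X (r j) - X m = abs_fock (\<lambda>n w. F j n w - rep_fock (X m) n w)"
      using abs_fock_diff[OF F fock_function_rep, of j "X m"] by (simp add: F_def abs_rep_fock)
    ultimately show ?thesis
      using norm_abs_fock[OF fock_function_diff[OF F fock_function_rep]] by simp
  qed
  have conv: "AE w in n_particle n. convergent (\<lambda>j. F j n w)" for n
  proof -
    \<comment> \<open>The squared increments have mass at most 4^-j; the weight 2^j required by
      \<open>convergent_if_geometric\<close> still leaves the summable bound 2^-j.\<close>
    let ?D = "\<lambda>j w. ennreal (2 ^ j * (norm (F (Suc j) n w - F j n w))\<^sup>2)"
    have b: "(\<integral>\<^sup>+w. ?D j w \<partial>n_particle n) \<le> ennreal ((1/2) ^ j)" for j
    proof -
      have "(\<integral>\<^sup>+w. ennreal ((norm (F (Suc j) n w - F j n w))\<^sup>2) \<partial>n_particle n)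
        \<le> fock_mass (\<lambda>n w. F (Suc j) n w - F j n w)"
        unfolding fock_mass_def by (rule nn_integral_ge_point) simp
      also have "\<dots> \<le> ennreal ((1/4) ^ j)"
        using massd[of j "Suc j" "r j"] rN[of j j] by (simp add: F_def)
      finally have "ennreal (2 ^ j) * (\<integral>\<^sup>+w. ennreal ((norm (F (Suc j) n w - F j n w))\<^sup>2) \<partial>n_particle n)
         \<le> ennreal (2 ^ j) * ennreal ((1/4) ^ j)" by (rule mult_left_mono) simp
      also have "\<dots> = ennreal (2 ^ j * (1/4) ^ j)" by (rule ennreal_mult[symmetric]) simp_all
      also have "(2 :: real) ^ j * (1/4) ^ j = (1/2) ^ j" unfolding power_mult_distrib[symmetric] by simp
      finally show ?thesis by (subst (asm) nn_integral_cmult[symmetric]) (simp_all add: ennreal_mult)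
    qed
    have "(\<integral>\<^sup>+w. (\<Sum>j. ?D j w) \<partial>n_particle n) = (\<Sum>j. \<integral>\<^sup>+w. ?D j w \<partial>n_particle n)"
      by (rule nn_integral_suminf) simp
    also have "\<dots> \<le> (\<Sum>j. ennreal ((1/2) ^ j))"
      by (intro suminf_le b summableI)
    also have "\<dots> = ennreal (\<Sum>j. (1/2) ^ j)" by (rule suminf_ennreal2) (simp_all add: summable_geometric)
    also have "\<dots> < \<infinity>" by simp
    finally have "AE w in n_particle n. (\<Sum>j. ?D j w) \<noteq> \<infinity>"
      by (intro nn_integral_PInf_AE) auto
    thus ?thesis
      by eventually_elim (intro convergent_if_geometric summable_suminf_not_top, auto)
  qed
  define L where "L n w = lim (\<lambda>j. F j n w)" for n w
  have Lm: "L n \<in> borel_measurable (n_particle n)" for n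
    unfolding L_def by (rule borel_measurable_lim_metric) simp
  \<comment> \<open>The sequences at \<open>w \<circ> p\<close> and at \<open>w\<close> are
    identical, so \<open>lim\<close> gives equal values even where they diverge. Symmetry thus holds
    at every point.\<close>
  have Ls: "L n (w \<circ> p) = L n w" if "p permutes {..<n}" "w \<in> space (n_particle n)" for n p w
    using F that by (simp add: L_def fock_function_def)
  have massL: "fock_mass (\<lambda>n w. L n w - rep_fock (X m) n w) \<le> ennreal ((1/4) ^ k)"
    if "m \<ge> N k" for m k
  proof -
    note fock_functionD(1)[OF fock_function_rep, measurable]
    have "fock_mass (\<lambda>n w. L n w - rep_fock (X m) n w)
      \<le> liminf (\<lambda>j. fock_mass (\<lambda>n w. F j n w - rep_fock (X m) n w))"
    proof (rule fock_mass_liminf)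
      show "AE w in n_particle n. (\<lambda>j. F j n w - rep_fock (X m) n w) \<longlonglongrightarrow> L n w - rep_fock (X m) n w" for n
        using conv[of n] by eventually_elim (intro tendsto_intros, simp add: L_def convergent_LIMSEQ_iff)
    qed measurable
    also have "\<dots> \<le> liminf (\<lambda>j::nat. ennreal ((1/4) ^ k))"
      by (rule Liminf_mono) (use massd that in \<open>auto simp: eventually_sequentially\<close>)
    finally show ?thesis by (simp add: Liminf_const)
  qed
  have diffL: "fock_function (\<lambda>n w. L n w - rep_fock (X m) n w)" if "m \<ge> N k" for m k
  proof (rule fock_functionI)
    note fock_functionD(1)[OF fock_function_rep, measurable] Lm[measurable]
    show "(\<lambda>w. L n w - rep_fock (X m) n w) \<in> borel_measurable (n_particle n)" for n by measurable
    show "fock_mass (\<lambda>n w. L n w - rep_fock (X m) n w) < \<infinity>"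
      using massL[OF that] by (rule le_less_trans) simp
  qed (use Ls fock_function_rep[of "X m"] in \<open>auto simp: fock_function_def\<close>)
  have "fock_function L"
    using fock_function_add[OF diffL[of 0 "N 0"] fock_function_rep[of "X (N 0)"]] by simp
  have "norm (X m - abs_fock L) \<le> (1/2) ^ k" if "m \<ge> N k" for m k
  proof -
    have "abs_fock L - X m = abs_fock (\<lambda>n w. L n w - rep_fock (X m) n w)"
      using abs_fock_diff[OF \<open>fock_function L\<close> fock_function_rep, of "X m"] by (simp add: abs_rep_fock)
    hence "ennreal ((norm (abs_fock L - X m))\<^sup>2) \<le> ennreal ((1/4) ^ k)"
      using norm_abs_fock[OF diffL[OF that]] massL[OF that] by simp
    hence "(norm (abs_fock L - X m))\<^sup>2 \<le> (1/4) ^ k" by (simp add: ennreal_le_iff)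
    also have "\<dots> = ((1/2) ^ k)\<^sup>2" by (rule half_power_square[symmetric])
    finally have "norm (abs_fock L - X m) \<le> (1/2) ^ k" by (rule power2_le_imp_le) simp
    thus ?thesis by (subst norm_minus_commute)
  qed
  note close = this
  have "X \<longlonglongrightarrow> abs_fock L"
  proof (rule LIMSEQ_I)
    fix e :: real assume "e > 0"
    then obtain k where "(1/2) ^ k < e" using real_arch_pow_inv[of e "1/2"] by auto
    thus "\<exists>no. \<forall>n\<ge>no. norm (X n - abs_fock L) < e"
      using close by (meson le_less_trans)
  qed
  thus "convergent X" by (rule convergentI)
qed

section \<open>Operators on square-summable families\<close>

lemma ell2_nth_simps [simp]:
  "ell2_nth (x + y) i = ell2_nth x i + ell2_nth y i"
  "ell2_nth (c *\<^sub>C x) i = c *\<^sub>C ell2_nth x i"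
  "ell2_nth (r *\<^sub>R x) i = r *\<^sub>R ell2_nth x i"
  "ell2_nth 0 i = 0"
  "ell2_nth (x - y) i = ell2_nth x i - ell2_nth y i"
  by (simp_all only: plus_ell2.rep_eq scaleC_ell2.rep_eq scaleR_ell2_def scaleR_scaleC zero_ell2.rep_eq
    minus_ell2_def uminus_ell2.rep_eq diff_conv_add_uminus)

lemma has_sum_finite_sum:
  fixes f :: "'b \<Rightarrow> 'a \<Rightarrow> 'c::topological_comm_monoid_add"
  assumes "finite B" "\<And>b. b \<in> B \<Longrightarrow> (f b has_sum s b) A"
  shows "((\<lambda>i. \<Sum>b\<in>B. f b i) has_sum (\<Sum>b\<in>B. s b)) A"
  using assms by (induction B) (auto intro: has_sum_add)

lemma ell2_nth_sum: "ell2_nth (\<Sum>a\<in>A. f a) i = (\<Sum>a\<in>A. ell2_nth (f a) i)"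
  by (induction A rule: infinite_finite_induct) auto

lemma ell2_summable: "(\<lambda>i. (norm (ell2_nth u i))\<^sup>2) summable_on UNIV"
  using ell2_nth[of u] by simp

lemma norm_ell2_square: "(norm u)\<^sup>2 = (\<Sum>\<^sub>\<infinity>i. (norm (ell2_nth u i))\<^sup>2)"
proof -
  have "complex_of_real ((norm u)\<^sup>2) = (\<Sum>\<^sub>\<infinity>i. complex_of_real ((norm (ell2_nth u i))\<^sup>2))"
    unfolding cinner_same[symmetric] cinner_ell2.rep_eq ..
  also have "\<dots> = complex_of_real (\<Sum>\<^sub>\<infinity>i. (norm (ell2_nth u i))\<^sup>2)"
    by (intro infsumI has_sum_of_real has_sum_infsum ell2_summable)
  finally show ?thesis unfolding of_real_eq_iff .
qed

lemma ell2_partial_sum_le: "finite J \<Longrightarrow> (\<Sum>i\<in>J. (norm (ell2_nth u i))\<^sup>2) \<le> (norm u)\<^sup>2"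
  unfolding norm_ell2_square by (rule finite_sum_le_infsum) (auto simp: ell2_summable)

lemma norm_ell2_nth_le: "norm (ell2_nth u i) \<le> norm u"
  using ell2_partial_sum_le[of "{i}" u] by (simp add: power2_le_iff_abs_le)

text \<open>For operators defined coordinatewise: one estimate on finite partial sums yields both
  square-summability of the image and the operator bound.\<close>

lemma Abs_ell2_bounded:
  assumes "\<And>J. finite J \<Longrightarrow> (\<Sum>i\<in>J. (norm (f i))\<^sup>2) \<le> C\<^sup>2" and "0 \<le> C"
  shows "ell2_nth (Abs_ell2 f) i = f i" and "norm (Abs_ell2 f) \<le> C"
proof -
  have s: "(\<lambda>i. (norm (f i))\<^sup>2) summable_on UNIV"
    by (rule nonneg_bounded_partial_sums_imp_summable_on[of _ _ "C\<^sup>2"])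
       (use assms(1) in \<open>auto intro: eventually_finite_subsets_at_top_weakI\<close>)
  thus n: "ell2_nth (Abs_ell2 f) i = f i" for i by (subst Abs_ell2_inverse) auto
  have "(norm (Abs_ell2 f))\<^sup>2 \<le> C\<^sup>2"
    unfolding norm_ell2_square n by (rule infsum_le_finite_sums) (use s assms(1) in auto)
  thus "norm (Abs_ell2 f) \<le> C" by (rule power2_le_imp_le) (rule assms(2))
qed

lift_definition single :: "'i \<Rightarrow> 'k::complex_inner \<Rightarrow> ('i, 'k) ell2"
  is "\<lambda>i k j. if j = i then k else 0"
proof -
  fix i :: 'i and k :: 'k
  show "(\<lambda>j. (norm (if j = i then k else 0))\<^sup>2) summable_on UNIV"
    by (rule finite_nonzero_values_imp_summable_on, rule finite_subset[of _ "{i}"]) auto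
qed

lemma single_nth [simp]: "ell2_nth (single i k) j = (if j = i then k else 0)"
  by (simp add: single.rep_eq)

lemma single_scaleC: "single i (c *\<^sub>C k) = c *\<^sub>C single i k"
  by (rule ell2_eqI) (simp add: scaleC.zero_right)

text \<open>By orthogonality, the squared distance from \<open>u\<close> to its partial sum over
  \<open>M\<close> is \<parallel>u\<parallel>^2 minus the sum of the squared coordinate norms over
  \<open>M\<close>, which tends to 0.\<close>

lemma ell2_has_sum: "((\<lambda>i. single i (ell2_nth u i)) has_sum u) UNIV"
proof -
  let ?g = "\<lambda>i. (norm (ell2_nth u i))\<^sup>2"
  have n: "(norm (sum (\<lambda>i. single i (ell2_nth u i)) M - u))\<^sup>2 = (norm u)\<^sup>2 - sum ?g M" if M: "finite M" for M
  proof -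
    have s: "(\<lambda>j. if j \<in> M then ?g j else 0) summable_on UNIV"
      by (rule finite_nonzero_values_imp_summable_on, rule finite_subset[OF _ M]) auto
    have "(norm (sum (\<lambda>i. single i (ell2_nth u i)) M - u))\<^sup>2 + (\<Sum>\<^sub>\<infinity>j. if j \<in> M then ?g j else 0)
        = (\<Sum>\<^sub>\<infinity>j. (norm (ell2_nth (sum (\<lambda>i. single i (ell2_nth u i)) M - u) j))\<^sup>2 + (if j \<in> M then ?g j else 0))"
      unfolding norm_ell2_square by (rule infsum_add[symmetric, OF ell2_summable s])
    also have "\<dots> = (norm u)\<^sup>2"
      unfolding norm_ell2_square by (intro infsum_cong) (simp add: ell2_nth_sum M)
    also have "(\<Sum>\<^sub>\<infinity>j. if j \<in> M then ?g j else 0) = infsum ?g M"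
      by (rule infsum_cong_neutral) auto
    finally show ?thesis using M by simp
  qed
  have "(sum ?g \<longlongrightarrow> (norm u)\<^sup>2) (finite_subsets_at_top UNIV)"
    using has_sum_infsum[OF ell2_summable[of u]] by (simp add: has_sum_def norm_ell2_square)
  hence "((\<lambda>M. (norm u)\<^sup>2 - sum ?g M) \<longlongrightarrow> (norm u)\<^sup>2 - (norm u)\<^sup>2) (finite_subsets_at_top UNIV)"
    by (intro tendsto_intros)
  hence "((\<lambda>M. (norm (sum (\<lambda>i. single i (ell2_nth u i)) M - u))\<^sup>2) \<longlongrightarrow> 0) (finite_subsets_at_top UNIV)"
    by (subst tendsto_cong[of _ "\<lambda>M. (norm u)\<^sup>2 - sum ?g M"])
       (auto intro!: eventually_finite_subsets_at_top_weakI simp: n)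
  from tendsto_real_sqrt[OF this]
  have "((\<lambda>M. norm (sum (\<lambda>i. single i (ell2_nth u i)) M - u)) \<longlongrightarrow> 0) (finite_subsets_at_top UNIV)"
    by simp
  thus ?thesis unfolding has_sum_def by (simp add: tendsto_norm_zero_iff LIM_zero_iff)
qed

lemma ell2_linear_eqI:
  fixes f g :: "('i, 'k::complex_inner) ell2 \<Rightarrow> 'b::real_normed_vector"
  assumes "bounded_linear f" "bounded_linear g"
    and "\<And>i k. f (single i k) = g (single i k)"
  shows "f u = g u"
  using has_sum_bounded_linear[OF assms(1) ell2_has_sum[of u]]
    has_sum_bounded_linear[OF assms(2) ell2_has_sum[of u]]
  by (simp add: assms(3) o_def has_sum_unique)

lemma cinner_single_left: "cinner (single i k) u = cinner k (ell2_nth u i)"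
proof -
  have "cinner (single i k) u = infsum (\<lambda>j. cinner (ell2_nth (single i k) j) (ell2_nth u j)) {i}"
    unfolding cinner_ell2.rep_eq by (rule infsum_cong_neutral) (auto simp: cinner.zero_left)
  thus ?thesis by simp
qed

lemma cinner_single_right: "cinner u (single i k) = cinner (ell2_nth u i) k"
  using cinner_single_left[of i k u] by (metis cinner_commute)

section \<open>Ampliations\<close>

lift_definition coslice :: "'k::complex_inner \<Rightarrow> ('i, 'k) ell2 \<Rightarrow> ('i, complex) ell2"
  is "\<lambda>k x i. cinner k (x i)"
proof -
  fix k :: 'k and x :: "'i \<Rightarrow> 'k"
  assume "(\<lambda>i. (norm (x i))\<^sup>2) summable_on UNIV"
  hence "(\<lambda>i. (norm k)\<^sup>2 * (norm (x i))\<^sup>2) summable_on UNIV" by (rule summable_on_cmult_right)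
  thus "(\<lambda>i. (norm (cinner k (x i)))\<^sup>2) summable_on UNIV"
    by (rule summable_on_comparison_test)
       (auto simp flip: power_mult_distrib intro!: power_mono norm_cinner_le)
qed

lemma coslice_nth [simp]: "ell2_nth (coslice k x) i = cinner k (ell2_nth x i)"
  by (simp add: coslice.rep_eq)

lemma norm_coslice: "norm (coslice k x) \<le> norm k * norm x"
proof (rule power2_le_imp_le)
  have "(norm (coslice k x))\<^sup>2 \<le> (\<Sum>\<^sub>\<infinity>i. (norm k)\<^sup>2 * (norm (ell2_nth x i))\<^sup>2)"
    unfolding norm_ell2_square
  proof (rule infsum_mono)
    show "(\<lambda>i. (norm (ell2_nth (coslice k x) i))\<^sup>2) summable_on UNIV" by (rule ell2_summable)
    show "(\<lambda>i. (norm k)\<^sup>2 * (norm (ell2_nth x i))\<^sup>2) summable_on UNIV"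
      by (intro summable_on_cmult_right ell2_summable)
  qed (auto simp flip: power_mult_distrib intro!: power_mono norm_cinner_le)
  also have "\<dots> = (norm k * norm x)\<^sup>2"
    by (simp add: infsum_cmult_right' norm_ell2_square power_mult_distrib)
  finally show "(norm (coslice k x))\<^sup>2 \<le> (norm k * norm x)\<^sup>2" .
qed simp

lemma coslice_simps:
  "coslice (k + l) x = coslice k x + coslice l x"
  "coslice k (x + y) = coslice k x + coslice k y"
  "coslice (c *\<^sub>C k) x = cnj c *\<^sub>C coslice k x"
  "coslice k (c *\<^sub>C x) = c *\<^sub>C coslice k x"
  "coslice (r *\<^sub>R k) x = r *\<^sub>R coslice k x"
  "coslice k (r *\<^sub>R x) = r *\<^sub>R coslice k x"
  "coslice k (single i l) = cinner k l *\<^sub>C single i 1"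
  by (rule ell2_eqI; simp add: cinner.add_left cinner.add_right cinner_scaleC_left cinner_scaleC_right
    cinner.scaleR_left cinner.scaleR_right scaleC_complex_def cinner.zero_right)+

text \<open>The map \<open>coslice k\<close> is 1 \<otimes> \<langle>k|. Testing with all of these
  reduces every identity between ampliations to one between operators on scalar families, via
  \<open>coslice_amp\<close>.\<close>

lemma coslice_eqI:
  assumes "\<And>k. coslice k x = coslice k y"
  shows "x = y"
proof (rule ell2_eqI, rule cinner_eqI)
  show "cinner k (ell2_nth x i) = cinner k (ell2_nth y i)" for i k
    using assms[of k] by (simp flip: coslice_nth)
qed

text \<open>For complex-linear \<open>T\<close> the right-hand side is bounded and conjugate-linear
  in \<open>k\<close>. Its complex conjugate is therefore a functional to which Riesz representation
  applies, and the choice is the coordinate \<open>i\<close> of (T \<otimes> 1) x.\<close>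

definition amp_nth :: "(('i, complex) ell2 \<Rightarrow>\<^sub>L ('i, complex) ell2) \<Rightarrow> ('i, 'k) ell2 \<Rightarrow> 'i \<Rightarrow>
    'k::{complex_inner, complete_space}" where
  "amp_nth T x i = (SOME y. \<forall>k. cinner k y = ell2_nth (T (coslice k x)) i)"

text \<open>The ampliation \<open>T \<otimes> 1\<close>, defined weakly by Riesz representation (see \<open>coslice_amp\<close>).\<close>

definition amp :: "(('i, complex) ell2 \<Rightarrow>\<^sub>L ('i, complex) ell2) \<Rightarrow>
    (('i, 'k::{complex_inner, complete_space}) ell2 \<Rightarrow>\<^sub>L ('i, 'k) ell2)" where
  "amp T = Blinfun (\<lambda>x. Abs_ell2 (amp_nth T x))"

lemma cinner_amp_nth:
  assumes T: "complex_linear T"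
  shows "cinner k (amp_nth T x i) = ell2_nth (T (coslice k x)) i"
proof -
  let ?f = "\<lambda>k. cnj (ell2_nth (T (coslice k x)) i)"
  have "bounded_linear ?f"
  proof (rule bounded_linear_intro[where K = "norm T * norm x"])
    fix k
    have "norm (?f k) \<le> norm (T (coslice k x))" by (simp add: norm_ell2_nth_le)
    also have "\<dots> \<le> norm T * norm (coslice k x)" by (rule norm_blinfun)
    also have "\<dots> \<le> norm T * (norm k * norm x)" by (intro mult_left_mono norm_coslice) simp
    finally show "norm (?f k) \<le> norm k * (norm T * norm x)" by (simp add: mult_ac)
  qed (simp_all add: coslice_simps blinfun.add_right blinfun.scaleR_right)
  moreover have "?f (c *\<^sub>C k) = c * ?f k" for c k
    using T by (simp add: coslice_simps complex_linear_def scaleC_complex_def)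
  ultimately obtain y where y: "\<And>k. ?f k = cinner y k" using riesz_representation by blast
  have "\<forall>k. cinner k y = ell2_nth (T (coslice k x)) i"
    using y cinner_commute[of _ y] by (metis complex_cnj_cnj)
  thus ?thesis unfolding amp_nth_def by (rule someI2) blast
qed

text \<open>This is \<parallel>T \<otimes> 1\<parallel> \<le> \<parallel>T\<parallel>. The vectors
  indexed by \<open>J\<close> lie in the span of a finite orthonormal \<open>B\<close>; Parseval in
  \<open>B\<close>, the bound of \<open>T\<close> on each \<open>coslice b x\<close> and Bessel's
  inequality for the coordinates of \<open>x\<close> combine after an exchange of sums.\<close>

lemma amp_nth_bound:
  assumes T: "complex_linear T" and J: "finite J"
  shows "(\<Sum>i\<in>J. (norm (amp_nth T x i))\<^sup>2) \<le> (norm T * norm x)\<^sup>2"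
proof -
  obtain B where B: "finite B" "orthonormal B"
    and exp: "\<And>i. i \<in> J \<Longrightarrow> amp_nth T x i = (\<Sum>b\<in>B. cinner b (amp_nth T x i) *\<^sub>C b)"
    using gram_schmidt[of "amp_nth T x ` J"] J by fastforce
  have "(\<Sum>i\<in>J. (norm (amp_nth T x i))\<^sup>2) = (\<Sum>i\<in>J. \<Sum>b\<in>B. (cmod (cinner b (amp_nth T x i)))\<^sup>2)"
    by (intro sum.cong refl parseval_finite exp)
  also have "\<dots> = (\<Sum>b\<in>B. \<Sum>i\<in>J. (cmod (ell2_nth (T (coslice b x)) i))\<^sup>2)"
    by (subst sum.swap) (simp add: cinner_amp_nth[OF T])
  also have "\<dots> \<le> (\<Sum>b\<in>B. (norm (T (coslice b x)))\<^sup>2)"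
    by (intro sum_mono ell2_partial_sum_le J)
  also have "\<dots> \<le> (\<Sum>b\<in>B. (norm T)\<^sup>2 * (norm (coslice b x))\<^sup>2)"
    by (intro sum_mono) (auto simp flip: power_mult_distrib intro!: power_mono norm_blinfun)
  also have "\<dots> = (norm T)\<^sup>2 * (\<Sum>b\<in>B. (norm (coslice b x))\<^sup>2)" by (simp add: sum_distrib_left)
  also have "(\<Sum>b\<in>B. (norm (coslice b x))\<^sup>2) \<le> (norm x)\<^sup>2"
  proof -
    have "((\<lambda>i. \<Sum>b\<in>B. (cmod (cinner b (ell2_nth x i)))\<^sup>2) has_sum (\<Sum>b\<in>B. (norm (coslice b x))\<^sup>2)) UNIV"
      unfolding norm_ell2_square
      by (intro has_sum_finite_sum B(1)) (use has_sum_infsum[OF ell2_summable[of "coslice _ x"]] in simp)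
    moreover have "((\<lambda>i. (norm (ell2_nth x i))\<^sup>2) has_sum (norm x)\<^sup>2) UNIV"
      unfolding norm_ell2_square by (rule has_sum_infsum[OF ell2_summable])
    ultimately show ?thesis by (rule has_sum_mono) (rule bessel_finite[OF B])
  qed
  finally show ?thesis by (simp add: power_mult_distrib mult_left_mono)
qed

lemma coslice_amp:
  fixes x :: "('i, 'k::{complex_inner, complete_space}) ell2"
  assumes T: "complex_linear T"
  shows "coslice k (amp T x) = T (coslice k x)"
proof -
  note b = Abs_ell2_bounded[OF amp_nth_bound[OF T] mult_nonneg_nonneg[OF norm_ge_zero norm_ge_zero]]
  have c: "coslice k (Abs_ell2 (amp_nth T x)) = T (coslice k x)" for k and x :: "('i, 'k) ell2"
    by (rule ell2_eqI) (simp add: b(1) cinner_amp_nth[OF T])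
  have "bounded_linear (\<lambda>x :: ('i, 'k) ell2. Abs_ell2 (amp_nth T x))"
  proof (rule bounded_linear_intro[where K = "norm T"])
    show "Abs_ell2 (amp_nth T (x + y)) = Abs_ell2 (amp_nth T x) + Abs_ell2 (amp_nth T y)"
      for x y :: "('i, 'k) ell2"
      by (rule coslice_eqI) (simp add: c coslice_simps blinfun.add_right)
    show "Abs_ell2 (amp_nth T (r *\<^sub>R x)) = r *\<^sub>R Abs_ell2 (amp_nth T x)" for x :: "('i, 'k) ell2" and r
      by (rule coslice_eqI) (simp add: c coslice_simps blinfun.scaleR_right)
    show "norm (Abs_ell2 (amp_nth T x)) \<le> norm x * norm T" for x :: "('i, 'k) ell2"
      using b(2)[of x] by (simp add: mult.commute)
  qed
  thus ?thesis by (simp add: amp_def bounded_linear_Blinfun_apply c)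
qed

lemma amp_simps:
  assumes "complex_linear S" "complex_linear T"
  shows "amp (S + T) = amp S + amp T"
    and "amp (c *\<^sub>C T) = c *\<^sub>C amp T"
    and "amp (S o\<^sub>L T) = amp S o\<^sub>L amp T"
proof -
  have "complex_linear (S + T)" "complex_linear (c *\<^sub>C T)" "complex_linear (S o\<^sub>L T)"
    using assms by (simp_all add: complex_linear_def blinfun.add_left scaleC_add_right
      scaleC_blinfun.rep_eq scaleC_scaleC mult.commute)
  note c = this[THEN coslice_amp] assms[THEN coslice_amp]
  show "amp (S + T) = amp S + amp T" "amp (c *\<^sub>C T) = c *\<^sub>C amp T" "amp (S o\<^sub>L T) = amp S o\<^sub>L amp T"
    by (rule blinfun_eqI, rule coslice_eqI, simp add: c blinfun.add_left coslice_simps scaleC_blinfun.rep_eq)+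
qed

lemma amp_id: "amp id_blinfun = id_blinfun"
  by (rule blinfun_eqI, rule coslice_eqI) (simp add: coslice_amp complex_linear_def)

lemma complex_linear_amp:
  assumes T: "complex_linear T"
  shows "complex_linear (amp T)"
  unfolding complex_linear_def
proof (intro allI, rule coslice_eqI)
  show "coslice k (amp T (c *\<^sub>C x)) = coslice k (c *\<^sub>C amp T x)" for k c x
    using T by (simp add: coslice_amp coslice_simps complex_linear_def)
qed

lemma amp_single:
  assumes T: "complex_linear T"
  shows "ell2_nth (amp T (single k l)) i = ell2_nth (T (single k 1)) i *\<^sub>C l"
proof (rule cinner_eqI)
  fix z
  have "cinner z (ell2_nth (amp T (single k l)) i) = ell2_nth (T (coslice z (single k l))) i"
    unfolding coslice_nth[symmetric] coslice_amp[OF T] ..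
  thus "cinner z (ell2_nth (amp T (single k l)) i) = cinner z (ell2_nth (T (single k 1)) i *\<^sub>C l)"
    using T by (simp add: coslice_simps complex_linear_def cinner_scaleC_right scaleC_complex_def)
qed

section \<open>Adjoints\<close>

lemma complex_linear_if_adjoint:
  fixes S T :: "'a::complex_inner \<Rightarrow>\<^sub>L 'a"
  assumes "\<And>x y. cinner (S x) y = cinner x (T y)"
  shows "complex_linear S"
  unfolding complex_linear_def
proof (intro allI, rule cinner_eqI)
  fix c x z
  have "cinner (S (c *\<^sub>C x)) z = cinner (c *\<^sub>C S x) z"
    by (simp add: assms cinner_scaleC_left)
  thus "cinner z (S (c *\<^sub>C x)) = cinner z (c *\<^sub>C S x)" by (metis cinner_commute)
qed

text \<open>As \<open>adjoint_op\<close> is a definite description, an adjoint has to be exhibited.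
  With e_i the unit vectors, its coordinate \<open>i\<close> at \<open>u\<close> can only be
  \<langle>T e_i, u\<rangle>; the work lies in the square-summability of these numbers.\<close>

lemma ell2_adjoint:
  fixes T :: "('i, complex) ell2 \<Rightarrow>\<^sub>L ('i, complex) ell2"
  assumes T: "complex_linear T"
  shows "cinner (adjoint_op T x) y = cinner x (T y)" and "complex_linear (adjoint_op T)"
proof -
  let ?a = "\<lambda>u i. cinner (T (single i 1)) u"
  have bound: "(\<Sum>i\<in>J. (norm (?a u i))\<^sup>2) \<le> (norm T * norm u)\<^sup>2" if J: "finite J" for u J
  proof -
    \<comment> \<open>Testing against this vector gives s = \<langle>T v, u\<rangle> \<le>
      \<parallel>T\<parallel> \<parallel>v\<parallel> \<parallel>u\<parallel>, where
      \<parallel>v\<parallel>^2 = s; one factor of \<open>s\<close> then cancels after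
      squaring.\<close>
    define v where "v = (\<Sum>i\<in>J. ?a u i *\<^sub>C single i (1 :: complex))"
    define s where "s = (\<Sum>i\<in>J. (norm (?a u i))\<^sup>2)"
    have s0: "0 \<le> s" unfolding s_def by (intro sum_nonneg) simp
    have s: "complex_of_real s = (\<Sum>i\<in>J. cnj (?a u i) * ?a u i)"
      unfolding s_def of_real_sum complex_norm_square by (simp only: mult.commute)
    have vn: "ell2_nth v i = ?a u i" if "i \<in> J" for i
      using that J by (simp add: v_def ell2_nth_sum scaleC_complex_def if_distrib cong: if_cong)
    have "cinner v v = (\<Sum>i\<in>J. cnj (?a u i) * ell2_nth v i)"
      by (subst (1) v_def) (simp add: cinner.sum_left cinner_scaleC_left cinner_single_left cinner_complex_def)
    also have "\<dots> = complex_of_real s" by (simp add: vn s)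
    finally have nv: "(norm v)\<^sup>2 = s" unfolding cinner_same of_real_eq_iff .
    have "cinner (T v) u = complex_of_real s"
      using T unfolding v_def s
      by (simp add: blinfun.sum_right complex_linear_def cinner.sum_left cinner_scaleC_left)
    hence "s = cmod (cinner (T v) u)" using s0 by simp
    also have "\<dots> \<le> norm (T v) * norm u" by (rule norm_cinner_le)
    also have "\<dots> \<le> (norm T * norm v) * norm u" by (intro mult_right_mono norm_blinfun) simp
    finally have "s\<^sup>2 \<le> (norm T * norm v * norm u)\<^sup>2" using s0 by (rule power_mono)
    also have "\<dots> = s * (norm T * norm u)\<^sup>2" by (simp add: power_mult_distrib nv)
    finally have "s * s \<le> s * (norm T * norm u)\<^sup>2" by (simp add: power2_eq_square)
    hence "s \<le> (norm T * norm u)\<^sup>2"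
      using s0 by (cases "s = 0") (auto simp: mult_le_cancel_left)
    thus ?thesis by (simp add: s_def)
  qed
  note b = Abs_ell2_bounded[OF bound mult_nonneg_nonneg[OF norm_ge_zero norm_ge_zero]]
  define S0 where "S0 u = Abs_ell2 (?a u)" for u
  have S0n: "ell2_nth (S0 u) i = ?a u i" for u i by (simp add: S0_def b(1))
  define S where "S = Blinfun S0"
  have "bounded_linear S0"
  proof (rule bounded_linear_intro[where K = "norm T"])
    show "S0 (u + v) = S0 u + S0 v" for u v
      by (rule ell2_eqI) (simp add: S0n cinner.add_right)
    show "S0 (r *\<^sub>R u) = r *\<^sub>R S0 u" for u r
      by (rule ell2_eqI) (simp add: S0n cinner.scaleR_right)
    show "norm (S0 u) \<le> norm u * norm T" for u
      using b(2)[of u] by (simp add: S0_def mult.commute)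
  qed
  hence Sn: "ell2_nth (S u) i = ?a u i" for u i
    by (simp add: S_def bounded_linear_Blinfun_apply S0n)
  have S: "cinner (S x) y = cinner x (T y)" for x y
  proof (rule ell2_linear_eqI[where f = "\<lambda>y. cinner (S x) y" and g = "\<lambda>y. cinner x (T y)"])
    show "bounded_linear (\<lambda>y. cinner (S x) y)" by (rule cinner.bounded_linear_right)
    show "bounded_linear (\<lambda>y. cinner x (T y))"
      by (rule bounded_linear_compose[OF cinner.bounded_linear_right blinfun.bounded_linear_right])
    fix i :: 'i and k :: complex
    have k: "single i k = k *\<^sub>C single i (1 :: complex)" by (simp flip: single_scaleC add: scaleC_complex_def)
    have "cinner (S x) (single i k) = k * cnj (?a x i)"
      by (simp add: cinner_single_right Sn cinner_complex_def)
    also have "\<dots> = cinner x (T (single i k))"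
      using T by (simp add: k complex_linear_def cinner_scaleC_right cinner_commute[of x])
    finally show "cinner (S x) (single i k) = cinner x (T (single i k))" .
  qed
  hence "adjoint_op T = S" by (rule adjoint_opI)
  thus "cinner (adjoint_op T x) y = cinner x (T y)" "complex_linear (adjoint_op T)"
    using S complex_linear_if_adjoint[OF S] by simp_all
qed

text \<open>Both sides are bounded and real-linear in \<open>y\<close>, so
  \<open>y = single i k\<close> suffices; there the coslice along \<open>k\<close> leads back to the
  adjoint relation for \<open>T\<close> itself.\<close>

lemma amp_adjoint:
  fixes x y :: "('i, 'k::{complex_inner, complete_space}) ell2"
  assumes T: "complex_linear T"
  shows "cinner (amp (adjoint_op T) x) y = cinner x (amp T y)"
proof (rule ell2_linear_eqI[where g = "\<lambda>y. cinner x (amp T y)"])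
  show "bounded_linear (cinner (amp (adjoint_op T) x))" by (rule cinner.bounded_linear_right)
  show "bounded_linear (\<lambda>y. cinner x (amp T y))"
    by (rule bounded_linear_compose[OF cinner.bounded_linear_right blinfun.bounded_linear_right])
  fix i :: 'i and k :: 'k
  have "cinner (amp (adjoint_op T) x) (single i k) = cnj (ell2_nth (coslice k (amp (adjoint_op T) x)) i)"
    by (simp add: cinner_single_right cinner_commute[of _ k])
  also have "\<dots> = cinner (adjoint_op T (coslice k x)) (single i 1)"
    by (simp add: coslice_amp ell2_adjoint(2)[OF T] cinner_single_right cinner_complex_def)
  also have "\<dots> = (\<Sum>\<^sub>\<infinity>j. cnj (cinner k (ell2_nth x j)) * ell2_nth (T (single i 1)) j)"
    unfolding ell2_adjoint(1)[OF T] by (simp add: cinner_ell2.rep_eq cinner_complex_def)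
  also have "\<dots> = (\<Sum>\<^sub>\<infinity>j. cinner (ell2_nth x j) (ell2_nth (amp T (single i k)) j))"
    by (intro infsum_cong) (simp add: amp_single[OF T] cinner_scaleC_right cinner_commute[of _ k])
  finally show "cinner (amp (adjoint_op T) x) (single i k) = cinner x (amp T (single i k))"
    by (simp add: cinner_ell2.rep_eq)
qed

section \<open>Direct sums of isometries\<close>

definition diag_op :: "('i \<Rightarrow> 'k \<Rightarrow> 'k) \<Rightarrow> (('i, 'k::complex_inner) ell2 \<Rightarrow>\<^sub>L ('i, 'k) ell2)" where
  "diag_op W = Blinfun (\<lambda>x. Abs_ell2 (\<lambda>i. W i (ell2_nth x i)))"

lemma diag_op_nth:
  fixes W :: "'i \<Rightarrow> 'k::complex_inner \<Rightarrow> 'k"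
  assumes W: "\<And>i x y. cinner (W i x) (W i y) = cinner x y"
  shows "ell2_nth (diag_op W x) i = W i (ell2_nth x i)"
proof -
  have b: "(\<Sum>i\<in>J. (norm (W i (ell2_nth x i)))\<^sup>2) \<le> (norm x)\<^sup>2" if "finite J" for J x
    using ell2_partial_sum_le[OF that] by (simp add: cinner_preserving_norm[OF W])
  note b = Abs_ell2_bounded[OF b norm_ge_zero]
  define S where "S x = Abs_ell2 (\<lambda>i. W i (ell2_nth x i))" for x
  have Sn: "ell2_nth (S x) i = W i (ell2_nth x i)" for x i by (simp add: S_def b(1))
  have add: "W i (a + b) = W i a + W i b" and sc: "W i (c *\<^sub>C a) = c *\<^sub>C W i a" for i a b c
    by (rule cinner_preserving_linear[of "W i"], rule W)+
  have "bounded_linear S"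
  proof (rule bounded_linear_intro[where K = 1])
    show "S (x + y) = S x + S y" for x y by (rule ell2_eqI) (simp add: Sn add)
    show "S (r *\<^sub>R x) = r *\<^sub>R S x" for x r
      by (rule ell2_eqI) (simp only: scaleR_scaleC ell2_nth_simps Sn sc)
    show "norm (S x) \<le> norm x * 1" for x using b(2)[of x] by (simp add: S_def)
  qed
  moreover have "diag_op W = Blinfun S" by (simp add: diag_op_def S_def[abs_def])
  ultimately show ?thesis by (simp add: bounded_linear_Blinfun_apply Sn)
qed

section \<open>Weyl operators\<close>

lemma L2_add:
  assumes f: "f \<in> L2_half_line" and g: "g \<in> L2_half_line"
  shows "(\<lambda>s. f s + g s) \<in> L2_half_line"
proof -
  have [measurable]: "f \<in> borel_measurable half_line" "g \<in> borel_measurable half_line"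
    and int: "integrable half_line (\<lambda>t. 2 * (norm (f t))\<^sup>2 + 2 * (norm (g t))\<^sup>2)"
    using f g by (simp_all add: L2_half_line_def)
  have "integrable half_line (\<lambda>t. (norm (f t + g t))\<^sup>2)"
    by (rule Bochner_Integration.integrable_bound[OF int]) (simp_all add: norm_add_square_le)
  thus ?thesis by (simp add: L2_half_line_def)
qed

lemma L2_zero: "(\<lambda>_. 0) \<in> L2_half_line"
  by (simp add: L2_half_line_def)

lemma L2_cinner_add_right:
  assumes "f \<in> L2_half_line" "g \<in> L2_half_line" "k \<in> L2_half_line"
  shows "L2_cinner f (\<lambda>s. g s + k s) = L2_cinner f g + L2_cinner f k"
  unfolding one_particle_facts(3)[OF assms(1,2), symmetric] one_particle_facts(3)[OF assms(1,3), symmetric]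
    one_particle_facts(3)[OF assms(1) L2_add[OF assms(2,3)], symmetric]
  using one_particle_facts(2)[OF assms(1,2)] one_particle_facts(2)[OF assms(1,3)]
  by (simp add: distrib_left)

lemma L2_cinner_commute: "L2_cinner f g = cnj (L2_cinner g f)"
  unfolding L2_cinner_def Bochner_Integration.integral_cnj[symmetric]
  by (rule Bochner_Integration.integral_cong) (simp_all add: mult.commute)

lemma L2_cinner_add_left:
  assumes "f \<in> L2_half_line" "g \<in> L2_half_line" "k \<in> L2_half_line"
  shows "L2_cinner (\<lambda>s. g s + k s) f = L2_cinner g f + L2_cinner k f"
  using L2_cinner_add_right[OF assms] by (metis L2_cinner_commute complex_cnj_add)

definition weyl_factor :: "(real \<Rightarrow> complex^2) \<Rightarrow> (real \<Rightarrow> complex^2) \<Rightarrow> complex" where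
  "weyl_factor k f = exp (- (L2_cinner k k / 2) - L2_cinner k f)"

text \<open>The three conditions determine \<open>W\<close>: preservation makes it bounded and
  linear, and its values are prescribed on the exponential vectors and on their orthogonal
  complement.\<close>

definition weyl_spec :: "(real \<Rightarrow> complex^2) \<Rightarrow> (fock \<Rightarrow> fock) \<Rightarrow> bool" where
  "weyl_spec k W \<longleftrightarrow> (\<forall>x y. cinner (W x) (W y) = cinner x y) \<and>
    (\<forall>f\<in>L2_half_line. W (exp_vec f) = weyl_factor k f *\<^sub>C exp_vec (\<lambda>s. f s + k s)) \<and>
    (\<forall>x. (\<forall>f\<in>L2_half_line. cinner (exp_vec f) x = 0) \<longrightarrow> W x = x)"

definition weyl :: "(real \<Rightarrow> complex^2) \<Rightarrow> fock \<Rightarrow> fock" where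
  "weyl k = (SOME W. weyl_spec k W)"

text \<open>The two scalar factors contribute the exponent - \<langle>k, k\<rangle> - \<langle>f,
  k\<rangle> - \<langle>k, g\<rangle>, which is exactly the excess of \<langle>f + k, g + k\<rangle>
  over \<langle>f, g\<rangle>.\<close>

lemma weyl_gram:
  assumes k: "k \<in> L2_half_line" and f: "f \<in> L2_half_line" and g: "g \<in> L2_half_line"
  shows "cinner (weyl_factor k f *\<^sub>C exp_vec (\<lambda>s. f s + k s)) (weyl_factor k g *\<^sub>C exp_vec (\<lambda>s. g s + k s))
    = cinner (exp_vec f) (exp_vec g)"
proof -
  have "cnj (weyl_factor k f) = exp (- (L2_cinner k k / 2) - L2_cinner f k)"
    by (simp only: weyl_factor_def exp_cnj complex_cnj_diff complex_cnj_minus complex_cnj_divide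
      complex_cnj_numeral L2_cinner_commute[symmetric])
  thus ?thesis
    using assms by (simp add: cinner_scaleC_left cinner_scaleC_right cinner_exp_vec L2_add L2_cinner_add_left
      L2_cinner_add_right weyl_factor_def flip: exp_add)
qed

lemma inner_scaleC_all_zero:
  assumes "\<And>c. inner (c *\<^sub>C y) x = 0"
  shows "cinner y x = 0"
  using assms[of 1] assms[of \<i>] by (intro complex_eqI) (simp_all add: inner_eq_Re_cinner cinner_scaleC_left)

text \<open>The Weyl operator is the identity on the orthogonal complement of the exponential vectors;
  thus their totality in the Fock space is not needed.\<close>

lemma weyl_spec_weyl:
  assumes k: "k \<in> L2_half_line"
  shows "weyl_spec k (weyl k)"
proof -
  let ?E = "{x. \<forall>f\<in>L2_half_line. cinner (exp_vec f) x = 0}"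
  let ?e = "\<lambda>f. exp_vec f" and ?e' = "\<lambda>f. weyl_factor k f *\<^sub>C exp_vec (\<lambda>s. f s + k s)"
  \<comment> \<open>All complex multiples of the exponential vectors are included because the
    totality condition of \<open>isometry_extension\<close> concerns the real inner product.\<close>
  define G where "G = {(c *\<^sub>C ?e f, c *\<^sub>C ?e' f) | c f. f \<in> L2_half_line} \<union> {(x, x) | x. x \<in> ?E}"
  have perp: "cinner (exp_vec f) x = 0" "cinner x (exp_vec f) = 0" if "x \<in> ?E" "f \<in> L2_half_line" for f x
    using that cinner_commute[of x "exp_vec f"] by auto
  have perp': "cinner (?e' f) x = 0" "cinner x (?e' f) = 0" if "x \<in> ?E" "f \<in> L2_half_line" for f x
    using perp[OF that(1) L2_add[OF that(2) k]] by (simp_all add: cinner_scaleC_left cinner_scaleC_right)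
  have "\<exists>W. (\<forall>x y. cinner (W x) (W y) = cinner x y) \<and> (\<forall>p\<in>G. W (fst p) = snd p)"
  proof (rule isometry_extension)
    fix p q assume "p \<in> G" "q \<in> G"
    then consider
        c f d g where "f \<in> L2_half_line" "g \<in> L2_half_line" "p = (c *\<^sub>C ?e f, c *\<^sub>C ?e' f)" "q = (d *\<^sub>C ?e g, d *\<^sub>C ?e' g)"
      | c f x where "f \<in> L2_half_line" "x \<in> ?E" "p = (c *\<^sub>C ?e f, c *\<^sub>C ?e' f)" "q = (x, x)"
      | d g x where "g \<in> L2_half_line" "x \<in> ?E" "p = (x, x)" "q = (d *\<^sub>C ?e g, d *\<^sub>C ?e' g)"
      | x y where "p = (x, x)" "q = (y, y)"
      unfolding G_def by blast
    thus "cinner (snd p) (snd q) = cinner (fst p) (fst q)"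
    proof cases
      case 1
      thus ?thesis using weyl_gram[OF k 1(1,2)]
        by (simp only: fst_conv snd_conv cinner_scaleC_left[of c] cinner_scaleC_right[of _ d])
    next
      case 2
      thus ?thesis using perp perp'
        by (simp only: fst_conv snd_conv cinner_scaleC_left[of c])
    next
      case 3
      thus ?thesis using perp perp'
        by (simp only: fst_conv snd_conv cinner_scaleC_right[of _ d])
    qed simp
  next
    fix x assume x: "\<And>p. p \<in> G \<Longrightarrow> inner (fst p) x = 0"
    have "cinner (exp_vec f) x = 0" if "f \<in> L2_half_line" for f
    proof (rule inner_scaleC_all_zero)
      fix c
      have "(c *\<^sub>C ?e f, c *\<^sub>C ?e' f) \<in> G" using that by (auto simp: G_def)
      from x[OF this] show "inner (c *\<^sub>C exp_vec f) x = 0" by simp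
    qed
    hence "(x, x) \<in> G" by (auto simp: G_def)
    from x[OF this] show "x = 0" by simp
  qed
  then obtain W where W: "\<And>x y. cinner (W x) (W y) = cinner x y" "\<And>p. p \<in> G \<Longrightarrow> W (fst p) = snd p"
    by blast
  have "weyl_spec k W"
    unfolding weyl_spec_def
  proof (intro conjI allI ballI impI)
    fix f assume "f \<in> L2_half_line"
    hence "(1 *\<^sub>C ?e f, 1 *\<^sub>C ?e' f) \<in> G" unfolding G_def by blast
    from W(2)[OF this] show "W (?e f) = ?e' f" by (simp add: scaleC_one)
  next
    fix x assume "\<forall>f\<in>L2_half_line. cinner (exp_vec f) x = 0"
    hence "(x, x) \<in> G" by (auto simp: G_def)
    from W(2)[OF this] show "W x = x" by simp
  qed (rule W)
  thus ?thesis unfolding weyl_def by (rule someI[of "weyl_spec k"])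
qed

lemma cinner_weyl: "k \<in> L2_half_line \<Longrightarrow> cinner (weyl k x) (weyl k y) = cinner x y"
  using weyl_spec_weyl by (auto simp: weyl_spec_def)

lemma weyl_exp_vec:
  "k \<in> L2_half_line \<Longrightarrow> f \<in> L2_half_line \<Longrightarrow>
    weyl k (exp_vec f) = weyl_factor k f *\<^sub>C exp_vec (\<lambda>s. f s + k s)"
  using weyl_spec_weyl by (auto simp: weyl_spec_def)

lemma weyl_complement:
  "k \<in> L2_half_line \<Longrightarrow> (\<And>f. f \<in> L2_half_line \<Longrightarrow> cinner (exp_vec f) x = 0) \<Longrightarrow> weyl k x = x"
  using weyl_spec_weyl by (auto simp: weyl_spec_def)

lemma weyl_scaleC: "k \<in> L2_half_line \<Longrightarrow> weyl k (c *\<^sub>C x) = c *\<^sub>C weyl k x"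
  by (rule cinner_preserving_linear(2)) (rule cinner_weyl)

lemma bounded_linear_weyl: "k \<in> L2_half_line \<Longrightarrow> bounded_linear (weyl k)"
  by (rule cinner_preserving_linear(3)) (rule cinner_weyl)

text \<open>In general W(k) W(l) = exp(- i Im \<langle>k, l\<rangle>) W(k + l), and
  \<open>kl\<close> says that \<langle>k, l\<rangle> is real. This is checked on the exponential
  vectors; a vector orthogonal to all of them is fixed by each of the three operators.\<close>

lemma weyl_weyl:
  assumes k: "k \<in> L2_half_line" and l: "l \<in> L2_half_line" and kl: "L2_cinner k l = L2_cinner l k"
  shows "weyl k (weyl l x) = weyl (\<lambda>s. k s + l s) x"
proof -
  note kl' = L2_add[OF k l]
  have "(\<lambda>x. weyl k (weyl l x)) = weyl (\<lambda>s. k s + l s)"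
  proof (rule bounded_linear_eq_if_total)
    show "bounded_linear (\<lambda>x. weyl k (weyl l x))"
      by (rule bounded_linear_compose[OF bounded_linear_weyl[OF k] bounded_linear_weyl[OF l]])
    show "bounded_linear (weyl (\<lambda>s. k s + l s))" by (rule bounded_linear_weyl[OF kl'])
    fix x assume x: "\<And>y. weyl k (weyl l y) = weyl (\<lambda>s. k s + l s) y \<Longrightarrow> inner y x = 0"
    have E: "cinner (exp_vec f) x = 0" if f: "f \<in> L2_half_line" for f
    proof (rule inner_scaleC_all_zero, rule x)
      fix c
      have "weyl_factor l f * weyl_factor k (\<lambda>s. f s + l s) = weyl_factor (\<lambda>s. k s + l s) f"
        using k l f kl unfolding weyl_factor_def exp_add[symmetric]
        by (intro arg_cong[where f = exp])
           (simp add: L2_cinner_add_left L2_cinner_add_right L2_add add_divide_distrib)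
      thus "weyl k (weyl l (c *\<^sub>C exp_vec f)) = weyl (\<lambda>s. k s + l s) (c *\<^sub>C exp_vec f)"
        using k l kl' f L2_add[OF f l]
        by (simp add: weyl_scaleC weyl_exp_vec scaleC_scaleC mult.assoc add.assoc add.commute[of "l _"])
    qed
    hence "weyl k (weyl l x) = weyl (\<lambda>s. k s + l s) x"
      using k l kl' by (simp add: weyl_complement)
    from x[OF this] show "x = 0" by simp
  qed
  thus ?thesis by metis
qed

text \<open>The operator is idempotent by \<open>weyl_weyl\<close> and injective because it is
  isometric.\<close>

lemma weyl_zero: "weyl (\<lambda>_. 0) x = x"
proof -
  have "weyl (\<lambda>_. 0) (weyl (\<lambda>_. 0) x) = weyl (\<lambda>_. 0) x"
    using weyl_weyl[OF L2_zero L2_zero] by simp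
  hence "weyl (\<lambda>_. 0) (weyl (\<lambda>_. 0) x - x) = 0"
    using bounded_linear.linear[OF bounded_linear_weyl[OF L2_zero]] by (simp add: linear_diff)
  hence "norm (weyl (\<lambda>_. 0) x - x) = 0"
    using cinner_preserving_norm[of "weyl (\<lambda>_. 0)", OF cinner_weyl[OF L2_zero]] by (metis norm_zero)
  thus ?thesis by simp
qed

lemma cinner_exp_vec_weyl:
  assumes "k \<in> L2_half_line" "f \<in> L2_half_line" "g \<in> L2_half_line"
  shows "cinner (exp_vec f) (weyl k (exp_vec g))
    = exp (L2_cinner f g + (L2_cinner f k - L2_cinner k g - L2_cinner k k / 2))"
proof -
  have "weyl_factor k g * exp (L2_cinner f g + L2_cinner f k)
      = exp (L2_cinner f g + (L2_cinner f k - L2_cinner k g - L2_cinner k k / 2))"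
    unfolding weyl_factor_def exp_add[symmetric] by (rule arg_cong[where f = exp]) (simp add: algebra_simps)
  thus ?thesis
    using assms by (simp add: weyl_exp_vec cinner_scaleC_right cinner_exp_vec L2_add L2_cinner_add_right)
qed

section \<open>The flow\<close>

lemma half_line_borel_measurable:
  "g \<in> borel_measurable borel \<Longrightarrow> g \<in> borel_measurable half_line"
  unfolding half_line_def by (rule measurable_restrict_space1) simp

lemma L2_restrict:
  assumes f: "f \<in> L2_half_line" and A: "A \<in> sets borel"
  shows "(\<lambda>s. if s \<in> A then f s else 0) \<in> L2_half_line"
proof -
  have fm: "f \<in> borel_measurable half_line" and fi: "integrable half_line (\<lambda>t. (norm (f t))\<^sup>2)"
    using f by (simp_all add: L2_half_line_def)
  have "(\<lambda>s. indicat_real A s *\<^sub>R f s) \<in> borel_measurable half_line"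
    using A by (intro borel_measurable_scaleR fm half_line_borel_measurable borel_measurable_indicator)
  moreover have "(\<lambda>s. indicat_real A s *\<^sub>R f s) = (\<lambda>s. if s \<in> A then f s else 0)"
    by (auto simp: indicator_def)
  ultimately have m: "(\<lambda>s. if s \<in> A then f s else 0) \<in> borel_measurable half_line" by simp
  hence "integrable half_line (\<lambda>s. (norm (if s \<in> A then f s else 0))\<^sup>2)"
    by (intro Bochner_Integration.integrable_bound[OF fi]) auto
  thus ?thesis using m by (simp add: L2_half_line_def)
qed

lemma before_L2: "f \<in> L2_half_line \<Longrightarrow> before t f \<in> L2_half_line"
  and after_L2: "f \<in> L2_half_line \<Longrightarrow> after t f \<in> L2_half_line"
  unfolding before_def after_def by (rule L2_restrict; simp)+

lemma integral_half_line:
  fixes F :: "real \<Rightarrow> complex"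
  shows "(\<integral>s. F s \<partial>half_line) = (LINT s:{0..}|lborel. F s)"
    and "integrable half_line F \<longleftrightarrow> set_integrable lborel {0..} F"
  unfolding half_line_def set_lebesgue_integral_def set_integrable_def
  by (simp_all add: integral_restrict_space integrable_restrict_space)

text \<open>The function k_t(p) of the overview. Its support is half-open as in
  \<open>before\<close>, so its product with \<open>after t f\<close> vanishes at every
  point.\<close>

definition noise :: "complex \<Rightarrow> complex \<Rightarrow> real \<Rightarrow> int \<times> int \<Rightarrow> real \<Rightarrow> complex^2" where
  "noise c1 c2 t p = before t (\<lambda>_. vector [of_int (fst p) * c1, of_int (snd p) * c2])"

lemma noise_L2: "noise c1 c2 t p \<in> L2_half_line"
proof -
  let ?v = "vector [of_int (fst p) * c1, of_int (snd p) * c2] :: complex^2"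
  have "(\<lambda>s. indicat_real {0..<t} s *\<^sub>R ?v) \<in> borel_measurable half_line"
    by (intro borel_measurable_scaleR half_line_borel_measurable borel_measurable_indicator) simp_all
  moreover have "(\<lambda>s. indicat_real {0..<t} s *\<^sub>R ?v) = noise c1 c2 t p"
    by (auto simp: indicator_def noise_def before_def)
  ultimately have m: "noise c1 c2 t p \<in> borel_measurable half_line" by simp
  have "integrable lborel (\<lambda>s. indicat_real {0..<t} s *\<^sub>R (norm ?v)\<^sup>2)"
    by (rule integrable_scaleR_left, rule integrable_real_indicator) (use emeasure_bounded_finite[of "{0..<t}"] in simp_all)
  moreover have "(\<lambda>s. indicat_real {0..<t} s *\<^sub>R (norm ?v)\<^sup>2)
      = (\<lambda>s. indicat_real {0..} s *\<^sub>R (norm (noise c1 c2 t p s))\<^sup>2)"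
    by (auto simp: indicator_def noise_def before_def)
  ultimately have "integrable lborel (\<lambda>s. indicat_real {0..} s *\<^sub>R (norm (noise c1 c2 t p s))\<^sup>2)"
    by (simp only:)
  hence "integrable half_line (\<lambda>s. (norm (noise c1 c2 t p s))\<^sup>2)"
    by (simp add: half_line_def integrable_restrict_space)
  thus ?thesis using m by (simp add: L2_half_line_def)
qed

lemma noise_add: "(\<lambda>s. noise c1 c2 t p s + noise c1 c2 t q s) = noise c1 c2 t (p + q)"
  by (rule ext) (simp add: noise_def before_def vec_eq_iff forall_2 algebra_simps)

lemma noise_zero: "noise c1 c2 t 0 = (\<lambda>_. 0)"
  by (rule ext) (simp add: noise_def before_def vec_eq_iff forall_2)

text \<open>Componentwise, the vectors \<open>noise c1 c2 t p s\<close> differ by real factors only; hence the inner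
  products are real.\<close>

lemma noise_commute: "L2_cinner (noise c1 c2 t p) (noise c1 c2 t q) = L2_cinner (noise c1 c2 t q) (noise c1 c2 t p)"
  unfolding L2_cinner_def
  by (rule Bochner_Integration.integral_cong) (simp_all add: noise_def before_def sum_2 mult_ac)

lemma weyl_noise: "weyl (noise c1 c2 t p) (weyl (noise c1 c2 t q) x) = weyl (noise c1 c2 t (p + q)) x"
  by (simp add: weyl_weyl noise_L2 noise_commute[of c1 c2 t p q] noise_add)

lemma cinner_weyl_noise: "cinner (weyl (noise c1 c2 t p) x) (weyl (noise c1 c2 t p) y) = cinner x y"
  by (rule cinner_weyl[OF noise_L2])

text \<open>The unitary T_t of the overview. Since W(k_t(-p)) W(k_t(p)) = W(0) = 1, the operator
  \<open>untwist\<close> is its inverse, hence its adjoint.\<close>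

definition twist :: "complex \<Rightarrow> complex \<Rightarrow> real \<Rightarrow> (h_fock \<Rightarrow>\<^sub>L h_fock)" where
  "twist c1 c2 t = diag_op (\<lambda>p. weyl (noise c1 c2 t p))"

definition untwist :: "complex \<Rightarrow> complex \<Rightarrow> real \<Rightarrow> (h_fock \<Rightarrow>\<^sub>L h_fock)" where
  "untwist c1 c2 t = diag_op (\<lambda>p. weyl (noise c1 c2 t (- p)))"

definition flow :: "complex \<Rightarrow> complex \<Rightarrow> real \<Rightarrow> (h \<Rightarrow>\<^sub>L h) \<Rightarrow> (h_fock \<Rightarrow>\<^sub>L h_fock)" where
  "flow c1 c2 t a = untwist c1 c2 t o\<^sub>L amp a o\<^sub>L twist c1 c2 t"

lemma twist_nth:
  "ell2_nth (twist c1 c2 t x) p = weyl (noise c1 c2 t p) (ell2_nth x p)"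
  "ell2_nth (untwist c1 c2 t x) p = weyl (noise c1 c2 t (- p)) (ell2_nth x p)"
  by (simp_all add: twist_def untwist_def diag_op_nth cinner_weyl_noise)

lemma twist_untwist: "twist c1 c2 t (untwist c1 c2 t x) = x" "untwist c1 c2 t (twist c1 c2 t x) = x"
  by (rule ell2_eqI, simp add: twist_nth weyl_noise noise_zero weyl_zero)+

lemma complex_linear_twist: "complex_linear (twist c1 c2 t)" "complex_linear (untwist c1 c2 t)"
  unfolding complex_linear_def
  by (intro allI ell2_eqI, simp add: twist_nth weyl_scaleC noise_L2)+

lemma cinner_untwist: "cinner (untwist c1 c2 t x) y = cinner x (twist c1 c2 t y)"
proof -
  have "cinner x (twist c1 c2 t y) = cinner (twist c1 c2 t (untwist c1 c2 t x)) (twist c1 c2 t y)"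
    by (simp add: twist_untwist)
  also have "\<dots> = cinner (untwist c1 c2 t x) y"
    by (simp add: cinner_ell2.rep_eq twist_nth(1) cinner_weyl_noise)
  finally show ?thesis ..
qed

lemma cinner_twist: "cinner (twist c1 c2 t x) y = cinner x (untwist c1 c2 t y)"
  using cinner_untwist[of c1 c2 t y x] by (metis cinner_commute)

lemma complex_linear_flow: "complex_linear a \<Longrightarrow> complex_linear (flow c1 c2 t a)"
  using complex_linear_twist[of c1 c2 t] complex_linear_amp[of a, where 'b = fock]
  by (simp add: flow_def complex_linear_def)

lemma flow_add: "complex_linear a \<Longrightarrow> complex_linear b \<Longrightarrow> flow c1 c2 t (a + b) = flow c1 c2 t a + flow c1 c2 t b"
  by (rule blinfun_eqI) (simp add: flow_def amp_simps(1) blinfun.add_left blinfun.add_right)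

lemma flow_scaleC: "complex_linear a \<Longrightarrow> flow c1 c2 t (c *\<^sub>C a) = c *\<^sub>C flow c1 c2 t a"
  using complex_linear_twist(2)[of c1 c2 t]
  by (intro blinfun_eqI) (simp add: flow_def amp_simps(2) scaleC_blinfun.rep_eq complex_linear_def)

text \<open>Ampliation respects sums, products and adjoints of complex-linear operators, and so does
  conjugation by a unitary. The set \<open>A\<close> may be the norm closure of the generated
  algebra, so no extension by continuity intervenes.\<close>

lemma unital_star_hom_flow:
  assumes A: "\<And>a. a \<in> A \<Longrightarrow> complex_linear a"
  shows "unital_star_hom A (flow c1 c2 t)"
  unfolding unital_star_hom_def complex_linear_on_def
proof (intro conjI ballI allI)
  show "flow c1 c2 t id_blinfun = id_blinfun"
    by (rule blinfun_eqI) (simp add: flow_def amp_id twist_untwist)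
  fix a assume a: "a \<in> A"
  show "flow c1 c2 t (adjoint_op a) = adjoint_op (flow c1 c2 t a)"
  proof (rule adjoint_opI[symmetric])
    show "cinner (flow c1 c2 t (adjoint_op a) x) y = cinner x (flow c1 c2 t a y)" for x y
      by (simp add: flow_def cinner_untwist amp_adjoint A[OF a] cinner_twist)
  qed
  fix b assume b: "b \<in> A"
  show "flow c1 c2 t (a o\<^sub>L b) = flow c1 c2 t a o\<^sub>L flow c1 c2 t b"
    by (rule blinfun_eqI) (simp add: flow_def amp_simps(3)[OF A A, OF a b] twist_untwist)
qed (simp_all add: complex_linear_flow flow_add flow_scaleC A)

section \<open>Matrix elements and adaptedness\<close>

definition weyl_mean :: "complex \<Rightarrow> complex \<Rightarrow> real \<Rightarrow> int \<times> int \<Rightarrow>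
    (real \<Rightarrow> complex^2) \<Rightarrow> (real \<Rightarrow> complex^2) \<Rightarrow> complex" where
  "weyl_mean c1 c2 t p f g = cinner (exp_vec f) (weyl (noise c1 c2 t p) (exp_vec g))"

lemma exp_tensor_single: "exp_tensor (single i c) f = single i (c *\<^sub>C exp_vec f)"
  by (rule ell2_eqI) (simp add: exp_tensor_def tensor.rep_eq scaleC.zero_left)

text \<open>Conjugation multiplies the matrix entry of \<open>a\<close> at (i, k) by the inverse of
  W(k_t(i)) followed on the right by W(k_t(k)). As W is a representation, only the difference
  \<open>k - i\<close> survives.\<close>

lemma flow_single:
  assumes a: "complex_linear a"
  shows "cinner (exp_tensor (single i c) f) (flow c1 c2 t a (exp_tensor (single k d) g))
    = cnj c * d * ell2_nth (a (single k 1)) i * weyl_mean c1 c2 t (k - i) f g"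
proof -
  let ?W = "\<lambda>p. weyl (noise c1 c2 t p)"
  have tw: "twist c1 c2 t (single p y) = single p (?W p y)" for p y
    using linear_0[OF bounded_linear.linear[OF bounded_linear_weyl[OF noise_L2]]]
    by (intro ell2_eqI) (simp add: twist_nth)
  have "cinner (?W i (c *\<^sub>C exp_vec f)) (ell2_nth (a (single k 1)) i *\<^sub>C ?W k (d *\<^sub>C exp_vec g))
     = cnj c * d * ell2_nth (a (single k 1)) i * cinner (?W i (exp_vec f)) (?W k (exp_vec g))"
    by (simp add: weyl_scaleC noise_L2 cinner_scaleC_left cinner_scaleC_right)
  moreover have "cinner (?W i (exp_vec f)) (?W k (exp_vec g)) = weyl_mean c1 c2 t (k - i) f g"
  proof -
    have "?W k (exp_vec g) = ?W i (?W (k - i) (exp_vec g))" by (simp add: weyl_noise)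
    thus ?thesis by (simp add: cinner_weyl_noise weyl_mean_def)
  qed
  ultimately show ?thesis
    by (simp add: flow_def exp_tensor_single cinner_twist[symmetric] tw cinner_single_left amp_single[OF a])
qed

lemma bounded_linear_exp_tensor: "bounded_linear (\<lambda>u. exp_tensor u f)"
proof (rule bounded_linear_intro[where K = "norm (exp_vec f)"])
  show "exp_tensor (u + v) f = exp_tensor u f + exp_tensor v f" for u v
    by (rule ell2_eqI) (simp add: exp_tensor_def tensor.rep_eq scaleC_add_left)
  show "exp_tensor (r *\<^sub>R u) f = r *\<^sub>R exp_tensor u f" for r u
    by (rule ell2_eqI) (simp add: exp_tensor_def tensor.rep_eq scaleC.scaleR_left)
  fix u :: h
  have "complex_of_real ((norm (exp_tensor u f))\<^sup>2) = complex_of_real ((norm u * norm (exp_vec f))\<^sup>2)"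
    unfolding cinner_same[symmetric] exp_tensor_def cinner_tensor
    by (simp add: cinner_same power_mult_distrib)
  hence "norm (exp_tensor u f) = norm u * norm (exp_vec f)"
    unfolding of_real_eq_iff by (simp add: power2_eq_iff_nonneg)
  thus "norm (exp_tensor u f) \<le> norm u * norm (exp_vec f)" by simp
qed

lemma bounded_linear_exp_form:
  "bounded_linear (\<lambda>u. cinner (exp_tensor u f) y)"
  "bounded_linear (\<lambda>v. cinner (exp_tensor u f) (blinfun_apply T (exp_tensor v g)))"
  by (intro bounded_linear_compose[OF cinner.bounded_linear_left] bounded_linear_exp_tensor
    bounded_linear_compose[OF cinner.bounded_linear_right] bounded_linear_compose[OF blinfun.bounded_linear_right])+

text \<open>Boundedness here includes real linearity only, which also fits forms that are
  conjugate-linear in \<open>u\<close>; this is why the scalars \<open>c\<close> and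
  \<open>d\<close> appear in \<open>FG\<close>.\<close>

lemma ell2_bilinear_eqI:
  fixes F G :: "('i, complex) ell2 \<Rightarrow> ('i, complex) ell2 \<Rightarrow> complex"
  assumes F: "\<And>v. bounded_linear (\<lambda>u. F u v)" "\<And>u. bounded_linear (F u)"
    and G: "\<And>v. bounded_linear (\<lambda>u. G u v)" "\<And>u. bounded_linear (G u)"
    and FG: "\<And>i k c d. F (single i c) (single k d) = G (single i c) (single k d)"
  shows "F u v = G u v"
proof -
  have "F (single i c) v = G (single i c) v" for i c
    by (rule ell2_linear_eqI[OF F(2) G(2)]) (rule FG)
  thus ?thesis by (rule ell2_linear_eqI[OF F(1) G(1)])
qed

lemma L2_cinner_split:
  assumes f: "f \<in> L2_half_line" and g: "g \<in> L2_half_line" and t: "0 \<le> t"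
  shows "L2_cinner f g = L2_cinner (before t f) (before t g) + L2_cinner (after t f) (after t g)"
proof -
  have "L2_cinner f g = L2_cinner (\<lambda>s. before t f s + after t f s) (\<lambda>s. before t g s + after t g s)"
    unfolding L2_cinner_def
    by (rule Bochner_Integration.integral_cong)
       (auto simp: before_def after_def half_line_def space_restrict_space)
  moreover have "L2_cinner (before t f) (after t g) = 0" "L2_cinner (after t f) (before t g) = 0"
    unfolding L2_cinner_def
    by (subst Bochner_Integration.integral_cong[where g = "\<lambda>_. 0"]; auto simp: before_def after_def)+
  ultimately show ?thesis
    using f g by (simp add: L2_cinner_add_left L2_cinner_add_right L2_add before_L2 after_L2)
qed

lemma weyl_mean_eq:
  assumes "f \<in> L2_half_line" "g \<in> L2_half_line"
  shows "weyl_mean c1 c2 t p f g = exp (L2_cinner f g +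
    (L2_cinner f (noise c1 c2 t p) - L2_cinner (noise c1 c2 t p) g
      - L2_cinner (noise c1 c2 t p) (noise c1 c2 t p) / 2))"
  unfolding weyl_mean_def by (rule cinner_exp_vec_weyl[OF noise_L2 assms])

text \<open>As k_t(p) vanishes from time \<open>t\<close> on, the terms containing it see only the
  restrictions to [0, t). The future enters through \<langle>f, g\<rangle> alone, which splits into
  a sum and hence yields a factor.\<close>

lemma weyl_mean_adapted:
  assumes f: "f \<in> L2_half_line" and g: "g \<in> L2_half_line" and t: "0 \<le> t"
  shows "weyl_mean c1 c2 t p f g = weyl_mean c1 c2 t p (before t f) (before t g) *
    cinner (exp_vec (after t f)) (exp_vec (after t g))"
proof -
  have "L2_cinner f (noise c1 c2 t p) = L2_cinner (before t f) (noise c1 c2 t p)"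
    "L2_cinner (noise c1 c2 t p) g = L2_cinner (noise c1 c2 t p) (before t g)"
    unfolding L2_cinner_def
    by (rule Bochner_Integration.integral_cong; auto simp: before_def noise_def)+
  thus ?thesis
    using f g L2_cinner_split[OF f g t]
    by (simp add: weyl_mean_eq before_L2 after_L2 cinner_exp_vec exp_add[symmetric] algebra_simps)
qed

lemma adapted_flow:
  assumes A: "\<And>a. a \<in> A \<Longrightarrow> complex_linear a"
  shows "adapted A (flow c1 c2)"
  unfolding adapted_def
proof (intro allI ballI impI)
  fix u v f g and t :: real and a
  assume fg: "f \<in> L2_half_line" "g \<in> L2_half_line" and t: "0 \<le> t" and a: "a \<in> A"
  show "cinner (exp_tensor u f) (flow c1 c2 t a (exp_tensor v g)) =
      cinner (exp_tensor u (before t f)) (flow c1 c2 t a (exp_tensor v (before t g))) *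
      cinner (exp_vec (after t f)) (exp_vec (after t g))"
    by (rule ell2_bilinear_eqI)
       (auto intro!: bounded_linear_exp_form bounded_linear_mult_const
         simp: flow_single A[OF a] weyl_mean_adapted[OF fg t])
qed

text \<open>The hypothesis says that \<open>x\<close> is homogeneous of degree \<open>p\<close> for
  the grading by shifts: its matrix is supported on one diagonal. All entries then carry the same
  Weyl factor, so the flow sends \<open>x\<close> to x \<otimes> W(k_t(p)).\<close>

lemma flow_homogeneous:
  assumes x: "complex_linear x" and p: "\<And>i k. ell2_nth (x (single k 1)) i \<noteq> 0 \<Longrightarrow> k - i = p"
  shows "cinner (exp_tensor u f) (flow c1 c2 t x (exp_tensor v g)) = cinner u (x v) * weyl_mean c1 c2 t p f g"
proof (rule ell2_bilinear_eqI[where F = "\<lambda>u v. cinner (exp_tensor u f) (flow c1 c2 t x (exp_tensor v g))"])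
  fix i k :: "int \<times> int" and c d :: complex
  have "x (single k d) = d *\<^sub>C x (single k 1)"
    using x single_scaleC[of k d "1 :: complex"] by (simp add: complex_linear_def scaleC_complex_def)
  hence "cinner (single i c) (x (single k d)) = cnj c * d * ell2_nth (x (single k 1)) i"
    by (simp add: cinner_single_left cinner_complex_def scaleC_complex_def)
  thus "cinner (exp_tensor (single i c) f) (flow c1 c2 t x (exp_tensor (single k d) g))
     = cinner (single i c) (x (single k d)) * weyl_mean c1 c2 t p f g"
    using p[of k i] by (auto simp: flow_single[OF x])
qed (intro bounded_linear_exp_form bounded_linear_mult_const cinner.bounded_linear_left
    bounded_linear_compose[OF cinner.bounded_linear_right blinfun.bounded_linear_right])+

section \<open>The exponential of an indefinite Lebesgue integral\<close>

text \<open>Bisecting \<open>{a..b}\<close> at a point where \<open>M\<close> takes its mean value halves the bound.\<close>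

lemma eq_if_quadratic_variation:
  fixes D :: "real \<Rightarrow> 'a::real_normed_vector" and M :: "real \<Rightarrow> real"
  assumes M: "continuous_on {0..T} M"
    and D: "\<And>a b. 0 \<le> a \<Longrightarrow> a \<le> b \<Longrightarrow> b \<le> T \<Longrightarrow> norm (D b - D a) \<le> C * (M b - M a)\<^sup>2"
    and mono: "\<And>a b. 0 \<le> a \<Longrightarrow> a \<le> b \<Longrightarrow> b \<le> T \<Longrightarrow> M a \<le> M b"
    and T: "0 \<le> T"
  shows "D T = D 0"
proof -
  have *: "norm (D b - D a) \<le> C * (M b - M a)\<^sup>2 / 2 ^ n" if "0 \<le> a" "a \<le> b" "b \<le> T" for a b n
    using that
  proof (induction n arbitrary: a b)
    case 0
    thus ?case using D by simp
  next
    case (Suc n)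
    have "M a \<le> M b" using Suc.prems by (rule mono)
    hence "M a \<le> (M a + M b) / 2" "(M a + M b) / 2 \<le> M b" by simp_all
    from IVT'[OF this Suc.prems(2)] obtain c where c: "a \<le> c" "c \<le> b" "M c = (M a + M b) / 2"
      using continuous_on_subset[OF M, of "{a..b}"] Suc.prems by auto
    have "norm (D b - D a) \<le> norm (D b - D c) + norm (D c - D a)"
      using norm_triangle_ineq[of "D b - D c" "D c - D a"] by simp
    also have "\<dots> \<le> C * (M b - M c)\<^sup>2 / 2 ^ n + C * (M c - M a)\<^sup>2 / 2 ^ n"
      using Suc c by (intro add_mono Suc.IH) auto
    also have "\<dots> = C * (M b - M a)\<^sup>2 / 2 ^ Suc n"
      by (simp add: c(3) power2_eq_square field_simps)
    finally show ?case .
  qed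
  have "(\<lambda>n. C * (M T - M 0)\<^sup>2 / 2 ^ n) \<longlonglongrightarrow> 0"
    by (rule LIMSEQ_divide_realpow_zero) simp
  hence "norm (D T - D 0) \<le> 0"
    by (rule LIMSEQ_le_const) (use * T in auto)
  thus ?thesis by simp
qed

lemma exp_minus_one_bounds:
  fixes w :: complex
  shows "norm (exp w - 1) \<le> exp (norm w) * norm w"
    and "norm (exp w - 1 - w) \<le> exp (norm w) * (norm w)\<^sup>2"
proof -
  have e: "exp \<bar>Re w\<bar> \<le> exp (norm w)" by (simp add: abs_Re_le_cmod)
  have "norm (exp w - 1) \<le> exp \<bar>Re w\<bar> * norm w" using Taylor_exp[of w 0] by simp
  also have "\<dots> \<le> exp (norm w) * norm w" using e by (rule mult_right_mono) simp
  finally show "norm (exp w - 1) \<le> exp (norm w) * norm w" .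
  have "norm (exp w - 1 - w) \<le> exp \<bar>Re w\<bar> * (norm w)\<^sup>2"
    using Taylor_exp[of w 1] by (simp add: numeral_2_eq_2 algebra_simps)
  also have "\<dots> \<le> exp (norm w) * (norm w)\<^sup>2" using e by (rule mult_right_mono) simp
  finally show "norm (exp w - 1 - w) \<le> exp (norm w) * (norm w)\<^sup>2" .
qed

text \<open>Since \<kappa> is merely integrable, increments are compared with those of M(t), the
  integral of |\<kappa>| over [0, t]. The difference of exp K and its candidate integral has
  increments of second order in those of \<open>M\<close>, and is therefore constant.\<close>

lemma exp_indefinite_integral:
  fixes \<kappa> :: "real \<Rightarrow> complex"
  defines "K \<equiv> \<lambda>t. LINT s:{0..t}|lborel. \<kappa> s"
  assumes \<kappa>: "set_integrable lborel {0..T} \<kappa>" and T: "0 \<le> T"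
  shows "set_integrable lborel {0..T} (\<lambda>s. \<kappa> s * exp (K s))"
    and "exp (K T) = 1 + (LINT s:{0..T}|lborel. \<kappa> s * exp (K s))"
proof -
  have \<kappa>i: "\<kappa> integrable_on {0..T}" and \<kappa>n: "(\<lambda>s. norm (\<kappa> s)) integrable_on {0..T}"
    using set_borel_integral_eq_integral(1)[OF \<kappa>]
      set_borel_integral_eq_integral(1)[OF set_integrable_norm[OF \<kappa>]] by simp_all
  define M where "M t = integral {0..t} (\<lambda>s. norm (\<kappa> s))" for t
  have K: "K t = integral {0..t} \<kappa>" if "t \<le> T" for t
    unfolding K_def
    by (rule set_borel_integral_eq_integral(2)) (rule set_integrable_subset[OF \<kappa>], use that in auto)
  have "continuous_on {0..T} (\<lambda>t. integral {0..t} \<kappa>)" by (rule indefinite_integral_continuous_1[OF \<kappa>i])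
  hence contK: "continuous_on {0..T} K" by (rule continuous_on_eq) (simp add: K)
  have contM: "continuous_on {0..T} M"
    unfolding M_def by (rule indefinite_integral_continuous_1[OF \<kappa>n])
  have sub: "f integrable_on {a..b}" if "f integrable_on {0..T}" "0 \<le> a" "b \<le> T"
    for f :: "real \<Rightarrow> 'b::banach" and a b
    by (rule integrable_on_subinterval[OF that(1)]) (use that in auto)
  have diff: "integral {0..b} f - integral {0..a} f = integral {a..b} f"
    if "f integrable_on {0..T}" "0 \<le> a" "a \<le> b" "b \<le> T" for f :: "real \<Rightarrow> 'b::banach" and a b
    using Henstock_Kurzweil_Integration.integral_combine[OF that(2,3) sub[OF that(1) order_refl that(4)]]
    by (simp add: algebra_simps)
  have mono: "M a \<le> M b" if "0 \<le> a" "a \<le> b" "b \<le> T" for a b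
  proof -
    have "0 \<le> integral {a..b} (\<lambda>s. norm (\<kappa> s))"
      by (rule Henstock_Kurzweil_Integration.integral_nonneg[OF sub[OF \<kappa>n]]) (use that in auto)
    thus ?thesis using diff[OF \<kappa>n that] by (simp add: M_def)
  qed
  have KM: "norm (K b - K a) \<le> M b - M a" if "0 \<le> a" "a \<le> b" "b \<le> T" for a b
  proof -
    have "norm (integral {a..b} \<kappa>) \<le> integral {a..b} (\<lambda>s. norm (\<kappa> s))"
      by (rule integral_norm_bound_integral[OF sub[OF \<kappa>i] sub[OF \<kappa>n]]) (use that in auto)
    thus ?thesis using diff[OF \<kappa>i that] diff[OF \<kappa>n that] that by (simp add: M_def K)
  qed
  have K0: "K 0 = 0" and M0: "M 0 = 0" using T by (simp_all add: K M_def)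
  have M_le: "M a \<le> M T" "0 \<le> M a" if "0 \<le> a" "a \<le> T" for a
    using mono[of a T] mono[of 0 a] that M0 by auto
  have eK: "norm (exp (K a)) \<le> exp (M T)" if "0 \<le> a" "a \<le> T" for a
  proof -
    have "norm (K a) \<le> M T" using KM[of 0 a] M_le[OF that] that K0 M0 by simp
    hence "Re (K a) \<le> M T" using complex_Re_le_cmod[of "K a"] by linarith
    thus ?thesis by simp
  qed
  let ?g = "\<lambda>s. \<kappa> s * exp (K s)"
  show g: "set_integrable lborel {0..T} ?g"
    unfolding set_integrable_def
  proof (rule Bochner_Integration.integrable_bound)
    have i: "integrable lborel (\<lambda>s. indicator {0..T} s *\<^sub>R \<kappa> s)" using \<kappa> by (simp add: set_integrable_def)
    thus "integrable lborel (\<lambda>s. exp (M T) *\<^sub>R (indicator {0..T} s *\<^sub>R \<kappa> s))"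
      by (rule integrable_scaleR_right)
    have "(\<lambda>s. indicator {0..T} s *\<^sub>R exp (K s)) \<in> borel_measurable borel"
      by (intro borel_measurable_continuous_on_indicator continuous_on_exp contK) simp
    hence "(\<lambda>s. (indicator {0..T} s *\<^sub>R \<kappa> s) * (indicator {0..T} s *\<^sub>R exp (K s))) \<in> borel_measurable lborel"
      using borel_measurable_integrable[OF i] by (intro borel_measurable_times) simp_all
    moreover have "(indicator {0..T} s *\<^sub>R \<kappa> s) * (indicator {0..T} s *\<^sub>R exp (K s)) = indicator {0..T} s *\<^sub>R ?g s" for s
      by (simp add: indicator_def)
    ultimately show "(\<lambda>s. indicator {0..T} s *\<^sub>R ?g s) \<in> borel_measurable lborel" by (simp only:)
    have "norm (\<kappa> s * exp (K s)) \<le> exp (M T) * norm (\<kappa> s)" if "s \<in> {0..T}" for s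
      using mult_left_mono[OF eK, of s "norm (\<kappa> s)"] that unfolding norm_mult by (simp add: mult.commute)
    thus "AE s in lborel. norm (indicator {0..T} s *\<^sub>R ?g s)
        \<le> norm (exp (M T) *\<^sub>R (indicator {0..T} s *\<^sub>R \<kappa> s))"
      by (auto simp: indicator_def)
  qed
  note gi = set_borel_integral_eq_integral(1)[OF g]
  define D where "D t = exp (K t) - integral {0..t} ?g" for t
  have "D T = D 0"
  proof (rule eq_if_quadratic_variation[OF contM _ mono T, where C = "2 * exp (M T) * exp (M T)"])
    fix a b assume ab: "0 \<le> a" "a \<le> b" "b \<le> T"
    define m where "m = M b - M a"
    have m: "0 \<le> m" "m \<le> M T" using mono[OF ab] M_le[of b] M_le[of a] ab by (auto simp: m_def)
    have w: "norm (K s - K a) \<le> m" if "s \<in> {a..b}" for s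
      using KM[of a s] mono[of s b] that ab by (auto simp: m_def)
    have split: "exp (K s) - exp (K a) = exp (K a) * (exp (K s - K a) - 1)" for s
      by (simp add: exp_diff right_diff_distrib)
    have sg: "?g integrable_on {a..b}" and s\<kappa>: "\<kappa> integrable_on {a..b}" and s\<kappa>n: "(\<lambda>s. norm (\<kappa> s)) integrable_on {a..b}"
      using sub gi \<kappa>i \<kappa>n ab by auto
    have id: "integral {a..b} (\<lambda>s. \<kappa> s * (exp (K s) - exp (K a))) = integral {a..b} ?g - (K b - K a) * exp (K a)"
      using diff[OF \<kappa>i ab] ab sg s\<kappa>
      by (simp add: right_diff_distrib Henstock_Kurzweil_Integration.integral_diff K integrable_on_mult_left integral_mult_left)
    have si: "(\<lambda>s. \<kappa> s * (exp (K s) - exp (K a))) integrable_on {a..b}"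
      using sg s\<kappa> by (simp add: right_diff_distrib Henstock_Kurzweil_Integration.integrable_diff integrable_on_mult_left)
    have 1: "norm (exp (K a) * (exp (K b - K a) - 1 - (K b - K a))) \<le> exp (M T) * (exp (M T) * m\<^sup>2)"
    proof -
      have "norm (exp (K b - K a) - 1 - (K b - K a)) \<le> exp (norm (K b - K a)) * (norm (K b - K a))\<^sup>2"
        by (rule exp_minus_one_bounds)
      also have "\<dots> \<le> exp (M T) * m\<^sup>2"
        using w[of b] ab m by (intro mult_mono power_mono) auto
      finally show ?thesis unfolding norm_mult using eK[of a] ab by (intro mult_mono) auto
    qed
    have "norm (integral {a..b} (\<lambda>s. \<kappa> s * (exp (K s) - exp (K a))))
        \<le> integral {a..b} (\<lambda>s. norm (\<kappa> s) * (exp (M T) * (exp (M T) * m)))"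
    proof (rule integral_norm_bound_integral[OF si])
      show "(\<lambda>s. norm (\<kappa> s) * (exp (M T) * (exp (M T) * m))) integrable_on {a..b}"
        using s\<kappa>n by (rule integrable_on_mult_left)
      fix s assume s: "s \<in> {a..b}"
      have "norm (exp (K s - K a) - 1) \<le> exp (norm (K s - K a)) * norm (K s - K a)"
        by (rule exp_minus_one_bounds)
      also have "\<dots> \<le> exp (M T) * m"
        using w[OF s] m by (intro mult_mono) auto
      finally show "norm (\<kappa> s * (exp (K s) - exp (K a))) \<le> norm (\<kappa> s) * (exp (M T) * (exp (M T) * m))"
        unfolding split norm_mult using eK[of a] ab by (intro mult_left_mono mult_mono) auto
    qed
    also have "\<dots> = m * (exp (M T) * (exp (M T) * m))"
      using diff[OF \<kappa>n ab] by (simp add: M_def m_def)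
    finally have 2: "norm (integral {a..b} (\<lambda>s. \<kappa> s * (exp (K s) - exp (K a)))) \<le> m * (exp (M T) * (exp (M T) * m))" .
    have "D b - D a = (exp (K b) - exp (K a)) - integral {a..b} ?g"
      unfolding D_def diff[OF gi ab, symmetric] by simp
    \<comment> \<open>The first term is the second-order Taylor remainder of exp; the second is the
      error of freezing exp K at \<open>a\<close> under the integral. Each is at most exp(M T)^2
      m^2, whence the constant 2 exp(M T)^2.\<close>
    also have "\<dots> = exp (K a) * (exp (K b - K a) - 1 - (K b - K a))
        - integral {a..b} (\<lambda>s. \<kappa> s * (exp (K s) - exp (K a)))"
    proof -
      have "exp (K a) * (exp (K b - K a) - 1 - (K b - K a))
          = (exp (K b) - exp (K a)) - (K b - K a) * exp (K a)"
        unfolding split by (simp add: algebra_simps)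
      thus ?thesis unfolding id by simp
    qed
    finally have eq: "D b - D a = exp (K a) * (exp (K b - K a) - 1 - (K b - K a))
        - integral {a..b} (\<lambda>s. \<kappa> s * (exp (K s) - exp (K a)))" .
    have "norm (D b - D a) \<le> exp (M T) * (exp (M T) * m\<^sup>2) + m * (exp (M T) * (exp (M T) * m))"
      unfolding eq by (rule order_trans[OF norm_triangle_ineq4 add_mono[OF 1 2]])
    thus "norm (D b - D a) \<le> 2 * exp (M T) * exp (M T) * (M b - M a)\<^sup>2"
      by (simp add: m_def power2_eq_square algebra_simps)
  qed
  thus "exp (K T) = 1 + (LINT s:{0..T}|lborel. ?g s)"
    using K0 by (simp add: D_def set_borel_integral_eq_integral(2)[OF g] algebra_simps)
qed

section \<open>The non-commutative torus\<close>

lemma complex_linear_simps: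
  "complex_linear a \<Longrightarrow> complex_linear b \<Longrightarrow> complex_linear (a + b)"
  "complex_linear a \<Longrightarrow> complex_linear (c *\<^sub>C a)"
  "complex_linear a \<Longrightarrow> complex_linear b \<Longrightarrow> complex_linear (a o\<^sub>L b)"
  "complex_linear 0"
  "complex_linear id_blinfun"
  by (simp_all add: complex_linear_def blinfun.add_left scaleC_add_right scaleC_blinfun.rep_eq
    scaleC_scaleC mult.commute blinfun.zero_left scaleC.zero_right)

lemma adjoint_op_linear:
  fixes a b :: "('i, complex) ell2 \<Rightarrow>\<^sub>L ('i, complex) ell2"
  assumes a: "complex_linear a" and b: "complex_linear b"
  shows "adjoint_op (a + b) = adjoint_op a + adjoint_op b"
    and "adjoint_op (c *\<^sub>C a) = cnj c *\<^sub>C adjoint_op a"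
    and "adjoint_op (adjoint_op a) = a"
proof -
  have "cinner (a x) y = cinner x (adjoint_op a y)" for x y
    using ell2_adjoint(1)[OF a, of y x] by (metis cinner_commute)
  thus "adjoint_op (adjoint_op a) = a" by (intro adjoint_opI)
qed (intro adjoint_opI; simp add: blinfun.add_left cinner_add_left cinner_add_right ell2_adjoint(1)[OF a]
    ell2_adjoint(1)[OF b] scaleC_blinfun.rep_eq cinner_scaleC_left cinner_scaleC_right)+

lemma adjoint_op_nth:
  fixes a :: "('i, complex) ell2 \<Rightarrow>\<^sub>L ('i, complex) ell2"
  assumes a: "complex_linear a"
  shows "ell2_nth (adjoint_op a u) i = cinner (a (single i 1)) u"
proof -
  have "ell2_nth (adjoint_op a u) i = cnj (cinner (adjoint_op a u) (single i 1))"
    by (simp add: cinner_single_right cinner_complex_def)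
  also have "\<dots> = cinner (a (single i 1)) u"
    unfolding ell2_adjoint(1)[OF a] by (rule cinner_commute[symmetric])
  finally show ?thesis .
qed

lemma complex_linear_torus_U: "complex_linear torus_U"
  unfolding complex_linear_def
proof (intro allI ell2_eqI)
  show "ell2_nth (torus_U (c *\<^sub>C x)) i = ell2_nth (c *\<^sub>C torus_U x) i" for c x i
    by (cases i) (simp add: torus_U_nth)
qed

context
  fixes lam :: complex
  assumes lam: "cmod lam = 1"
begin

lemma lam_nonzero: "lam \<noteq> 0"
  using lam by auto

lemma cnj_lam: "cnj lam powi n = lam powi (- n)"
proof -
  have "lam powi n * cnj (lam powi n) = 1"
    by (simp only: complex_norm_square[symmetric] norm_power_int lam) simp
  moreover have "lam powi n * lam powi (- n) = 1"
    using lam_nonzero by (simp add: power_int_minus)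
  ultimately have "cnj (lam powi n) = lam powi (- n)"
    using lam_nonzero by (metis mult_cancel_left power_int_not_zero)
  thus ?thesis by simp
qed

lemma complex_linear_torus_V: "complex_linear (torus_V lam)"
  unfolding complex_linear_def
proof (intro allI ell2_eqI)
  show "ell2_nth (torus_V lam (c *\<^sub>C x)) i = ell2_nth (c *\<^sub>C torus_V lam x) i" for c x i
    by (cases i) (simp add: torus_V_nth[OF lam] scaleC_complex_def)
qed

lemma torus_U_adjoint_nth: "ell2_nth (adjoint_op torus_U u) (p, q) = ell2_nth u (p - 1, q)"
proof -
  have "torus_U (single (p, q) 1) = single (p - 1, q) 1"
  proof (rule ell2_eqI)
    show "ell2_nth (torus_U (single (p, q) 1)) i = ell2_nth (single (p - 1, q) 1) i" for i
      by (cases i) (auto simp: torus_U_nth)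
  qed
  thus ?thesis
    by (simp add: adjoint_op_nth complex_linear_torus_U cinner_single_left cinner_complex_def)
qed

lemma torus_V_adjoint_nth:
  "ell2_nth (adjoint_op (torus_V lam) u) (p, q) = lam powi (- p) * ell2_nth u (p, q - 1)"
proof -
  have "torus_V lam (single (p, q) 1) = single (p, q - 1) (lam powi p)"
  proof (rule ell2_eqI)
    show "ell2_nth (torus_V lam (single (p, q) 1)) i = ell2_nth (single (p, q - 1) (lam powi p)) i" for i
      by (cases i) (auto simp: torus_V_nth[OF lam])
  qed
  thus ?thesis
    by (simp add: adjoint_op_nth complex_linear_torus_V cinner_single_left cinner_complex_def cnj_lam)
qed

section \<open>Products and adjoints of the monomials in U and V\<close>

lemma zpow_U_nth: "ell2_nth (unitary_zpow torus_U m u) (p, q) = ell2_nth u (p + m, q)"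
proof -
  have 1: "ell2_nth ((((o\<^sub>L) torus_U) ^^ n) id_blinfun u) (p, q) = ell2_nth u (p + int n, q)" for n p
    by (induction n arbitrary: p) (simp_all add: torus_U_nth algebra_simps)
  have 2: "ell2_nth ((((o\<^sub>L) (adjoint_op torus_U)) ^^ n) id_blinfun u) (p, q) = ell2_nth u (p - int n, q)" for n p
    by (induction n arbitrary: p) (simp_all add: torus_U_adjoint_nth algebra_simps)
  show ?thesis by (simp add: unitary_zpow_def 1 2)
qed

lemma zpow_V_nth: "ell2_nth (unitary_zpow (torus_V lam) m u) (p, q) = lam powi (p * m) * ell2_nth u (p, q + m)"
proof -
  have 1: "ell2_nth ((((o\<^sub>L) (torus_V lam)) ^^ n) id_blinfun u) (p, q) =
      lam powi (p * int n) * ell2_nth u (p, q + int n)" for n q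
    by (induction n arbitrary: q)
       (simp_all add: torus_V_nth[OF lam] distrib_left power_int_add lam_nonzero add_ac)
  have 2: "ell2_nth ((((o\<^sub>L) (adjoint_op (torus_V lam))) ^^ n) id_blinfun u) (p, q) =
      lam powi (- (p * int n)) * ell2_nth u (p, q - int n)" for n q
    by (induction n arbitrary: q)
       (simp_all add: torus_V_adjoint_nth distrib_left power_int_add power_int_diff lam_nonzero
         power_int_minus diff_diff_eq add_ac mult_ac divide_inverse)
  show ?thesis by (simp add: unitary_zpow_def 1 2)
qed

lemma torus_basis_nth:
  "ell2_nth (torus_basis lam m n u) (p, q) = lam powi ((p + m) * n) * ell2_nth u (p + m, q + n)"
  by (simp add: torus_basis_def zpow_U_nth zpow_V_nth)

lemma complex_linear_torus_basis: "complex_linear (torus_basis lam m n)"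
  unfolding complex_linear_def
proof (intro allI ell2_eqI)
  show "ell2_nth (torus_basis lam m n (c *\<^sub>C x)) i = ell2_nth (c *\<^sub>C torus_basis lam m n x) i" for c x i
    by (cases i) (simp add: torus_basis_nth scaleC_complex_def)
qed

text \<open>The phase is the cost of moving V^n past U^m': since UV = \<lambda>VU, each exchange
  contributes one factor of the inverse of \<lambda>.\<close>

lemma torus_basis_mult:
  "torus_basis lam m n o\<^sub>L torus_basis lam m' n' = lam powi (- (m' * n)) *\<^sub>C torus_basis lam (m + m') (n + n')"
proof (rule blinfun_eqI, rule ell2_eqI)
  fix u :: h and i :: "int \<times> int"
  obtain p q where i: "i = (p, q)" by fastforce
  have "lam powi ((p + m) * n) * lam powi ((p + m + m') * n')
      = lam powi (- (m' * n)) * lam powi ((p + (m + m')) * (n + n'))"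
    unfolding power_int_add[OF disjI1[OF lam_nonzero], symmetric]
    by (rule arg_cong[where f = "(powi) lam"]) (simp add: algebra_simps)
  thus "ell2_nth ((torus_basis lam m n o\<^sub>L torus_basis lam m' n') u) i =
      ell2_nth ((lam powi (- (m' * n)) *\<^sub>C torus_basis lam (m + m') (n + n')) u) i"
    by (simp add: i torus_basis_nth scaleC_blinfun.rep_eq scaleC_complex_def add.assoc mult.assoc[symmetric])
qed

lemma torus_basis_adjoint:
  "adjoint_op (torus_basis lam m n) = lam powi (- (m * n)) *\<^sub>C torus_basis lam (- m) (- n)"
proof (rule blinfun_eqI, rule ell2_eqI)
  fix u :: h and i :: "int \<times> int"
  obtain p q where i: "i = (p, q)" by fastforce
  have "torus_basis lam m n (single (p, q) 1) = single (p - m, q - n) (lam powi (p * n))"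
  proof (rule ell2_eqI)
    show "ell2_nth (torus_basis lam m n (single (p, q) 1)) k = ell2_nth (single (p - m, q - n) (lam powi (p * n))) k" for k
      by (cases k) (auto simp: torus_basis_nth)
  qed
  hence "ell2_nth (adjoint_op (torus_basis lam m n) u) i = lam powi (- (p * n)) * ell2_nth u (p - m, q - n)"
    by (simp add: i adjoint_op_nth complex_linear_torus_basis cinner_single_left cinner_complex_def cnj_lam)
  moreover have "lam powi (- (p * n)) = lam powi (- (m * n)) * lam powi ((p + - m) * - n)"
    unfolding power_int_add[OF disjI1[OF lam_nonzero], symmetric]
    by (rule arg_cong[where f = "(powi) lam"]) (simp add: algebra_simps)
  ultimately show "ell2_nth (adjoint_op (torus_basis lam m n) u) i =
      ell2_nth ((lam powi (- (m * n)) *\<^sub>C torus_basis lam (- m) (- n)) u) i"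
    by (simp add: i torus_basis_nth scaleC_blinfun.rep_eq scaleC_complex_def)
qed

text \<open>The unit is not among the closure rules of \<open>star_subalgebra\<close>; it is
  obtained from the unitarity of U.\<close>

lemma id_torus_A0: "id_blinfun \<in> torus_A0 lam"
proof -
  have "adjoint_op torus_U o\<^sub>L torus_U = id_blinfun"
  proof (rule blinfun_eqI, rule ell2_eqI)
    show "ell2_nth ((adjoint_op torus_U o\<^sub>L torus_U) u) i = ell2_nth (id_blinfun u) i" for u i
      by (cases i) (simp add: torus_U_adjoint_nth torus_U_nth)
  qed
  thus ?thesis
    unfolding torus_A0_def
    by (metis insertI1 star_subalgebra.generator star_subalgebra.mult star_subalgebra.star)
qed

lemma torus_basis_A0: "torus_basis lam m n \<in> torus_A0 lam"
proof -
  have pow: "(((o\<^sub>L) T) ^^ k) id_blinfun \<in> torus_A0 lam" if "T \<in> torus_A0 lam" for T k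
    using that id_torus_A0 by (induction k) (auto simp: torus_A0_def intro: star_subalgebra.mult)
  have zpow: "unitary_zpow T k \<in> torus_A0 lam" if "T \<in> torus_A0 lam" for T k
    unfolding unitary_zpow_def using that pow
    by (auto simp: torus_A0_def intro: star_subalgebra.star)
  show ?thesis
    using zpow[of torus_U m] zpow[of "torus_V lam" n] unfolding torus_basis_def
    by (auto simp: torus_A0_def intro: star_subalgebra.mult star_subalgebra.generator)
qed

end

text \<open>Induction over this set has cases only for monomials, sums and multiples, which suit
  identities linear in the operator; products and adjoints, which \<open>star_subalgebra\<close>
  would bring in, do not.\<close>

inductive_set torus_span :: "complex \<Rightarrow> (h \<Rightarrow>\<^sub>L h) set" for lam :: complex where
  basis: "torus_basis lam m n \<in> torus_span lam"
| add: "a \<in> torus_span lam \<Longrightarrow> b \<in> torus_span lam \<Longrightarrow> a + b \<in> torus_span lam"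
| scale: "a \<in> torus_span lam \<Longrightarrow> c *\<^sub>C a \<in> torus_span lam"

lemma torus_span_complex_linear:
  assumes lam: "cmod lam = 1"
  shows "a \<in> torus_span lam \<Longrightarrow> complex_linear a"
  by (induction rule: torus_span.induct)
     (simp_all add: complex_linear_torus_basis[OF lam] complex_linear_simps)

lemma torus_span_mult:
  assumes lam: "cmod lam = 1" and a: "a \<in> torus_span lam" and b: "b \<in> torus_span lam"
  shows "a o\<^sub>L b \<in> torus_span lam"
  using a
proof induction
  case (basis m n)
  show ?case
    using b
  proof induction
    case (basis m' n')
    show ?case unfolding torus_basis_mult[OF lam] by (intro torus_span.intros)
  next
    case (add a b)
    have "torus_basis lam m n o\<^sub>L (a + b) = (torus_basis lam m n o\<^sub>L a) + (torus_basis lam m n o\<^sub>L b)"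
      by (rule blinfun_eqI) (simp add: blinfun.add_left blinfun.add_right)
    thus ?case using add by (simp add: torus_span.add)
  next
    case (scale a c)
    have "torus_basis lam m n o\<^sub>L (c *\<^sub>C a) = c *\<^sub>C (torus_basis lam m n o\<^sub>L a)"
      using complex_linear_torus_basis[OF lam]
      by (intro blinfun_eqI) (simp add: complex_linear_def scaleC_blinfun.rep_eq)
    thus ?case using scale by (simp add: torus_span.scale)
  qed
next
  case (add a a')
  have "(a + a') o\<^sub>L b = (a o\<^sub>L b) + (a' o\<^sub>L b)"
    by (rule blinfun_eqI) (simp add: blinfun.add_left)
  thus ?case using add by (simp add: torus_span.add)
next
  case (scale a c)
  have "(c *\<^sub>C a) o\<^sub>L b = c *\<^sub>C (a o\<^sub>L b)" by (intro blinfun_eqI) (simp add: scaleC_blinfun.rep_eq)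
  thus ?case using scale by (simp add: torus_span.scale)
qed

lemma torus_span_adjoint:
  assumes lam: "cmod lam = 1"
  shows "a \<in> torus_span lam \<Longrightarrow> adjoint_op a \<in> torus_span lam"
proof (induction rule: torus_span.induct)
  case (basis m n)
  show ?case unfolding torus_basis_adjoint[OF lam] by (intro torus_span.intros)
next
  case (add a b)
  thus ?case using torus_span_complex_linear[OF lam] by (simp add: adjoint_op_linear torus_span.add)
next
  case (scale a c)
  thus ?case using torus_span_complex_linear[OF lam] by (simp add: adjoint_op_linear(2)[of a a] torus_span.scale)
qed

lemma torus_A0_eq_span:
  assumes lam: "cmod lam = 1"
  shows "torus_A0 lam = torus_span lam"
proof (intro equalityI subsetI)
  fix a assume "a \<in> torus_A0 lam"
  thus "a \<in> torus_span lam"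
    unfolding torus_A0_def
  proof induction
    case (generator a)
    have "torus_basis lam 1 0 = torus_U" "torus_basis lam 0 1 = torus_V lam"
    proof (rule_tac [!] blinfun_eqI, rule_tac [!] ell2_eqI)
      show "ell2_nth (torus_basis lam 1 0 u) i = ell2_nth (torus_U u) i" for u i
        by (cases i) (simp add: torus_basis_nth[OF lam] torus_U_nth)
      show "ell2_nth (torus_basis lam 0 1 u) i = ell2_nth (torus_V lam u) i" for u i
        by (cases i) (simp add: torus_basis_nth[OF lam] torus_V_nth[OF lam])
    qed
    thus ?case using generator torus_span.basis[of lam 1 0] torus_span.basis[of lam 0 1] by auto
  qed (use lam in \<open>auto intro: torus_span.intros torus_span_mult torus_span_adjoint\<close>)
next
  fix a assume "a \<in> torus_span lam"
  thus "a \<in> torus_A0 lam"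
    by induction (use torus_basis_A0[OF lam] in \<open>auto simp: torus_A0_def intro: star_subalgebra.intros\<close>)
qed

lemma complex_linear_torus_A0: "cmod lam = 1 \<Longrightarrow> a \<in> torus_A0 lam \<Longrightarrow> complex_linear a"
  by (simp add: torus_A0_eq_span torus_span_complex_linear)

lemma closed_complex_linear: "closed (Collect complex_linear)"
  unfolding complex_linear_def
  by (intro closed_Collect_all closed_Collect_eq bounded_linear.continuous_on[OF blinfun.bounded_linear_left]
    bounded_linear.continuous_on[OF bounded_linear_compose[OF bounded_linear_scaleC blinfun.bounded_linear_left]] continuous_on_id)

lemma complex_linear_torus_A:
  assumes lam: "cmod lam = 1" and a: "a \<in> torus_A lam"
  shows "complex_linear a"
proof -
  have "torus_A lam \<subseteq> Collect complex_linear"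
    unfolding torus_A_def
    by (intro closure_minimal closed_complex_linear) (use complex_linear_torus_A0[OF lam] in auto)
  thus ?thesis using a by auto
qed

section \<open>The quantum stochastic differential equation\<close>

text \<open>The scalar by which \<open>\<phi>\<close>, sliced by \<open>(1, a)\<close> and \<open>(1, b)\<close>, acts on \<open>U\<^sup>m V\<^sup>n\<close>.\<close>

definition rate :: "complex \<Rightarrow> complex \<Rightarrow> int \<Rightarrow> int \<Rightarrow> complex^2 \<Rightarrow> complex^2 \<Rightarrow> complex" where
  "rate c1 c2 m n a b = cnj (a $ 1) * (of_int m * c1) + cnj (a $ 2) * (of_int n * c2)
    - (cnj (of_int m * c1) * b $ 1 + cnj (of_int n * c2) * b $ 2)
    - complex_of_real ((cmod c1)\<^sup>2 * (of_int m)\<^sup>2 + (cmod c2)\<^sup>2 * (of_int n)\<^sup>2) / 2"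

lemma L2_cinner_integrable:
  assumes f: "f \<in> L2_half_line" and g: "g \<in> L2_half_line"
  shows "integrable half_line (\<lambda>t. \<Sum>k\<in>UNIV. cnj (f t $ k) * g t $ k)"
proof -
  have m: "(\<lambda>t. h t $ k) \<in> borel_measurable half_line" if "h \<in> L2_half_line" for h :: "real \<Rightarrow> complex^2" and k
  proof -
    have "h \<in> borel_measurable half_line" using that by (simp add: L2_half_line_def)
    moreover have "(\<lambda>v :: complex^2. v $ k) \<in> borel_measurable borel"
      by (intro borel_measurable_continuous_onI continuous_intros)
    ultimately show ?thesis by (rule measurable_compose)
  qed
  have i: "integrable half_line (\<lambda>t. (norm (h t $ k))\<^sup>2)" if "h \<in> L2_half_line" for h :: "real \<Rightarrow> complex^2" and k
  proof (rule Bochner_Integration.integrable_bound)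
    show "integrable half_line (\<lambda>t. (norm (h t))\<^sup>2)" using that by (simp add: L2_half_line_def)
    show "(\<lambda>t. (norm (h t $ k))\<^sup>2) \<in> borel_measurable half_line" using m[OF that, of k] by measurable
    show "AE t in half_line. norm ((norm (h t $ k))\<^sup>2) \<le> norm ((norm (h t))\<^sup>2)"
      by (simp add: power_mono Finite_Cartesian_Product.norm_nth_le)
  qed
  show ?thesis
    by (intro Bochner_Integration.integrable_sum L2_cnj_mult(1) m i f g)
qed

text \<open>On [0, t) the three integrands on the left add up pointwise to \<open>rate\<close>, and
  from \<open>t\<close> on they vanish together with k_t.\<close>

lemma weyl_exponent:
  fixes c1 c2 :: complex and m n :: int
  assumes f: "f \<in> L2_half_line" and g: "g \<in> L2_half_line" and t: "0 \<le> t"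
  defines "r \<equiv> \<lambda>s. rate c1 c2 m n (f s) (g s)"
  shows "set_integrable lborel {0..t} r"
    and "L2_cinner f (noise c1 c2 t (m, n)) - L2_cinner (noise c1 c2 t (m, n)) g
      - L2_cinner (noise c1 c2 t (m, n)) (noise c1 c2 t (m, n)) / 2 = (LINT s:{0..t}|lborel. r s)"
proof -
  define F where "F t s = (\<Sum>k\<in>UNIV. cnj (f s $ k) * noise c1 c2 t (m, n) s $ k)
     - (\<Sum>k\<in>UNIV. cnj (noise c1 c2 t (m, n) s $ k) * g s $ k)
     - (\<Sum>k\<in>UNIV. cnj (noise c1 c2 t (m, n) s $ k) * noise c1 c2 t (m, n) s $ k) / 2" for t s
  have c: "z * of_int k * cnj (z * of_int k) = (of_int k)\<^sup>2 * (complex_of_real (cmod z))\<^sup>2" for z k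
  proof -
    have "z * of_int k * cnj (z * of_int k) = complex_of_real ((cmod (z * of_int k))\<^sup>2)"
      by (rule complex_norm_square[symmetric])
    also have "(cmod (z * of_int k))\<^sup>2 = (of_int k)\<^sup>2 * (cmod z)\<^sup>2"
      by (simp add: norm_mult power_mult_distrib mult.commute)
    finally show ?thesis by simp
  qed
  have Fr: "F t s = (if s \<in> {0..<t} then r s else 0)" for t s
    unfolding F_def r_def rate_def noise_def before_def
    by (simp add: sum_2 c mult.commute del: complex_cnj_mult)
  have Fi: "integrable half_line (F t)" for t
    unfolding F_def
    by (intro Bochner_Integration.integrable_diff integrable_divide_zero L2_cinner_integrable f g noise_L2)
  \<comment> \<open>The function \<open>F t\<close> vanishes at \<open>t\<close> itself, whereas
    \<open>F (t + 1)\<close> agrees with \<open>r\<close> on the whole closed interval.\<close>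
  have "set_integrable lborel {0..} (F (t + 1))" using Fi by (simp add: integral_half_line)
  hence "set_integrable lborel {0..t} (F (t + 1))" by (rule set_integrable_subset) auto
  thus ri: "set_integrable lborel {0..t} r"
    by (rule set_integrable_cong[THEN iffD1, rotated -1]) (auto simp: Fr)
  have "L2_cinner f (noise c1 c2 t (m, n)) - L2_cinner (noise c1 c2 t (m, n)) g
      - L2_cinner (noise c1 c2 t (m, n)) (noise c1 c2 t (m, n)) / 2 = (\<integral>s. F t s \<partial>half_line)"
    unfolding F_def L2_cinner_def
    by (simp add: L2_cinner_integrable f g noise_L2)
  also have "\<dots> = (\<integral>s. indicator {0..} s *\<^sub>R F t s \<partial>lborel)"
    by (simp add: integral_half_line set_lebesgue_integral_def)
  also have "\<dots> = (\<integral>s. indicator {0..t} s *\<^sub>R r s \<partial>lborel)"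
  proof (rule integral_cong_AE)
    show "(\<lambda>s. indicator {0..} s *\<^sub>R F t s) \<in> borel_measurable lborel"
      using Fi[of t] by (simp add: integral_half_line set_integrable_def borel_measurable_integrable)
    show "(\<lambda>s. indicator {0..t} s *\<^sub>R r s) \<in> borel_measurable lborel"
      using ri by (simp add: set_integrable_def borel_measurable_integrable)
    \<comment> \<open>The two integrands can differ only at the endpoint \<open>t\<close>, where
      \<open>noise\<close> is already zero.\<close>
    show "AE s in lborel. indicator {0..} s *\<^sub>R F t s = indicator {0..t} s *\<^sub>R r s"
      using AE_lborel_singleton[of t] by eventually_elim (auto simp: Fr indicator_def)
  qed
  finally show "L2_cinner f (noise c1 c2 t (m, n)) - L2_cinner (noise c1 c2 t (m, n)) g
      - L2_cinner (noise c1 c2 t (m, n)) (noise c1 c2 t (m, n)) / 2 = (LINT s:{0..t}|lborel. r s)"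
    by (simp add: set_lebesgue_integral_def)
qed

lemma cinner_exp_tensor:
  "f \<in> L2_half_line \<Longrightarrow> g \<in> L2_half_line \<Longrightarrow>
    cinner (exp_tensor u f) (exp_tensor v g) = cinner u v * exp (L2_cinner f g)"
  by (simp add: exp_tensor_def cinner_tensor cinner_exp_vec)

lemma flow_torus_basis:
  assumes lam: "cmod lam = 1" and f: "f \<in> L2_half_line" and g: "g \<in> L2_half_line" and t: "0 \<le> t"
  shows "cinner (exp_tensor u f) (flow c1 c2 t (torus_basis lam m n) (exp_tensor v g)) =
    cinner u (torus_basis lam m n v) * exp (L2_cinner f g) * exp (LINT s:{0..t}|lborel. rate c1 c2 m n (f s) (g s))"
proof -
  have "k - i = (m, n)" if "ell2_nth (torus_basis lam m n (single k 1)) i \<noteq> 0" for i k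
    using that by (cases i; cases k) (auto simp: torus_basis_nth[OF lam] split: if_splits)
  thus ?thesis
    by (simp add: flow_homogeneous[OF complex_linear_torus_basis[OF lam]] weyl_mean_eq[OF f g]
      weyl_exponent(2)[OF f g t] exp_add)
qed

text \<open>For a monomial the integrand is a constant times \<open>rate\<close> times the
  exponential of the indefinite integral of \<open>rate\<close>, so the equation is an instance of
  \<open>exp_indefinite_integral\<close>.\<close>

lemma flow_torus_basis_qsde:
  fixes c1 c2 :: complex and m n :: int and u v :: h
  assumes lam: "cmod lam = 1" and f: "f \<in> L2_half_line" and g: "g \<in> L2_half_line" and t: "0 \<le> t"
  defines "x \<equiv> torus_basis lam m n"
  defines "J \<equiv> \<lambda>s. cinner (exp_tensor u f) (flow c1 c2 s (rate c1 c2 m n (f s) (g s) *\<^sub>C x) (exp_tensor v g))"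
  shows "set_integrable lborel {0..t} J"
    and "cinner (exp_tensor u f) (flow c1 c2 t x (exp_tensor v g)) =
      cinner (exp_tensor u f) (exp_tensor (x v) g) + (LINT s:{0..t}|lborel. J s)"
proof -
  let ?r = "\<lambda>s. rate c1 c2 m n (f s) (g s)"
  let ?c = "cinner u (x v) * exp (L2_cinner f g)"
  let ?e = "\<lambda>t. exp (LINT s:{0..t}|lborel. ?r s)"
  have J: "J s = ?c * (?r s * ?e s)" if "s \<in> {0..t}" for s
    using that flow_torus_basis[OF lam f g, of s u c1 c2 m n v]
    by (simp add: J_def x_def flow_scaleC complex_linear_torus_basis[OF lam] scaleC_blinfun.rep_eq cinner_scaleC_right)
  note ri = weyl_exponent(1)[OF f g t, of c1 c2 m n]
  have "set_integrable lborel {0..t} (\<lambda>s. ?c * (?r s * ?e s))"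
    by (intro set_integrable_mult_right exp_indefinite_integral(1)[OF ri t])
  thus "set_integrable lborel {0..t} J"
    by (rule set_integrable_cong[THEN iffD1, rotated -1]) (auto simp: J)
  have "(LINT s:{0..t}|lborel. J s) = (LINT s:{0..t}|lborel. ?c * (?r s * ?e s))"
    by (rule set_lebesgue_integral_cong) (auto simp: J)
  also have "\<dots> = ?c * (?e t - 1)"
    using exp_indefinite_integral(2)[OF ri t] by simp
  finally show "cinner (exp_tensor u f) (flow c1 c2 t x (exp_tensor v g)) =
      cinner (exp_tensor u f) (exp_tensor (x v) g) + (LINT s:{0..t}|lborel. J s)"
    using flow_torus_basis[OF lam f g t, of u c1 c2 m n v]
    by (simp add: x_def cinner_exp_tensor[OF f g] right_diff_distrib)
qed

section \<open>The generator on the algebra of monomials\<close>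

lemma dagger_eigenvector:
  fixes x :: "('i, complex) ell2 \<Rightarrow>\<^sub>L ('i, complex) ell2"
  assumes x: "complex_linear x" and d: "d (adjoint_op x) = c *\<^sub>C adjoint_op x"
  shows "dagger d x = cnj c *\<^sub>C x"
  using x by (simp add: dagger_def d adjoint_op_linear(2)[of _ "adjoint_op x"] adjoint_op_linear(3) ell2_adjoint(2))

lemma torus_A0_adjoint: "x \<in> torus_A0 lam \<Longrightarrow> adjoint_op x \<in> torus_A0 lam"
  unfolding torus_A0_def by (rule star_subalgebra.star)

text \<open>The two adjoints in \<open>dagger\<close> conjugate scalars twice, so complex linearity
  survives.\<close>

lemma dagger_torus_A0:
  assumes lam: "cmod lam = 1"
    and d: "complex_linear_on (torus_A0 lam) d" "d ` torus_A0 lam \<subseteq> torus_A0 lam"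
    and x: "x \<in> torus_A0 lam" and y: "y \<in> torus_A0 lam"
  shows "dagger d (x + y) = dagger d x + dagger d y"
    and "dagger d (c *\<^sub>C x) = c *\<^sub>C dagger d x"
    and "complex_linear (dagger d x)"
proof -
  note cl = complex_linear_torus_A0[OF lam]
  have xy: "complex_linear x" "complex_linear y" "adjoint_op x \<in> torus_A0 lam" "adjoint_op y \<in> torus_A0 lam"
    using x y by (simp_all add: cl torus_A0_adjoint)
  hence d': "complex_linear (d (adjoint_op x))" "complex_linear (d (adjoint_op y))"
    using d(2) by (auto intro!: cl)
  show "dagger d (x + y) = dagger d x + dagger d y" "dagger d (c *\<^sub>C x) = c *\<^sub>C dagger d x"
    using d(1) xy d' unfolding dagger_def complex_linear_on_def
    by (simp_all add: adjoint_op_linear(1) adjoint_op_linear(2)[OF _ xy(1)] adjoint_op_linear(2)[OF xy(1) xy(1)] adjoint_op_linear(2)[OF d'(1) d'(1)])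
  show "complex_linear (dagger d x)"
    unfolding dagger_def by (rule ell2_adjoint(2)[OF d'(1)])
qed

lemma slice_torus_phi:
  assumes "complex_linear (tau x)" "complex_linear (dagger d1 x)" "complex_linear (dagger d2 x)"
    "complex_linear (d1 x)" "complex_linear (d2 x)"
  shows "slice (vec_hat f s) (vec_hat g s) (torus_phi c1 c2 d1 d2 tau x) =
    tau x + (cnj c1 * g s $ 1) *\<^sub>C dagger d1 x + (cnj c2 * g s $ 2) *\<^sub>C dagger d2 x
      + (cnj (f s $ 1) * c1) *\<^sub>C d1 x + (cnj (f s $ 2) * c2) *\<^sub>C d2 x"
proof -
  have "\<forall>i k. complex_linear (torus_phi c1 c2 d1 d2 tau x $ i $ k)"
    using assms by (simp add: forall_3 torus_phi_def complex_linear_simps)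
  hence "slice (vec_hat f s) (vec_hat g s) (torus_phi c1 c2 d1 d2 tau x) =
    (\<Sum>i\<in>UNIV. \<Sum>k\<in>UNIV. (cnj (vec_hat f s $ i) * vec_hat g s $ k) *\<^sub>C torus_phi c1 c2 d1 d2 tau x $ i $ k)"
    by (intro slice_eq_sum) blast
  also have "\<dots> = tau x + (cnj c1 * g s $ 1) *\<^sub>C dagger d1 x + (cnj c2 * g s $ 2) *\<^sub>C dagger d2 x
      + (cnj (f s $ 1) * c1) *\<^sub>C d1 x + (cnj (f s $ 2) * c2) *\<^sub>C d2 x"
  proof -
    have z: "a *\<^sub>C (0 :: h \<Rightarrow>\<^sub>L h) = 0" for a
      by (rule blinfun_eqI) (simp add: scaleC_blinfun.rep_eq scaleC.zero_right)
    show ?thesis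
      by (simp add: sum_3 torus_phi_def vec_hat_def scaleC_one scaleC_scaleC z mult.commute add.assoc)
  qed
  finally show ?thesis .
qed

theorem theorem6p9:
  fixes lam c1 c2 :: complex
    and d1 d2 tau :: "(h \<Rightarrow>\<^sub>L h) \<Rightarrow> (h \<Rightarrow>\<^sub>L h)"
  assumes lam: "cmod lam = 1"
    and d1: "complex_linear_on (torus_A0 lam) d1" "d1 ` torus_A0 lam \<subseteq> torus_A0 lam"
      "\<And>m n. d1 (torus_basis lam m n) = of_int m *\<^sub>C torus_basis lam m n"
    and d2: "complex_linear_on (torus_A0 lam) d2" "d2 ` torus_A0 lam \<subseteq> torus_A0 lam"
      "\<And>m n. d2 (torus_basis lam m n) = of_int n *\<^sub>C torus_basis lam m n"
    and tau: "complex_linear_on (torus_A0 lam) tau" "tau ` torus_A0 lam \<subseteq> torus_A0 lam"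
      "\<And>m n. tau (torus_basis lam m n) =
        complex_of_real (- (1 / 2) * ((cmod c1)\<^sup>2 * (of_int m)\<^sup>2 + (cmod c2)\<^sup>2 * (of_int n)\<^sup>2))
          *\<^sub>C torus_basis lam m n"
  defines "phi \<equiv> torus_phi c1 c2 d1 d2 tau"
  shows "\<exists>j :: real \<Rightarrow> (h \<Rightarrow>\<^sub>L h) \<Rightarrow> (h_fock \<Rightarrow>\<^sub>L h_fock).
    (\<forall>t\<ge>0. unital_star_hom (torus_A lam) (j t)) \<and>
    adapted (torus_A lam) j \<and>
    (\<forall>u v. \<forall>f\<in>L2_half_line. \<forall>g\<in>L2_half_line. \<forall>x\<in>torus_A0 lam. \<forall>t\<ge>0.
      set_integrable lborel {0..t} (\<lambda>s. cinner (exp_tensor u f)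
        (j s (slice (vec_hat f s) (vec_hat g s) (phi x)) (exp_tensor v g))) \<and>
      cinner (exp_tensor u f) (j t x (exp_tensor v g)) =
        cinner (exp_tensor u f) (exp_tensor (x v) g) +
        (LINT s:{0..t}|lborel. cinner (exp_tensor u f)
          (j s (slice (vec_hat f s) (vec_hat g s) (phi x)) (exp_tensor v g))))"
proof (intro exI[of _ "flow c1 c2"] conjI[OF _ conjI] allI impI ballI)
  show "unital_star_hom (torus_A lam) (flow c1 c2 t)" for t
    by (rule unital_star_hom_flow) (rule complex_linear_torus_A[OF lam])
  show "adapted (torus_A lam) (flow c1 c2)"
    by (rule adapted_flow) (rule complex_linear_torus_A[OF lam])
  fix u v :: h and f g x and t :: real
  assume f: "f \<in> L2_half_line" and g: "g \<in> L2_half_line" and x: "x \<in> torus_A0 lam" and t: "0 \<le> t"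
  define S where "S x s = slice (vec_hat f s) (vec_hat g s) (phi x)" for x s
  let ?J = "\<lambda>x s. cinner (exp_tensor u f) (flow c1 c2 s (S x s) (exp_tensor v g))"
  note cl = complex_linear_torus_A0[OF lam]
  have cl_d: "complex_linear (tau y)" "complex_linear (d1 y)" "complex_linear (d2 y)"
    "complex_linear (dagger d1 y)" "complex_linear (dagger d2 y)" if "y \<in> torus_A0 lam" for y
    using that tau(2) d1(2) d2(2) dagger_torus_A0(3)[OF lam d1(1,2) that that] dagger_torus_A0(3)[OF lam d2(1,2) that that]
    by (auto intro!: cl)
  have S: "S y s = tau y + (cnj c1 * g s $ 1) *\<^sub>C dagger d1 y + (cnj c2 * g s $ 2) *\<^sub>C dagger d2 y
      + (cnj (f s $ 1) * c1) *\<^sub>C d1 y + (cnj (f s $ 2) * c2) *\<^sub>C d2 y" if "y \<in> torus_A0 lam" for y s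
    unfolding S_def phi_def by (rule slice_torus_phi) (use cl_d that in auto)
  \<comment> \<open>The linearity rules for \<open>flow\<close> concern complex-linear operators, so
    every slice must be known to be one.\<close>
  have cl_S: "complex_linear (S y s)" if "y \<in> torus_A0 lam" for y s
    unfolding S[OF that] by (intro complex_linear_simps cl_d that)
  have closed: "y + z \<in> torus_A0 lam" "c *\<^sub>C y \<in> torus_A0 lam" if "y \<in> torus_A0 lam" "z \<in> torus_A0 lam" for y z c
    using that by (auto simp: torus_A0_def intro: star_subalgebra.intros)
  have S_add: "S (y + z) s = S y s + S z s" if "y \<in> torus_A0 lam" "z \<in> torus_A0 lam" for y z s
    using that d1(1) d2(1) tau(1) dagger_torus_A0(1)[OF lam d1(1,2) that] dagger_torus_A0(1)[OF lam d2(1,2) that]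
    by (simp add: S closed complex_linear_on_def scaleC_add_right)
  have S_scale: "S (c *\<^sub>C y) s = c *\<^sub>C S y s" if "y \<in> torus_A0 lam" for c y s
    using that d1(1) d2(1) tau(1) dagger_torus_A0(2)[OF lam d1(1,2) that that] dagger_torus_A0(2)[OF lam d2(1,2) that that]
    by (simp add: S closed[OF that that] complex_linear_on_def scaleC_add_right scaleC_scaleC mult.commute)
  have S_basis: "S (torus_basis lam m n) s = rate c1 c2 m n (f s) (g s) *\<^sub>C torus_basis lam m n" for m n s
  proof -
    let ?b = "torus_basis lam m n"
    have b: "?b \<in> torus_A0 lam" and nb: "torus_basis lam (- m) (- n) \<in> torus_A0 lam"
      by (rule torus_basis_A0[OF lam])+
    \<comment> \<open>The adjoint of a monomial is a multiple of the one with exponents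
      \<open>- m\<close> and \<open>- n\<close>. Taking adjoints again preserves these real
      eigenvalues, so each dagger map is the negative of the original on the basis.\<close>
    have "d1 (adjoint_op ?b) = - of_int m *\<^sub>C adjoint_op ?b" "d2 (adjoint_op ?b) = - of_int n *\<^sub>C adjoint_op ?b"
      using d1(1) d2(1) nb d1(3)[of "- m" "- n"] d2(3)[of "- m" "- n"]
      by (simp_all add: torus_basis_adjoint[OF lam] complex_linear_on_def scaleC_scaleC mult.commute)
    hence dg: "dagger d1 ?b = - of_int m *\<^sub>C ?b" "dagger d2 ?b = - of_int n *\<^sub>C ?b"
      using dagger_eigenvector[OF cl[OF b]] by simp_all
    show ?thesis
      \<comment> \<open>The five eigenvalues add up to \<open>rate\<close>: the dagger terms supply
        the negative terms in \<open>g\<close>, and \<open>tau\<close> supplies the half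
        squares.\<close>
      unfolding S[OF b] dg d1(3) d2(3) tau(3) scaleC_scaleC scaleC_add_left[symmetric]
      by (rule arg_cong[where f = "\<lambda>c. c *\<^sub>C ?b"]) (simp add: rate_def algebra_simps)
  qed
  have J_add: "?J (y + z) s = ?J y s + ?J z s" if "y \<in> torus_A0 lam" "z \<in> torus_A0 lam" for y z s
    using that by (simp add: S_add flow_add cl_S blinfun.add_left cinner_add_right)
  have J_scale: "?J (c *\<^sub>C y) s = c * ?J y s" if "y \<in> torus_A0 lam" for c y s
    using that by (simp add: S_scale flow_scaleC cl_S scaleC_blinfun.rep_eq cinner_scaleC_right)
  have "x \<in> torus_span lam" using x torus_A0_eq_span[OF lam] by simp
  \<comment> \<open>Integrability is carried through the induction because additivity of the
    integral relies on it.\<close>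
  hence "set_integrable lborel {0..t} (?J x) \<and> cinner (exp_tensor u f) (flow c1 c2 t x (exp_tensor v g)) =
    cinner (exp_tensor u f) (exp_tensor (x v) g) + (LINT s:{0..t}|lborel. ?J x s)"
  proof induction
    case (basis m n)
    show ?case
      unfolding S_basis using flow_torus_basis_qsde[OF lam f g t] by blast
  next
    case (add a b)
    hence ab: "a \<in> torus_A0 lam" "b \<in> torus_A0 lam" using torus_A0_eq_span[OF lam] by simp_all
    show ?case
      using add.IH unfolding J_add[OF ab]
      by (simp add: flow_add cl ab blinfun.add_left cinner_add_right cinner_exp_tensor[OF f g] distrib_right)
  next
    case (scale a c)
    hence a: "a \<in> torus_A0 lam" using torus_A0_eq_span[OF lam] by simp
    show ?case
      using scale.IH unfolding J_scale[OF a]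
      by (simp add: flow_scaleC cl a scaleC_blinfun.rep_eq cinner_scaleC_right cinner_exp_tensor[OF f g] distrib_left)
  qed
  thus "set_integrable lborel {0..t} (\<lambda>s. cinner (exp_tensor u f)
        (flow c1 c2 s (slice (vec_hat f s) (vec_hat g s) (phi x)) (exp_tensor v g))) \<and>
      cinner (exp_tensor u f) (flow c1 c2 t x (exp_tensor v g)) =
        cinner (exp_tensor u f) (exp_tensor (x v) g) +
        (LINT s:{0..t}|lborel. cinner (exp_tensor u f)
          (flow c1 c2 s (slice (vec_hat f s) (vec_hat g s) (phi x)) (exp_tensor v g)))"
    unfolding S_def .
qed

end
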